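(* For each $q\in\{1,2\}$, $$\lim_{N\to\infty}\ \sum_{n\le N}\lambda_{n,N}\,F_n^{(q)} = q .$$
   Context: Here $\zeta$ is the Riemann zeta function and $\mu_n=\mu(n)$ is the Möbius function. For integers $N\ge 2$ and $1\le n\le N$, $\lambda_{n,N}=\mu_n\left(1-\frac{\log n}{\log N}\right)$. For $q=1,2$ and $n\ge1$, $$F_n^{(q)}=\frac{1}{2\pi i}\int_{\Re(s)=1/2} n^{-s}\,\frac{\zeta(s)}{s^q(1-s)^q}\,ds ,$$ where the vertical line is traversed upwards, from $1/2-i\infty$ to $1/2+i\infty$. *)

theory Defs
  imports
    "HOL-Complex_Analysis.Complex_Analysis"
    "HOL-Computational_Algebra.Squarefree"
begin

(* The value 0 at the pole is a dummy that makes the description unique. *)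
definition riemann_zeta :: "complex \<Rightarrow> complex" where
  "riemann_zeta = (THE f. f holomorphic_on - {1} \<and>
     (\<forall>s. Re s > 1 \<longrightarrow> (\<lambda>n. of_nat (Suc n) powr (-s)) sums f s) \<and> f 1 = 0)"

definition moebius_mu :: "nat \<Rightarrow> int" where
  "moebius_mu n = (if squarefree n then (-1) ^ card (prime_factors n) else 0)"

definition lambda_coeff :: "nat \<Rightarrow> nat \<Rightarrow> real" where
  "lambda_coeff n N = of_int (moebius_mu n) * (1 - ln (real n) / ln (real N))"

(* The integral of f ds over the line Re s = c traversed upwards: s = c + i t, ds = i dt. *)
definition vertical_line_integral :: "real \<Rightarrow> (complex \<Rightarrow> complex) \<Rightarrow> complex" where
  "vertical_line_integral c f = (\<integral>t. f (Complex c t) * \<i> \<partial>lborel)"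

definition F_coeff :: "nat \<Rightarrow> nat \<Rightarrow> complex" where
  "F_coeff q n = 1 / (2 * of_real pi * \<i>) *
     vertical_line_integral (1/2)
       (\<lambda>s. of_nat n powr (-s) * (riemann_zeta s / (s ^ q * (1 - s) ^ q)))"

(* The rest of the theory shows that the description of riemann_zeta is satisfied by exactly
   one function. *)

definition tail_zeta :: "complex \<Rightarrow> complex" where
  "tail_zeta s = (\<Sum>n. of_nat (n + 2) powr (-s))"

lemma norm_tail_term: "norm (of_nat (n + 2) powr (-s) :: complex) = real (n + 2) powr (- Re s)"
  by (subst norm_powr_real_powr) auto

lemma summable_tail_real: "a > 1 \<Longrightarrow> summable (\<lambda>n. real (n + 2) powr (- a))"
  using summable_ignore_initial_segment[of "\<lambda>n. real n powr (- a)" 2] summable_real_powr_iff[of "-a"] by simp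

lemma tail_sums:
  assumes "Re s > 1"
  shows "(\<lambda>n. of_nat (n + 2) powr (-s)) sums tail_zeta s"
  unfolding tail_zeta_def
  by (rule summable_sums, rule summable_norm_cancel, unfold norm_tail_term) (rule summable_tail_real[OF assms])

lemma tail_holomorphic: "tail_zeta holomorphic_on {s. Re s > 1}"
proof -
  have op: "open {s. Re s > 1}" by (simp add: open_halfspace_Re_gt)
  obtain g where g: "\<forall>x\<in>{s. Re s > 1}. ((\<lambda>n. of_nat (n + 2) powr (-x)) sums g x) \<and> g field_differentiable (at x)"
  proof (rule series_differentiable_comparison_complex[OF op, where f = "\<lambda>n x. of_nat (n + 2) powr (-x)"])
    fix n :: nat and x :: complex
    have "(\<lambda>x. of_nat (n + 2) powr (-x) :: complex) holomorphic_on UNIV"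
      by (intro holomorphic_intros)
    thus "(\<lambda>x. of_nat (n + 2) powr (-x) :: complex) field_differentiable at x"
      by (simp add: holomorphic_on_def)
  next
    fix x :: complex assume x: "x \<in> {s. Re s > 1}"
    define d where "d = (Re x - 1) / 2"
    have d: "d > 0" using x by (simp add: d_def)
    define h :: "nat \<Rightarrow> complex" where "h = (\<lambda>n. of_real (real (n + 2) powr (- (1 + d))))"
    have "summable h" unfolding h_def summable_of_real_iff by (rule summable_tail_real) (use d in simp)
    moreover have "range h \<subseteq> \<real>\<^sub>\<ge>\<^sub>0" by (auto simp: h_def)
    moreover have "cmod (of_nat (n + 2) powr (-y)) \<le> cmod (h n)" if "y \<in> ball x d \<inter> {s. Re s > 1}" for n y
    proof -
      have "\<bar>Re x - Re y\<bar> < d"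
        using that abs_Re_le_cmod[of "x - y"] by (simp add: dist_norm)
      hence "Re y \<ge> 1 + d" unfolding d_def by (auto simp: abs_if field_simps split: if_splits)
      thus ?thesis unfolding norm_tail_term h_def norm_of_real
        by (simp add: powr_mono)
    qed
    ultimately show "\<exists>d h. 0 < d \<and> summable h \<and> range h \<subseteq> \<real>\<^sub>\<ge>\<^sub>0 \<and>
        (\<forall>\<^sub>F n in sequentially. \<forall>y\<in>ball x d \<inter> {s. Re s > 1}. cmod (of_nat (n + 2) powr (-y)) \<le> cmod (h n))"
      using d by (intro exI[of _ d] exI[of _ h]) auto
  qed
  show ?thesis
    unfolding holomorphic_on_open[OF op]
  proof (rule ballI)
    fix x assume x: "x \<in> {s. Re s > 1}"
    have eq: "g y = tail_zeta y" if "y \<in> {s. Re s > 1}" for y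
      using g that tail_sums[of y] sums_unique2 by blast
    obtain f' where "(g has_field_derivative f') (at x)" using g x unfolding field_differentiable_def by blast
    hence "(tail_zeta has_field_derivative f') (at x)"
      by (rule has_field_derivative_transform_within_open[OF _ op x eq])
    thus "\<exists>f'. (tail_zeta has_field_derivative f') (at x)" ..
  qed
qed

lemma tail_bound: "\<exists>C\<ge>0. \<forall>s. Re s \<ge> 2 \<longrightarrow> norm (tail_zeta s) \<le> C * 2 powr (- Re s)"
proof (intro exI conjI allI impI)
  let ?C = "4 * (\<Sum>n. real (n + 2) powr (- 2))"
  have sm: "summable (\<lambda>n. real (n + 2) powr (- 2))" by (rule summable_tail_real) simp
  show "?C \<ge> 0" by (intro mult_nonneg_nonneg suminf_nonneg sm) auto
  fix s :: complex assume s: "Re s \<ge> 2"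
  have le: "real (n + 2) powr (- Re s) \<le> real (n + 2) powr (- 2) * (4 * 2 powr (- Re s))" for n
  proof -
    have "real (n + 2) powr (- Re s) = real (n + 2) powr (- 2) * real (n + 2) powr (- (Re s - 2))"
      by (simp add: powr_add[symmetric])
    also have "\<dots> \<le> real (n + 2) powr (- 2) * 2 powr (- (Re s - 2))"
      by (intro mult_left_mono powr_mono2') (use s in auto)
    also have "(2::real) powr (- (Re s - 2)) = 4 * 2 powr (- Re s)"
      by (simp add: powr_diff powr_minus field_simps)
    finally show ?thesis .
  qed
  have sm': "summable (\<lambda>n. real (n + 2) powr (- Re s))" by (rule summable_tail_real) (use s in simp)
  have "norm (tail_zeta s) \<le> (\<Sum>n. real (n + 2) powr (- Re s))"
    unfolding tail_zeta_def norm_tail_term[symmetric]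
    by (rule summable_norm) (unfold norm_tail_term, rule sm')
  also have "\<dots> \<le> (\<Sum>n. real (n + 2) powr (- 2) * (4 * 2 powr (- Re s)))"
    by (intro suminf_le le sm' summable_mult2 sm)
  also have "\<dots> = ?C * 2 powr (- Re s)"
    by (subst suminf_mult2[OF sm, symmetric]) simp
  finally show "norm (tail_zeta s) \<le> ?C * 2 powr (- Re s)" .
qed

lemma summable_poch: "summable (\<lambda>j. pochhammer (a::real) (j + 2) / fact (j + 2) * (1/2) ^ j)"
proof -
  have "summable (\<lambda>n. ((-a) gchoose n) * (-1/2) ^ n)"
    using gen_binomial_real[of "-1/2" "-a"] by (simp add: sums_iff)
  also have "(\<lambda>n. ((-a) gchoose n) * (-1/2) ^ n) = (\<lambda>n. pochhammer a n / fact n * (1/2) ^ n)"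
    by (rule ext) (simp add: gbinomial_pochhammer power_mult_distrib[symmetric] flip: power_divide)
  finally have "summable (\<lambda>j. pochhammer a (j+2) / fact (j+2) * (1/2) ^ (j+2))"
    by (rule summable_ignore_initial_segment)
  from summable_mult[OF this, of 4] show ?thesis
    by (simp add: mult_ac power_add power2_eq_square del: fact_Suc pochhammer_Suc add_2_eq_Suc')
qed

lemma pochhammer_nonneg': "(a::real) \<ge> 0 \<Longrightarrow> pochhammer a n \<ge> 0"
  by (simp add: pochhammer_prod prod_nonneg)

lemma norm_pochhammer_le:
  assumes "norm (z::complex) \<le> a"
  shows "norm (pochhammer z n) \<le> pochhammer a n"
  unfolding pochhammer_prod prod_norm[symmetric]
proof (rule prod_mono, safe)
  fix i
  show "norm (z + of_nat i) \<le> a + of_nat i"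
    by (rule order.trans[OF norm_triangle_ineq]) (use assms in simp)
qed simp

(* For Re s > 1, expand (n-1)^(1-s) - n^(1-s) binomially in powers of 1/n and sum over n >= 2;
   the left-hand sides telescope to 1.  The resulting identity extends (s - 1) tail_zeta s
   to the left, one unit strip at a time. *)
lemma tail_recursion:
  assumes s: "Re s > 1"
  shows "(\<lambda>j. pochhammer (s - 1) (j + 2) / fact (j + 2) * tail_zeta (s + of_nat (j + 1)))
           sums (1 - (s - 1) * tail_zeta s)"
proof -
  define b where "b = (\<lambda>n j. pochhammer (s - 1) (j + 2) / fact (j + 2) *
                         of_nat (n + 2) powr (- (s + of_nat (j + 1))) :: complex)"
  define R where "R = (\<lambda>n. (of_nat (n + 1) powr (1 - s) - of_nat (n + 2) powr (1 - s))
                         - (s - 1) * of_nat (n + 2) powr (- s) :: complex)"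
  have row: "(\<lambda>j. b n j) sums R n" for n
  proof -
    have "(\<lambda>k. ((1 - s) gchoose k) * of_real (real (n + 2)) powr (1 - s - of_nat k) * of_real (- 1) ^ k)
             sums of_real (real (n + 2) + (- 1)) powr (1 - s)"
      by (rule gen_binomial_complex''[where x = "real (n + 2)" and y = "- 1" and a = "1 - s"]) linarith
    moreover have "((1 - s) gchoose k) * of_real (real (n + 2)) powr (1 - s - of_nat k) * of_real (- 1) ^ k
        = pochhammer (s - 1) k / fact k * of_nat (n + 2) powr (1 - s - of_nat k)" for k
    proof -
      have "((-1) ^ k * (-1) ^ k :: complex) = 1" by (simp flip: power_mult_distrib)
      moreover have "e * p / q * r * e = (e * e) * (p / q * r)" for e p q r :: complex
        by (simp only: times_divide_eq_left times_divide_eq_right mult_ac)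
      ultimately have "(-1) ^ k * p / q * r * (-1) ^ k = p / q * r" for p q r :: complex
        by (metis mult_1_left)
      thus ?thesis unfolding gbinomial_pochhammer minus_diff_eq
        by (simp only: of_real_of_nat_eq of_real_minus of_real_1)
    qed
    moreover have "complex_of_real (real (n + 2) + (- 1)) = of_nat (n + 1)"
    proof -
      have "real (n + 2) + (- 1) = real (n + 1)" by linarith
      thus ?thesis by (simp only: of_real_of_nat_eq)
    qed
    ultimately have "(\<lambda>k. pochhammer (s - 1) k / fact k * of_nat (n + 2) powr (1 - s - of_nat k))
        sums of_nat (n + 1) powr (1 - s)" by (simp only:)
    from sums_split_initial_segment[OF this, of 2]
    have "(\<lambda>j. pochhammer (s - 1) (j + 2) / fact (j + 2) * of_nat (n + 2) powr (1 - s - of_nat (j + 2))) sums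
        (of_nat (n + 1) powr (1 - s)
          - (\<Sum>k<2. pochhammer (s - 1) k / fact k * of_nat (n + 2) powr (1 - s - of_nat k)))" .
    also have "(\<Sum>k<2. pochhammer (s - 1) k / fact k * of_nat (n + 2) powr (1 - s - of_nat k))
        = of_nat (n + 2) powr (1 - s) + (s - 1) * of_nat (n + 2) powr (- s)"
      by (simp add: lessThan_nat_numeral)
    also have "of_nat (n + 1) powr (1 - s) - \<dots> = R n"
      unfolding R_def by (simp only: diff_diff_eq)
    finally have "(\<lambda>j. pochhammer (s - 1) (j + 2) / fact (j + 2) *
        of_nat (n + 2) powr (1 - s - of_nat (j + 2))) sums R n" .
    moreover have "1 - s - of_nat (j + 2) = - (s + of_nat (j + 1))" for j by simp
    ultimately show ?thesis by (simp only: b_def)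
  qed
  have col: "(\<lambda>n. b n j) sums (pochhammer (s - 1) (j + 2) / fact (j + 2) * tail_zeta (s + of_nat (j + 1)))" for j
    unfolding b_def by (intro sums_mult tail_sums) (use s in auto)
  have Rsums: "R sums (1 - (s - 1) * tail_zeta s)"
  proof -
    have "(\<lambda>n. of_nat (n + 1) powr (1 - s) :: complex) \<longlonglongrightarrow> 0"
    proof (rule tendsto_norm_zero_cancel)
      have *: "norm (of_nat (n + 1) powr (1 - s) :: complex) = real (n + 1) powr (1 - Re s)" for n
        by (subst norm_powr_real_powr) auto
      have "(\<lambda>n. real (n + 1) powr (1 - Re s)) \<longlonglongrightarrow> 0"
        by (rule tendsto_neg_powr[OF _ filterlim_compose[OF filterlim_real_sequentially filterlim_add_const_nat_at_top]])
          (use s in simp)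
      thus "(\<lambda>n. norm (of_nat (n + 1) powr (1 - s) :: complex)) \<longlonglongrightarrow> 0" unfolding * .
    qed
    from telescope_sums'[OF this]
    have "(\<lambda>n. of_nat (n + 1) powr (1 - s) - of_nat (n + 2) powr (1 - s) :: complex) sums 1" by simp
    thus ?thesis unfolding R_def by (intro sums_diff sums_mult tail_sums s)
  qed
  define A where "A = (\<lambda>j. pochhammer (norm (s - 1)) (j + 2) / fact (j + 2) * (1/2) ^ j :: real)"
  have A0: "A j \<ge> 0" for j by (simp add: A_def pochhammer_nonneg' del: add_2_eq_Suc')
  have Asm: "summable A" unfolding A_def by (rule summable_poch)
  have bb: "norm (b n j) \<le> real (n + 2) powr (- (Re s + 1)) * A j" for n j
  proof -
    have "norm (b n j) = norm (pochhammer (s - 1) (j + 2)) / fact (j + 2) * real (n + 2) powr (- (Re s + 1 + real j))"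
      unfolding b_def norm_mult norm_divide norm_tail_term norm_fact by (simp only: plus_complex.sel complex_Re_of_nat of_nat_add of_nat_1 one_complex.sel add_ac)
    also have "real (n + 2) powr (- (Re s + 1 + real j)) = real (n + 2) powr (- (Re s + 1)) * real (n + 2) powr (- real j)"
      by (simp add: powr_add[symmetric])
    also have "norm (pochhammer (s - 1) (j + 2)) / fact (j + 2) * \<dots>
        \<le> pochhammer (norm (s - 1)) (j + 2) / fact (j + 2) * (real (n + 2) powr (- (Re s + 1)) * (1/2) ^ j)"
    proof (intro mult_mono divide_right_mono)
      show "norm (pochhammer (s - 1) (j + 2)) \<le> pochhammer (norm (s - 1)) (j + 2)"
        by (rule norm_pochhammer_le) simp
      have "real (n + 2) powr (- real j) \<le> 2 powr (- real j)" by (rule powr_mono2') auto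
      also have "\<dots> = (1/2) ^ j" by (simp add: powr_minus powr_realpow field_simps)
      finally show "real (n + 2) powr (- real j) \<le> (1/2) ^ j" .
    qed (simp_all add: pochhammer_nonneg' del: add_2_eq_Suc')
    also have "\<dots> = real (n + 2) powr (- (Re s + 1)) * A j"
      unfolding A_def by (simp only: mult_ac)
    finally show ?thesis .
  qed
  have "(\<lambda>(n, j). real (n + 2) powr (- (Re s + 1)) * A j) summable_on UNIV \<times> UNIV"
  proof (rule summable_on_SigmaI)
    show "((\<lambda>j. case (n, j) of (n, j) \<Rightarrow> real (n + 2) powr (- (Re s + 1)) * A j)
        has_sum (real (n + 2) powr (- (Re s + 1)) * suminf A)) UNIV" for n :: nat
      by (simp, intro sums_nonneg_imp_has_sum sums_mult summable_sums Asm) (use A0 in auto)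
    have "summable (\<lambda>n. real (n + 2) powr (- (Re s + 1)) * suminf A)"
      by (intro summable_mult2 summable_tail_real) (use s in simp)
    thus "(\<lambda>n. real (n + 2) powr (- (Re s + 1)) * suminf A) summable_on UNIV"
      using A0 Asm by (subst summable_on_UNIV_nonneg_real_iff) (auto intro!: mult_nonneg_nonneg suminf_nonneg)
  qed (use A0 in auto)
  hence "(\<lambda>x. norm (case x of (n, j) \<Rightarrow> b n j)) summable_on UNIV \<times> UNIV"
    by (rule summable_on_comparison_test) (use bb in auto)
  hence bsm: "(\<lambda>(n, j). b n j) summable_on UNIV \<times> UNIV"
    by (rule abs_summable_summable)
  have "(\<lambda>(n, j). b n j) \<circ> prod.swap summable_on (UNIV \<times> UNIV)"
    using bsm by (subst summable_on_reindex[symmetric]) (auto simp: product_swap)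
  hence bsm': "(\<lambda>(j, n). b n j) summable_on UNIV \<times> UNIV"
    by (simp add: o_def case_prod_unfold prod.swap_def)
  have row': "infsum (b n) UNIV = R n" for n
  proof -
    have "summable (\<lambda>j. norm (b n j))"
      by (rule summable_comparison_test'[OF summable_mult[OF Asm], of 0]) (use bb in simp)
    from norm_summable_imp_has_sum[OF this row] show ?thesis by (rule infsumI)
  qed
  have col': "infsum (\<lambda>n. b n j) UNIV = pochhammer (s - 1) (j + 2) / fact (j + 2) * tail_zeta (s + of_nat (j + 1))" for j
  proof -
    have "summable (\<lambda>n. norm (b n j))"
      by (rule summable_comparison_test'[OF summable_mult2[OF summable_tail_real], of "Re s + 1" 0])
        (use bb s in auto)
    from norm_summable_imp_has_sum[OF this col] show ?thesis by (rule infsumI)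
  qed
  have "(\<lambda>j. infsum (\<lambda>n. b n j) UNIV) summable_on UNIV"
    using summable_on_Sigma_banach[OF bsm'] .
  hence "(\<lambda>j. infsum (\<lambda>n. b n j) UNIV) sums infsum (\<lambda>j. infsum (\<lambda>n. b n j) UNIV) UNIV"
    by (intro has_sum_imp_sums has_sum_infsum)
  also have "infsum (\<lambda>j. infsum (\<lambda>n. b n j) UNIV) UNIV = infsum (\<lambda>n. infsum (b n) UNIV) UNIV"
    using infsum_swap_banach[OF bsm, symmetric] by simp
  also have "\<dots> = 1 - (s - 1) * tail_zeta s"
  proof -
    have "(\<lambda>n. infsum (b n) UNIV) summable_on UNIV"
      using summable_on_Sigma_banach[OF bsm] .
    hence "R summable_on UNIV" unfolding row' .
    from sums_unique2[OF has_sum_imp_sums[OF has_sum_infsum[OF this]] Rsums]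
    show ?thesis unfolding row' .
  qed
  finally show ?thesis unfolding col' .
qed

lemma tail_continuation:
  "\<exists>H. H holomorphic_on {s. Re s > 1 - real m} \<and> (\<forall>s. Re s > 1 \<longrightarrow> H s = (s - 1) * tail_zeta s)"
proof (induction m)
  case 0
  show ?case
    by (rule exI[of _ "\<lambda>s. (s - 1) * tail_zeta s"]) (auto intro!: holomorphic_intros tail_holomorphic)
next
  case (Suc m)
  then obtain H where H: "H holomorphic_on {s. Re s > 1 - real m}"
    and Heq: "\<And>s. Re s > 1 \<Longrightarrow> H s = (s - 1) * tail_zeta s" by blast
  obtain C where C: "C \<ge> 0" "\<And>s. Re s \<ge> 2 \<Longrightarrow> norm (tail_zeta s) \<le> C * 2 powr (- Re s)"
    using tail_bound by blast
  let ?S = "{s. Re s > 1 - real (Suc m)}"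
  let ?f = "\<lambda>j s. pochhammer (s - 1) (j + 1) / fact (j + 2) * H (s + of_nat (j + 1))"
  have op: "open ?S" by (simp only: open_halfspace_Re_gt)
  have f: "?f j holomorphic_on ?S" for j
  proof -
    have "(\<lambda>s. H (s + of_nat (j + 1))) holomorphic_on ?S"
      by (rule holomorphic_on_compose_gen[of "\<lambda>s. s + of_nat (j + 1)" _ H, unfolded o_def, OF _ H])
         (auto intro!: holomorphic_intros)
    thus ?thesis unfolding pochhammer_prod by (intro holomorphic_intros) auto
  qed
  obtain g where g: "\<forall>x\<in>?S. ((\<lambda>j. ?f j x) sums g x) \<and> g field_differentiable (at x)"
  proof (rule series_differentiable_comparison_complex[OF op, where f = ?f])
    fix n x assume "x \<in> ?S"
    thus "?f n field_differentiable at x" using f[of n] op holomorphic_on_imp_differentiable_at by blast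
  next
    fix x assume "x \<in> ?S"
    define R where "R = norm x + 1"
    define h :: "nat \<Rightarrow> complex" where
      "h = (\<lambda>j. of_real (C * 2 powr R * (pochhammer (R + 1) (j + 2) / fact (j + 2) * (1/2) ^ j)))"
    have R: "R \<ge> 1" by (simp add: R_def)
    have h0: "C * 2 powr R * (pochhammer (R + 1) (j + 2) / fact (j + 2) * (1/2) ^ j) \<ge> 0" for j
      using C(1) R by (intro mult_nonneg_nonneg divide_nonneg_nonneg pochhammer_nonneg) auto
    have "summable h" unfolding h_def summable_of_real_iff by (intro summable_mult summable_poch)
    moreover have "range h \<subseteq> \<real>\<^sub>\<ge>\<^sub>0" using h0 by (auto simp only: h_def nonneg_Reals_of_real_iff)
    moreover have "norm (?f j y) \<le> norm (h j)" if j: "j \<ge> nat \<lceil>R + 1\<rceil>" and y: "y \<in> ball x 1 \<inter> ?S" for j y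
    proof -
      have jR: "real j \<ge> R + 1" using j by linarith
      have yR: "norm y \<le> R"
        using y norm_triangle_ineq2[of y x] by (simp add: R_def dist_norm norm_minus_commute)
      have Rey: "\<bar>Re y\<bar> \<le> R" using abs_Re_le_cmod[of y] yR by simp
      have re2: "Re (y + of_nat (j + 1)) \<ge> 2" using Rey jR R by simp
      have "norm (H (y + of_nat (j + 1))) = norm (y + of_nat j) * norm (tail_zeta (y + of_nat (j + 1)))"
        using re2 by (subst Heq) (simp_all add: norm_mult)
      also have "norm (y + of_nat j) \<le> R + 1 + real (j + 1)"
        by (rule order.trans[OF norm_triangle_ineq]) (use yR in simp)
      also have "norm (tail_zeta (y + of_nat (j + 1))) \<le> C * 2 powr (- Re (y + of_nat (j + 1)))"
        by (rule C(2)) (rule re2)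
      also have "(2::real) powr (- Re (y + of_nat (j + 1))) \<le> 2 powr (R - real j)"
        by (rule powr_mono) (use Rey in auto)
      also have "(2::real) powr (R - real j) = 2 powr R * (1/2) ^ j"
        by (simp add: powr_diff powr_realpow field_simps)
      finally have Hb: "norm (H (y + of_nat (j + 1))) \<le> (R + 1 + real (j + 1)) * (C * (2 powr R * (1/2) ^ j))"
        using C(1) R by (simp add: mult_left_mono mult_right_mono)
      have pb: "norm (pochhammer (y - 1) (j + 1)) \<le> pochhammer (R + 1) (j + 1)"
        by (rule norm_pochhammer_le) (use norm_triangle_ineq4[of y 1] yR in simp)
      have "norm (?f j y) = norm (pochhammer (y - 1) (j + 1)) / fact (j + 2) * norm (H (y + of_nat (j + 1)))"
        by (simp only: norm_mult norm_divide norm_fact)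
      also have "\<dots> \<le> pochhammer (R + 1) (j + 1) / fact (j + 2) * ((R + 1 + real (j + 1)) * (C * (2 powr R * (1/2) ^ j)))"
        using pb Hb R by (intro mult_mono divide_right_mono divide_nonneg_nonneg pochhammer_nonneg) auto
      also have "\<dots> = C * 2 powr R * (pochhammer (R + 1) (j + 2) / fact (j + 2) * (1/2) ^ j)"
        using pochhammer_Suc[of "R + 1" "j + 1"] by simp
      also have "\<dots> = norm (h j)" unfolding h_def norm_of_real by (rule abs_of_nonneg[OF h0, symmetric])
      finally show ?thesis .
    qed
    ultimately show "\<exists>d h. 0 < d \<and> summable h \<and> range h \<subseteq> \<real>\<^sub>\<ge>\<^sub>0 \<and>
        (\<forall>\<^sub>F n in sequentially. \<forall>y\<in>ball x d \<inter> ?S. cmod (?f n y) \<le> cmod (h n))"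
      by (intro exI[of _ 1] exI[of _ h]) (auto simp only: eventually_at_top_linorder zero_less_one)
  qed
  have "(\<lambda>s. 1 - g s) holomorphic_on ?S"
    using g op by (intro holomorphic_intros) (auto simp: holomorphic_on_def intro: field_differentiable_at_within)
  moreover have "1 - g s = (s - 1) * tail_zeta s" if s: "Re s > 1" for s
  proof -
    have "?f j s = pochhammer (s - 1) (j + 2) / fact (j + 2) * tail_zeta (s + of_nat (j + 1))" for j
      using s pochhammer_Suc[of "s - 1" "j + 1"] by (subst Heq) simp_all
    hence "(\<lambda>j. ?f j s) sums (1 - (s - 1) * tail_zeta s)"
      using tail_recursion[OF s] by (simp only:)
    moreover have "(\<lambda>j. ?f j s) sums g s" using g s by auto
    ultimately have "1 - (s - 1) * tail_zeta s = g s" by (rule sums_unique2)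
    thus ?thesis by (simp only: diff_diff_eq2 add_diff_cancel_left' diff_eq_eq add.commute)
  qed
  ultimately show ?case by (intro exI[of _ "\<lambda>s. 1 - g s"]) blast
qed

lemma riemann_zeta_exists:
  "\<exists>f. f holomorphic_on - {1} \<and>
     (\<forall>s. Re s > 1 \<longrightarrow> (\<lambda>n. of_nat (Suc n) powr (-s)) sums f s) \<and> f 1 = 0"
proof -
  obtain H where H: "\<And>m. H m holomorphic_on {s. Re s > 1 - real m}"
    and Heq: "\<And>m s. Re s > 1 \<Longrightarrow> H m s = (s - 1) * tail_zeta s"
    using tail_continuation by metis
  have HH: "H m s = H n s" if "Re s > 1 - real m" "m \<le> n" for m n s
  proof (rule analytic_continuation_open[of "{s. Re s > 1}" "{s. Re s > 1 - real m}" "H m" "H n"])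
    show "H n holomorphic_on {s. Re s > 1 - real m}"
      by (rule holomorphic_on_subset[OF H]) (use that in auto)
    have "(2::complex) \<in> {s. Re s > 1}" by simp
    thus "{s. Re s > 1} \<noteq> {}" by blast
  qed (use H Heq that in \<open>auto simp: open_halfspace_Re_gt intro!: convex_connected convex_halfspace_Re_gt\<close>)
  define m where "m = (\<lambda>s. nat \<lceil>2 - Re s\<rceil>)"
  have m: "Re s > 1 - real (m s)" for s unfolding m_def by linarith
  define G where "G = (\<lambda>s. H (m s) s)"
  have Geq: "G s = H k s" if "Re s > 1 - real k" for k s
    unfolding G_def using HH[OF m, where n = k] HH[OF that, where n = "m s", symmetric] nat_le_linear[of "m s" k] by blast
  have G: "G holomorphic_on UNIV"
  proof (subst holomorphic_on_open[OF open_UNIV], safe)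
    fix s
    have op: "open {z. Re z > 1 - real (m s)}" by (simp add: open_halfspace_Re_gt)
    have s: "s \<in> {z. Re z > 1 - real (m s)}" using m by simp
    obtain f' where "(H (m s) has_field_derivative f') (at s)"
      using H[of "m s"] s holomorphic_on_open[OF op] by blast
    hence "(G has_field_derivative f') (at s)"
      by (rule has_field_derivative_transform_within_open[OF _ op s]) (use Geq in auto)
    thus "\<exists>f'. (G has_field_derivative f') (at s)" ..
  qed
  define f where "f = (\<lambda>s. if s = 1 then 0 else 1 + G s / (s - 1))"
  have "(\<lambda>s. 1 + G s / (s - 1)) holomorphic_on - {1}"
    by (intro holomorphic_intros holomorphic_on_subset[OF G]) auto
  hence "f holomorphic_on - {1}"
    by (rule holomorphic_transform) (auto simp: f_def)
  moreover have "(\<lambda>n. of_nat (Suc n) powr (-s)) sums f s" if s: "Re s > 1" for s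
  proof -
    have s1: "s - 1 \<noteq> 0" 
    proof
      assume "s - 1 = 0"
      hence "s = 1" by simp
      thus False using s by simp
    qed
    have "G s = (s - 1) * tail_zeta s" using Geq[of 0 s] Heq[OF s, of 0] s by simp
    hence "f s = tail_zeta s + 1" using s1 by (simp add: f_def)
    moreover have "(\<lambda>n. of_nat (Suc (Suc n)) powr (-s)) sums tail_zeta s"
      using tail_sums[OF s] by simp
    hence "(\<lambda>n. of_nat (Suc n) powr (-s)) sums (tail_zeta s + of_nat (Suc 0) powr (-s))"
      by (rule sums_Suc)
    ultimately show ?thesis by simp
  qed
  moreover have "f 1 = 0" by (simp add: f_def)
  ultimately show ?thesis by blast
qed

lemma riemann_zeta_unique:
  assumes "f holomorphic_on - {1}" "g holomorphic_on - {1}"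
    and "\<And>s. Re s > 1 \<Longrightarrow> (\<lambda>n. of_nat (Suc n) powr (-s)) sums f s"
    and "\<And>s. Re s > 1 \<Longrightarrow> (\<lambda>n. of_nat (Suc n) powr (-s)) sums g s"
    and "f 1 = 0" "g 1 = 0"
  shows "f = g"
proof
  fix s
  show "f s = g s"
  proof (cases "s = 1")
    case False
    show ?thesis
    proof (rule analytic_continuation_open[of "{s. Re s > 1}" "- {1}" f g])
      have "(2::complex) \<in> {s. Re s > 1}" by simp
      thus "{s. Re s > 1} \<noteq> {}" by blast
      show "connected (- {1::complex})" by (rule connected_punctured_universe) simp
      show "f z = g z" if "z \<in> {s. Re s > 1}" for z
        using that assms(3,4)[of z] sums_unique2 by blast
    qed (use assms False in \<open>auto simp: open_halfspace_Re_gt\<close>)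
  qed (use assms in simp)
qed

lemma riemann_zeta:
  shows "riemann_zeta holomorphic_on - {1}"
    and "Re s > 1 \<Longrightarrow> (\<lambda>n. of_nat (Suc n) powr (-s)) sums riemann_zeta s"
    and "riemann_zeta 1 = 0"
proof -
  have "\<exists>!f. f holomorphic_on - {1} \<and>
     (\<forall>s. Re s > 1 \<longrightarrow> (\<lambda>n. of_nat (Suc n) powr (-s)) sums f s) \<and> f 1 = 0"
    using riemann_zeta_exists riemann_zeta_unique by (intro ex_ex1I) blast+
  from theI'[OF this, folded riemann_zeta_def]
  show "riemann_zeta holomorphic_on - {1}"
    and "Re s > 1 \<Longrightarrow> (\<lambda>n. of_nat (Suc n) powr (-s)) sums riemann_zeta s"
    and "riemann_zeta 1 = 0" by blast+
qed

end

theory Submission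
  imports Defs "HOL-Real_Asymp.Real_Asymp"
begin

text \<open>
  Moving the line of integration to the right past the pole at \<open>s = 1\<close> shows that \<open>F_n\<close> is minus
  the residue there, because the integral over \<open>Re s = b\<close> tends to 0 as \<open>b\<close> grows. So \<open>n F_n\<close> is a polynomial of
  degree \<open>q\<close> in \<open>ln n\<close>, and \<open>G(w) = \<Sum>n. \<mu>(n) F_n n^(-w)\<close> is a combination of the derivatives
  of \<open>1/\<zeta>\<close> up to order \<open>q\<close> at \<open>1 + w\<close>. The weights of \<open>\<lambda>\<close> are those of Perron's formula with kernel
  \<open>exp z / z^2\<close>: with \<open>X = ln N\<close>, the sum is \<open>1 / (2 \<pi> i)\<close> times the integral of
  \<open>exp z G(z / X) / z^2\<close> over \<open>Re z = 1\<close>. The 3-4-1 inequality gives \<open>G(w) = O((1 + \<bar>Im w\<bar>)^(1/2))\<close>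
  to the right of \<open>Re w = 0\<close>, so dominated convergence yields the limit \<open>G(0)\<close>. By the Leibniz rule
  \<open>G(0)\<close> is minus the residue of \<open>1 / (s^q (1 - s)^q)\<close> at \<open>s = 1\<close>, and this residue is \<open>-q\<close>.
\<close>

section \<open>Euler product and Dirichlet series on the half-plane of convergence\<close>

text \<open>Since \<open>F_n\<close> has size \<open>(ln n)^q / n\<close>, the point
  \<open>w = 0\<close> lies on the boundary of absolute convergence of the series G, and its
  convergence there is never asserted. The weights only call for three facts: G to the right of the
  line, a growth bound that is uniform up to the line, and continuity at the single point 0. For the
  middle one mere non-vanishing of \<zeta> would not do, because a majorant is wanted; hence the
  3-4-1 inequality is used in quantitative form. The exponent 1/2 is fixed by the kernel: against
  \<open>1 / z^2\<close> it leaves the integrable decay \<open>t^(-3/2)\<close>. Scaling by X keeps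
  the line \<open>Re z = 1\<close> and the kernel fixed and moves all dependence on N into the
  argument \<open>z / X\<close>, which tends to 0 for each z. Heights near 0, where \<zeta> has its
  pole, are treated apart: there the zero of \<open>1/\<zeta>\<close> makes everything
  holomorphic.\<close>

lemma norm_of_nat_powr: "norm (of_nat n powr s :: complex) = real n powr Re s"
  by (subst norm_powr_real_powr) auto

lemma of_nat_mult_powr:
  "of_nat (m * n) powr s = (of_nat m powr s * of_nat n powr s :: complex)"
  by (simp add: powr_times_real)

lemma has_sum_zeta:
  assumes "Re s > 1"
  shows "((\<lambda>n. of_nat n powr -s) has_sum riemann_zeta s) {0<..}"
proof -
  have "summable (\<lambda>n. real (Suc n) powr - Re s)"
    using summable_ignore_initial_segment[of "\<lambda>n. real n powr - Re s" 1]
      summable_real_powr_iff[of "- Re s"] assms by simp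
  hence "summable (\<lambda>n. norm (of_nat (Suc n) powr -s :: complex))"
    unfolding norm_of_nat_powr by simp
  hence "((\<lambda>n. of_nat (Suc n) powr -s) has_sum riemann_zeta s) UNIV"
    by (rule norm_summable_imp_has_sum) (rule riemann_zeta(2)[OF assms])
  hence "(((\<lambda>n. of_nat n powr -s) \<circ> Suc) has_sum riemann_zeta s) UNIV"
    by (simp only: o_def)
  moreover have "range Suc = {0<..}"
    by (rule greaterThan_0[symmetric])
  ultimately show ?thesis
    using has_sum_reindex[of Suc UNIV "\<lambda>n. of_nat n powr -s" "riemann_zeta s"] by simp
qed

text \<open>Each factor is one sieving step: \<open>p^(-s)\<close> times the sum over the integers
  surviving S is the sum over their multiples by p, and these are exactly the survivors that p
  divides.\<close>

lemma finite_euler_product: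
  assumes s: "Re s > 1" and "finite S" and "\<And>p. p \<in> S \<Longrightarrow> prime p"
  shows "((\<lambda>n. of_nat n powr -s) has_sum riemann_zeta s * (\<Prod>p\<in>S. 1 - of_nat p powr -s))
           {n::nat. n > 0 \<and> (\<forall>p\<in>S. \<not> p dvd n)}"
  using assms(2,3)
proof (induction S)
  case empty
  show ?case using has_sum_zeta[OF s] by (simp add: greaterThan_def)
next
  case (insert p S)
  let ?f = "\<lambda>n. of_nat n powr -s :: complex"
  let ?U = "{n::nat. n > 0 \<and> (\<forall>p\<in>S. \<not> p dvd n)}"
  let ?Z = "riemann_zeta s * (\<Prod>p\<in>S. 1 - of_nat p powr -s)"
  have p: "prime p" and pS: "\<And>q. q \<in> S \<Longrightarrow> prime q" using insert.prems by auto
  have IH: "(?f has_sum ?Z) ?U" using insert.IH pS by blast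
  have dvd: "q dvd p * n \<longleftrightarrow> q dvd n" if "q \<in> S" for q n
    using that p pS[OF that] insert.hyps(2) primes_dvd_imp_eq[of q p] by (auto simp: prime_dvd_mult_iff)
  have img: "(\<lambda>n. p * n) ` ?U = {n \<in> ?U. p dvd n}"
  proof safe
    fix n assume "n > 0" "\<forall>q\<in>S. \<not> q dvd n" and "p dvd n"
    moreover obtain k where "n = p * k" using \<open>p dvd n\<close> by (elim dvdE)
    ultimately show "n \<in> (\<lambda>n. p * n) ` ?U" using dvd by auto
  qed (use p dvd in \<open>auto simp: prime_gt_0_nat\<close>)
  have "((\<lambda>n. ?f p * ?f n) has_sum ?f p * ?Z) ?U"
    by (rule has_sum_cmult_right[OF IH])
  hence "((?f \<circ> (\<lambda>n. p * n)) has_sum ?f p * ?Z) ?U"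
    by (simp only: o_def of_nat_mult_powr)
  moreover have "inj_on (\<lambda>n. p * n) ?U" using p by (auto simp: inj_on_def)
  ultimately have "(?f has_sum ?f p * ?Z) {n \<in> ?U. p dvd n}"
    using has_sum_reindex[of "\<lambda>n. p * n" ?U ?f] img by simp
  from has_sum_Diff[OF IH this]
  have "(?f has_sum ?Z - ?f p * ?Z) (?U - {n \<in> ?U. p dvd n})" by blast
  moreover have "?U - {n \<in> ?U. p dvd n} = {n. n > 0 \<and> (\<forall>p\<in>insert p S. \<not> p dvd n)}" by auto
  moreover have "?Z - ?f p * ?Z = riemann_zeta s * (\<Prod>p\<in>insert p S. 1 - of_nat p powr -s)"
    using insert.hyps by (simp add: algebra_simps)
  ultimately show ?case by simp
qed

text \<open>Serves as error term twice: for the sieved \<zeta> series and for the truncated Moebius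
  series, where only terms with \<open>n \<ge> N\<close> are left over.\<close>

lemma norm_has_sum_le_tail:
  fixes f :: "nat \<Rightarrow> complex"
  assumes \<sigma>: "\<sigma> > 1" and f: "(f has_sum a) B" "B \<subseteq> {N..}"
    and bound: "\<And>n. norm (f n) \<le> real n powr - \<sigma>"
  shows "norm a \<le> (\<Sum>n. real (n + N) powr - \<sigma>)"
proof -
  have sm: "summable (\<lambda>n. real n powr - \<sigma>)"
    using summable_real_powr_iff[of "- \<sigma>"] \<sigma> by simp
  have "((\<lambda>n. real (n + N) powr - \<sigma>) has_sum (\<Sum>n. real (n + N) powr - \<sigma>)) UNIV"
    by (rule norm_summable_imp_has_sum)
      (use summable_ignore_initial_segment[OF sm, of N] in \<open>auto intro: summable_sums\<close>)
  hence "(((\<lambda>n. real n powr - \<sigma>) \<circ> (\<lambda>n. n + N)) has_sum (\<Sum>n. real (n + N) powr - \<sigma>)) UNIV"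
    by (simp only: o_def)
  moreover have "range (\<lambda>n. n + N) = {N..}"
    by (auto simp: image_iff le_iff_add add.commute)
  ultimately have rs: "((\<lambda>n. real n powr - \<sigma>) has_sum (\<Sum>n. real (n + N) powr - \<sigma>)) {N..}"
    using has_sum_reindex[of "\<lambda>n. n + N" UNIV "\<lambda>n. real n powr - \<sigma>"] by simp
  have "(\<lambda>n. real n powr - \<sigma>) summable_on B"
    by (rule summable_on_subset_banach[OF has_sum_imp_summable[OF rs] f(2)])
  hence ns: "((\<lambda>n. real n powr - \<sigma>) has_sum infsum (\<lambda>n. real n powr - \<sigma>) B) B"
    by (rule has_sum_infsum)
  have "norm a \<le> infsum (\<lambda>n. real n powr - \<sigma>) B"
    by (rule norm_infsum_le[OF f(1) ns bound])
  also have "\<dots> \<le> (\<Sum>n. real (n + N) powr - \<sigma>)"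
    by (rule has_sum_mono2[OF ns rs f(2)]) auto
  finally show ?thesis .
qed

lemma tail_powr_tendsto_0:
  assumes "\<sigma> > 1"
  shows "(\<lambda>N. \<Sum>n. real (n + N) powr - \<sigma>) \<longlonglongrightarrow> 0"
  by (rule suminf_exist_split2) (use summable_real_powr_iff[of "- \<sigma>"] assms in simp)

text \<open>After sieving by the primes up to N, what remains is 1 and integers all of whose prime
  factors exceed N, so the error is a tail of a convergent series.\<close>

lemma euler_product_tendsto:
  assumes s: "Re s > 1"
  shows "(\<lambda>N. riemann_zeta s * (\<Prod>p | prime p \<and> p \<le> N. 1 - of_nat p powr -s)) \<longlonglongrightarrow> 1"
proof -
  let ?f = "\<lambda>n. of_nat n powr -s :: complex"
  let ?P = "\<lambda>N. {p::nat. prime p \<and> p \<le> N}"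
  define g where "g N = riemann_zeta s * (\<Prod>p\<in>?P N. 1 - of_nat p powr -s)" for N
  have bound: "norm (g N - 1) \<le> (\<Sum>n. real (n + N) powr - Re s)" for N
  proof -
    let ?U = "{n::nat. n > 0 \<and> (\<forall>p\<in>?P N. \<not> p dvd n)}"
    have "(?f has_sum g N) ?U"
      unfolding g_def by (rule finite_euler_product[OF s]) auto
    moreover have "(?f has_sum 1) {1}" using has_sum_finite[of "{1}" ?f] by simp
    moreover have "{1} \<subseteq> ?U" by (auto dest: prime_gt_1_nat)
    ultimately have hs: "(?f has_sum g N - 1) (?U - {1})" by (rule has_sum_Diff)
    have sub: "?U - {1} \<subseteq> {N..}"
    proof (rule subsetI)
      fix n assume "n \<in> ?U - {1}"
      hence n: "n > 0" "\<forall>p\<in>?P N. \<not> p dvd n" "n \<noteq> 1" by auto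
      obtain p where "prime p" "p dvd n" using prime_factor_nat[OF n(3)] by blast
      moreover from this have "\<not> p \<le> N" using n(2) by blast
      ultimately show "n \<in> {N..}" using dvd_imp_le[of p n] n(1) by simp
    qed
    show ?thesis
      by (rule norm_has_sum_le_tail[OF s hs sub]) (simp add: norm_of_nat_powr)
  qed
  have "(\<lambda>N. norm (g N - 1)) \<longlonglongrightarrow> 0"
    by (rule tendsto_sandwich[OF _ _ tendsto_const tail_powr_tendsto_0[OF s]])
       (intro always_eventually allI norm_ge_zero bound)+
  thus ?thesis unfolding g_def using tendsto_norm_zero_iff LIM_zero_iff by blast
qed

section \<open>The Moebius function and the Dirichlet series of 1/\<zeta>\<close>

lemma norm_moebius_mu_le: "norm (of_int (moebius_mu n) :: 'a :: real_normed_algebra_1) \<le> 1"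
  by (simp add: moebius_mu_def norm_power)

lemma squarefree_nat_nonzero: "squarefree (n::nat) \<Longrightarrow> n \<noteq> 0"
  by (intro notI) simp

lemma moebius_mu_prime_mult:
  assumes p: "prime p" "\<not> p dvd n"
  shows "moebius_mu (p * n) = - moebius_mu n"
proof -
  have cop: "coprime p n" using p by (rule prime_imp_coprime)
  have "squarefree (p * n) \<longleftrightarrow> squarefree n"
    using cop p squarefree_prime[of p] by (auto simp: squarefree_mult_coprime dest: squarefree_multD)
  moreover have "card (prime_factors (p * n)) = Suc (card (prime_factors n))" if "squarefree n"
  proof -
    have "n \<noteq> 0" using that squarefree_nat_nonzero by blast
    hence "prime_factors (p * n) = insert p (prime_factors n)"
      using p by (auto simp: prime_factors_product prime_factorization_prime)
    moreover have "p \<notin> prime_factors n" using p in_prime_factors_imp_dvd by blast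
    ultimately show ?thesis by simp
  qed
  ultimately show ?thesis by (simp add: moebius_mu_def)
qed

lemma squarefree_prime_factors_insert:
  assumes p: "prime p" "p \<notin> S" and S: "\<And>q. q \<in> S \<Longrightarrow> prime q"
  shows "{n::nat. squarefree n \<and> prime_factors n \<subseteq> insert p S} =
     {n. squarefree n \<and> prime_factors n \<subseteq> S} \<union> (\<lambda>n. p * n) ` {n. squarefree n \<and> prime_factors n \<subseteq> S}"
  (is "?L = ?A \<union> _ ` ?A")
proof (intro equalityI subsetI)
  fix n assume n: "n \<in> ?L"
  hence n0: "n \<noteq> 0" using squarefree_nat_nonzero by blast
  show "n \<in> ?A \<union> (\<lambda>n. p * n) ` ?A"
  proof (cases "p dvd n")
    case True
    then obtain k where k: "n = p * k" by (elim dvdE)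
    have sq: "squarefree k" using n k by (auto dest: squarefree_multD)
    have "\<not> p dvd k"
    proof
      assume "p dvd k"
      hence "p\<^sup>2 dvd n" using k by (auto simp: power2_eq_square)
      hence "is_unit p" using n by (auto simp: squarefree_def)
      thus False using p by simp
    qed
    moreover have "prime_factors k \<subseteq> prime_factors n" using k n0 by (auto simp: prime_factors_dvd)
    ultimately have "prime_factors k \<subseteq> S" using n by (auto simp: prime_factors_dvd)
    thus ?thesis using k sq by auto
  next
    case False
    thus ?thesis using n by (auto simp: prime_factors_dvd)
  qed
next
  fix n assume "n \<in> ?A \<union> (\<lambda>n. p * n) ` ?A"
  thus "n \<in> ?L"
  proof
    assume "n \<in> (\<lambda>n. p * n) ` ?A"
    then obtain k where k: "n = p * k" "squarefree k" "prime_factors k \<subseteq> S" by auto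
    have k0: "k \<noteq> 0" using k(2) by (rule squarefree_nat_nonzero)
    have "\<not> p dvd k" using k p k0 by (auto simp: prime_factors_dvd)
    hence "squarefree n"
      using k p by (auto simp: squarefree_mult_coprime prime_imp_coprime squarefree_prime)
    thus ?thesis using k k0 p by (auto simp: prime_factors_product prime_factorization_prime)
  qed auto
qed

text \<open>Expansion of the product: a new prime p adjoins to the index set a disjoint copy
  multiplied by p, and on it every term is the old one times \<open>-(p^(-s))\<close>.\<close>

lemma finite_euler_product_moebius:
  assumes "finite S" and "\<And>p. p \<in> S \<Longrightarrow> prime p"
  shows "finite {n::nat. squarefree n \<and> prime_factors n \<subseteq> S} \<and>
    (\<Sum>n | squarefree n \<and> prime_factors n \<subseteq> S. of_int (moebius_mu n) * of_nat n powr -s :: complex)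
       = (\<Prod>p\<in>S. 1 - of_nat p powr -s)"
  using assms
proof (induction S)
  case empty
  have "{n::nat. squarefree n \<and> prime_factors n \<subseteq> {}} = {1}"
    by (auto simp: prime_factorization_empty_iff)
  thus ?case by (simp add: moebius_mu_def)
next
  case (insert p S)
  let ?f = "\<lambda>n. of_int (moebius_mu n) * of_nat n powr -s :: complex"
  let ?A = "{n::nat. squarefree n \<and> prime_factors n \<subseteq> S}"
  have p: "prime p" and pS: "\<And>q. q \<in> S \<Longrightarrow> prime q" using insert.prems by auto
  have IH: "finite ?A" "sum ?f ?A = (\<Prod>p\<in>S. 1 - of_nat p powr -s)" using insert.IH pS by auto
  have nd: "\<not> p dvd n" if "n \<in> ?A" for n
  proof
    assume "p dvd n"
    moreover have "n \<noteq> 0" using that squarefree_nat_nonzero by blast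
    ultimately have "p \<in> prime_factors n" using p by (simp add: prime_factors_dvd)
    thus False using that insert.hyps by auto
  qed
  have inj: "inj_on (\<lambda>n. p * n) ?A" using p by (auto simp: inj_on_def)
  have "sum ?f ((\<lambda>n. p * n) ` ?A) = (\<Sum>n\<in>?A. ?f (p * n))"
    using sum.reindex[OF inj, of ?f] by simp
  also have "\<dots> = (\<Sum>n\<in>?A. - (of_nat p powr -s) * ?f n)"
  proof (rule sum.cong[OF refl])
    fix n assume "n \<in> ?A"
    thus "?f (p * n) = - (of_nat p powr -s) * ?f n"
      using moebius_mu_prime_mult[OF p nd[of n]] by (simp only: of_nat_mult_powr) simp
  qed
  also have "\<dots> = - (of_nat p powr -s) * sum ?f ?A" by (simp only: sum_distrib_left)
  finally have "sum ?f ?A + sum ?f ((\<lambda>n. p * n) ` ?A) = (1 - of_nat p powr -s) * sum ?f ?A"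
    by (simp add: algebra_simps)
  moreover have "?A \<inter> (\<lambda>n. p * n) ` ?A = {}" using nd by (auto dest!: nd[OF CollectI])
  moreover have "{n::nat. squarefree n \<and> prime_factors n \<subseteq> insert p S} = ?A \<union> (\<lambda>n. p * n) ` ?A"
    by (rule squarefree_prime_factors_insert[OF p insert.hyps(2) pS])
  ultimately show ?case
    using IH insert.hyps by (simp only: sum.union_disjoint prod.insert finite_Un finite_imageI) simp
qed

text \<open>The partial Euler products tend to the Moebius series, while their multiples by
  \<open>riemann_zeta s\<close> tend to 1. Comparing the limits replaces the multiplication of two
  Dirichlet series.\<close>

lemma moebius_sums:
  assumes s: "Re s > 1"
  shows "(\<lambda>n. of_int (moebius_mu n) * of_nat n powr -s) sums (1 / riemann_zeta s)"
proof -
  let ?f = "\<lambda>n. of_int (moebius_mu n) * of_nat n powr -s :: complex"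
  let ?A = "\<lambda>N. {n::nat. squarefree n \<and> prime_factors n \<subseteq> {p. prime p \<and> p \<le> N}}"
  let ?P = "\<lambda>N. \<Prod>p | prime p \<and> p \<le> N. 1 - of_nat p powr -s :: complex"
  have nf: "norm (?f n) \<le> real n powr - Re s" for n
  proof -
    have "norm (?f n) \<le> 1 * real n powr - Re s"
      unfolding norm_mult norm_of_nat_powr
      by (intro mult_mono norm_moebius_mu_le) auto
    thus ?thesis by simp
  qed
  have "summable (\<lambda>n. norm (?f n))"
    by (rule summable_comparison_test'[of "\<lambda>n. real n powr - Re s" 0])
       (use nf s summable_real_powr_iff[of "- Re s"] in auto)
  hence sf: "summable ?f" "(?f has_sum suminf ?f) UNIV"
    by (rule summable_norm_cancel,
        intro norm_summable_imp_has_sum[OF _ summable_sums[OF summable_norm_cancel]])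
  hence hsq: "(?f has_sum suminf ?f) {n. squarefree n}"
    using has_sum_cong_neutral[of "{n. squarefree n}" UNIV ?f ?f "suminf ?f"] by (auto simp: moebius_mu_def)
  have "norm (suminf ?f - ?P N) \<le> (\<Sum>n. real (n + N) powr - Re s)" for N
  proof -
    have fe: "finite (?A N)" "sum ?f (?A N) = ?P N"
      by (rule finite_euler_product_moebius[THEN conjunct1], simp, blast,
          rule finite_euler_product_moebius[THEN conjunct2], simp, blast)
    have "(?f has_sum ?P N) (?A N)" using has_sum_finite[OF fe(1), of ?f] unfolding fe(2) .
    hence "(?f has_sum suminf ?f - ?P N) ({n. squarefree n} - ?A N)"
      by (rule has_sum_Diff[OF hsq]) blast
    moreover have "{n. squarefree n} - ?A N \<subseteq> {N..}"
    proof (rule subsetI)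
      fix n assume n: "n \<in> {n. squarefree n} - ?A N"
      hence "n > 0" using squarefree_nat_nonzero by blast
      moreover from n obtain p where "p \<in> prime_factors n" "\<not> p \<le> N"
        by (auto dest: in_prime_factors_imp_prime)
      ultimately show "n \<in> {N..}" using dvd_imp_le[of p n] by (auto simp: prime_factors_dvd)
    qed
    ultimately show ?thesis by (rule norm_has_sum_le_tail[OF s _ _ nf])
  qed
  hence "(\<lambda>N. norm (suminf ?f - ?P N)) \<longlonglongrightarrow> 0"
    by (intro tendsto_sandwich[OF _ _ tendsto_const tail_powr_tendsto_0[OF s]])
       (intro always_eventually allI norm_ge_zero | simp only:)+
  hence "(\<lambda>N. suminf ?f - (suminf ?f - ?P N)) \<longlonglongrightarrow> suminf ?f - 0"
    by (intro tendsto_diff tendsto_const) (rule tendsto_norm_zero_cancel)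
  hence "(\<lambda>N. riemann_zeta s * ?P N) \<longlonglongrightarrow> riemann_zeta s * suminf ?f"
    by (intro tendsto_mult tendsto_const) simp
  from LIMSEQ_unique[OF this euler_product_tendsto[OF s]]
  have "riemann_zeta s * suminf ?f = 1" .
  hence "suminf ?f = 1 / riemann_zeta s"
    by (metis mult_zero_left nonzero_mult_div_cancel_left zero_neq_one)
  thus ?thesis using sf(1) summable_sums by fastforce
qed

section \<open>The 3-4-1 inequality\<close>

text \<open>In the power series of the logarithm of the left-hand side, \<open>r^n / n\<close> has
  the coefficient \<open>-(3 + 4 * c + (2 * c^2 - 1)) = -2 * (1 + c)^2\<close> with
  \<open>c = Re (u^n)\<close>, which is never positive.\<close>

lemma mertens_341:
  fixes u :: complex and r :: real
  assumes r: "0 \<le> r" "r < 1" and u: "norm u = 1"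
  shows "norm ((1 - of_real r) ^ 3 * (1 - of_real r * u) ^ 4 * (1 - of_real r * u\<^sup>2)) \<le> 1"
proof -
  have S: "(\<lambda>n. - Re (z ^ n) / real n) sums ln (norm (1 - z))" if "norm z < 1" for z :: complex
  proof -
    have "1 - z \<noteq> 0" using that by auto
    moreover have "(\<lambda>n. Re (- (z ^ n) / complex_of_nat n)) sums Re (Ln (1 - z))"
      using Ln_series'[of "-z"] that sums_Re by fastforce
    ultimately show ?thesis by simp
  qed
  have nr: "norm (of_real r * u) < 1" "norm (of_real r * u\<^sup>2) < 1" "norm (of_real r :: complex) < 1"
    using r u by (simp_all add: norm_mult norm_power)
  have S3: "(\<lambda>n. 3 * (- Re (of_real r ^ n) / real n) + 4 * (- Re ((of_real r * u) ^ n) / real n)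
              + - Re ((of_real r * u\<^sup>2) ^ n) / real n)
    sums (3 * ln (norm (1 - of_real r :: complex)) + 4 * ln (norm (1 - of_real r * u)) + ln (norm (1 - of_real r * u\<^sup>2)))"
    by (intro sums_add sums_mult S nr)
  have "3 * (- Re (of_real r ^ n) / real n) + 4 * (- Re ((of_real r * u) ^ n) / real n)
              + - Re ((of_real r * u\<^sup>2) ^ n) / real n \<le> 0" for n
  proof -
    define c where "c = Re (u ^ n)"
    have "norm (u ^ n) = 1" using u by (simp add: norm_power)
    hence "c\<^sup>2 + (Im (u ^ n))\<^sup>2 = 1" unfolding c_def by (metis cmod_power2 one_power2)
    moreover have "(u\<^sup>2) ^ n = (u ^ n)\<^sup>2" by (metis power_mult mult.commute)
    hence "Re ((u\<^sup>2) ^ n) = c\<^sup>2 - (Im (u ^ n))\<^sup>2"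
      by (simp add: c_def power2_eq_square)
    ultimately have c2: "Re ((u\<^sup>2) ^ n) = 2 * c\<^sup>2 - 1" by simp
    have eqs: "Re (of_real r ^ n) = r ^ n" "Re ((of_real r * u) ^ n) = r ^ n * c"
      "Re ((of_real r * u\<^sup>2) ^ n) = r ^ n * (2 * c\<^sup>2 - 1)"
      unfolding power_mult_distrib of_real_power[symmetric] c2[symmetric] by (simp_all add: c_def)
    \<comment> \<open>At \<open>n = 0\<close> both sides are 0, being divided by zero.\<close>
    have "3 * (- Re (of_real r ^ n) / real n) + 4 * (- Re ((of_real r * u) ^ n) / real n)
              + - Re ((of_real r * u\<^sup>2) ^ n) / real n = - (2 * r ^ n * (1 + c)\<^sup>2) / real n"
      unfolding eqs by (cases "n = 0") (simp_all add: field_simps power2_eq_square)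
    also have "\<dots> \<le> 0" using r by simp
    finally show ?thesis .
  qed
  hence le: "3 * ln (norm (1 - of_real r :: complex)) + 4 * ln (norm (1 - of_real r * u)) + ln (norm (1 - of_real r * u\<^sup>2)) \<le> 0"
    by (rule sums_le[OF _ S3 sums_zero])
  have pos: "norm (1 - z) > 0" if "norm z < 1" for z :: complex using that by auto
  have "ln (norm ((1 - of_real r) ^ 3 * (1 - of_real r * u) ^ 4 * (1 - of_real r * u\<^sup>2)))
      = 3 * ln (norm (1 - of_real r :: complex)) + 4 * ln (norm (1 - of_real r * u)) + ln (norm (1 - of_real r * u\<^sup>2))"
    unfolding norm_mult norm_power
    using pos[OF nr(1)] pos[OF nr(2)] pos[OF nr(3)] by (simp add: ln_mult ln_realpow)
  hence "ln (norm ((1 - of_real r) ^ 3 * (1 - of_real r * u) ^ 4 * (1 - of_real r * u\<^sup>2))) \<le> 0" using le by simp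
  moreover have "norm ((1 - of_real r) ^ 3 * (1 - of_real r * u) ^ 4 * (1 - of_real r * u\<^sup>2)) > 0"
    unfolding norm_mult norm_power using pos[OF nr(1)] pos[OF nr(2)] pos[OF nr(3)] by simp
  ultimately show ?thesis by (simp add: ln_le_zero_iff)
qed

text \<open>The Euler factors at p are those of \<open>mertens_341\<close> with
  \<open>r = p^(-\<sigma>)\<close> and \<open>u = p^(-\<i> t)\<close>, so the combined partial
  products have modulus at most 1. Multiplied by the \<zeta> values they tend to 1, which forces the
  \<zeta> values to have modulus at least 1.\<close>

lemma zeta_341:
  assumes \<sigma>: "\<sigma> > 1"
  shows "norm (riemann_zeta (of_real \<sigma>) ^ 3 * riemann_zeta (Complex \<sigma> t) ^ 4
           * riemann_zeta (Complex \<sigma> (2 * t))) \<ge> 1"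
proof -
  define P where "P N s = (\<Prod>p | prime p \<and> p \<le> N. 1 - of_nat p powr -s :: complex)" for N :: nat and s
  let ?Z = "norm (riemann_zeta (of_real \<sigma>) ^ 3 * riemann_zeta (Complex \<sigma> t) ^ 4
           * riemann_zeta (Complex \<sigma> (2 * t)))"
  let ?Q = "\<lambda>N. P N (of_real \<sigma>) ^ 3 * P N (Complex \<sigma> t) ^ 4 * P N (Complex \<sigma> (2 * t))"
  have lim: "(\<lambda>N. riemann_zeta s * P N s) \<longlonglongrightarrow> 1" if "Re s = \<sigma>" for s
    unfolding P_def using euler_product_tendsto[of s] that \<sigma> by simp
  have "(\<lambda>N. norm ((riemann_zeta (of_real \<sigma>) * P N (of_real \<sigma>)) ^ 3
              * (riemann_zeta (Complex \<sigma> t) * P N (Complex \<sigma> t)) ^ 4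
              * (riemann_zeta (Complex \<sigma> (2 * t)) * P N (Complex \<sigma> (2 * t))))) \<longlonglongrightarrow> norm (1 ^ 3 * 1 ^ 4 * 1 :: complex)"
    by (intro tendsto_intros lim) simp_all
  moreover have "norm ((riemann_zeta (of_real \<sigma>) * P N (of_real \<sigma>)) ^ 3
              * (riemann_zeta (Complex \<sigma> t) * P N (Complex \<sigma> t)) ^ 4
              * (riemann_zeta (Complex \<sigma> (2 * t)) * P N (Complex \<sigma> (2 * t)))) \<le> ?Z" for N
  proof -
    have factor: "norm ((1 - of_nat p powr - of_real \<sigma>) ^ 3 * (1 - of_nat p powr - Complex \<sigma> t) ^ 4
       * (1 - of_nat p powr - Complex \<sigma> (2 * t)) :: complex) \<le> 1" if p: "prime p" for p :: nat
    proof -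
      define r where "r = real p powr - \<sigma>"
      define u where "u = (of_nat p powr (- \<i> * of_real t) :: complex)"
      have p1: "real p > 1" using prime_gt_1_nat[OF p] by simp
      have "r < 1" unfolding r_def using p1 \<sigma> powr_less_mono2_neg[of "-\<sigma>" 1 "real p"] by simp
      have r: "of_nat p powr - of_real \<sigma> = (of_real r :: complex)"
        unfolding r_def by (simp add: powr_of_real[symmetric])
      have C: "- Complex \<sigma> x = - of_real \<sigma> + - \<i> * of_real x" for x
        by (simp add: complex_eq_iff)
      have u2: "of_nat p powr (- \<i> * of_real (2 * t)) = u\<^sup>2"
        unfolding u_def power2_eq_square powr_add[symmetric] by (simp add: algebra_simps)
      have "of_nat p powr - Complex \<sigma> t = of_real r * u"
        unfolding C powr_add r u_def ..
      moreover have "of_nat p powr - Complex \<sigma> (2 * t) = of_real r * u\<^sup>2"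
        unfolding C powr_add r u2 ..
      moreover have "norm u = 1" unfolding u_def norm_of_nat_powr using p1 by simp
      ultimately show ?thesis
        using mertens_341[of r u] \<open>r < 1\<close> r by (simp add: r_def)
    qed
    have "norm (?Q N) = (\<Prod>p | prime p \<and> p \<le> N. norm ((1 - of_nat p powr - of_real \<sigma>) ^ 3 * (1 - of_nat p powr - Complex \<sigma> t) ^ 4
       * (1 - of_nat p powr - Complex \<sigma> (2 * t)) :: complex))"
      unfolding P_def by (simp only: norm_mult norm_power prod.distrib prod_power_distrib prod_norm[symmetric])
    also have "\<dots> \<le> 1" by (rule prod_le_1) (use factor in auto)
    finally have "norm (?Q N) \<le> 1" .
    hence "?Z * norm (?Q N) \<le> ?Z * 1" by (intro mult_left_mono) auto
    thus ?thesis by (simp add: norm_mult norm_power power_mult_distrib mult_ac)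
  qed
  ultimately have "norm (1 ^ 3 * 1 ^ 4 * 1 :: complex) \<le> ?Z"
    by (intro tendsto_upperbound[of _ _ sequentially]) (auto intro!: always_eventually)
  thus ?thesis by simp
qed

section \<open>Growth of \<open>\<zeta>\<close> and \<open>1/\<zeta>\<close>\<close>

text \<open>The quotient is the integral of \<open>x powr -s\<close> over the interval from \<open>n\<close> to \<open>n + 1\<close>.\<close>

definition zeta_term :: "nat \<Rightarrow> complex \<Rightarrow> complex" where
  "zeta_term n s = of_nat (n + 1) powr (-s)
     - (of_nat (n + 1) powr (1 - s) - of_nat n powr (1 - s)) / (1 - s)"

text \<open>The mean value inequality with a majorant for the derivative. Having
  \<open>\<delta>\<close> in place of \<open>Re s\<close> lets the bound depend on s through the
  factor \<open>norm s\<close> only.\<close>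

lemma norm_powr_diff_le:
  fixes s :: complex
  assumes \<delta>: "0 < \<delta>" "\<delta> \<le> Re s" and xy: "1 \<le> x" "x \<le> y"
  shows "norm (of_real y powr -s - of_real x powr -s :: complex) \<le> norm s / \<delta> * (x powr -\<delta> - y powr -\<delta>)"
proof (cases "x = y")
  case False
  hence "x < y" using xy by simp
  have "norm (of_real y powr -s - of_real x powr -s :: complex)
      \<le> - norm s / \<delta> * y powr -\<delta> - (- norm s / \<delta> * x powr -\<delta>)"
  proof (rule differentiable_bound_general[OF \<open>x < y\<close>, where f = "\<lambda>u. of_real u powr -s"
        and \<phi> = "\<lambda>u. - norm s / \<delta> * u powr -\<delta>"
        and f' = "\<lambda>u. - s * of_real u powr (-s - 1)"
        and \<phi>' = "\<lambda>u. norm s * u powr (-\<delta> - 1)"])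
    show "continuous_on {x..y} (\<lambda>u. of_real u powr -s :: complex)"
      using xy by (auto intro!: continuous_intros)
    show "continuous_on {x..y} (\<lambda>u. - norm s / \<delta> * u powr -\<delta>)"
      using xy \<delta> by (auto intro!: continuous_intros)
    fix u assume u: "x < u" "u < y"
    hence u1: "u > 1" using xy by simp
    have "((\<lambda>z. z powr -s) has_field_derivative - s * of_real u powr (-s - 1)) (at (of_real u))"
      using u1 by (auto intro!: derivative_eq_intros)
    thus "((\<lambda>u. of_real u powr -s) has_vector_derivative - s * of_real u powr (-s - 1)) (at u)"
      using has_vector_derivative_real_field by blast
    show "((\<lambda>u. - norm s / \<delta> * u powr -\<delta>) has_vector_derivative norm s * u powr (-\<delta> - 1)) (at u)"
      unfolding has_real_derivative_iff_has_vector_derivative[symmetric]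
      using u1 \<delta> by (auto intro!: derivative_eq_intros)
    have "norm (of_real u powr (-s - 1) :: complex) = u powr (- Re s - 1)"
      using u1 by (subst norm_powr_real_powr) auto
    also have "\<dots> \<le> u powr (-\<delta> - 1)" using u1 \<delta> by (intro powr_mono) auto
    finally show "norm (- s * of_real u powr (-s - 1)) \<le> norm s * u powr (-\<delta> - 1)"
      by (simp add: norm_mult mult_left_mono)
  qed
  thus ?thesis by (simp add: algebra_simps)
qed simp

text \<open>The difference on the right is kept, rather than a power of n, because it telescopes:
  the sum over \<open>n \<ge> M\<close> is \<open>norm s / \<delta> * M^(-\<delta>)\<close>.\<close>

lemma norm_zeta_term_le:
  assumes \<delta>: "0 < \<delta>" "\<delta> \<le> Re s" and s1: "s \<noteq> 1" and n: "n > 0"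
  shows "norm (zeta_term n s) \<le> norm s / \<delta> * (real n powr -\<delta> - real (n + 1) powr -\<delta>)"
proof -
  have s1': "1 - s \<noteq> 0" using s1 by simp
  let ?K = "norm s / \<delta> * (real n powr -\<delta> - real (n + 1) powr -\<delta>)"
  \<comment> \<open>A primitive of \<open>(n + 1)^(-s) - u^(-s)\<close>, whose increment from n to
    \<open>n + 1\<close> is \<open>zeta_term n s\<close>.\<close>
  let ?f = "\<lambda>u::real. of_real u * of_nat (n + 1) powr -s - of_real u powr (1 - s) / (1 - s) :: complex"
  have "norm (?f (real (n + 1)) - ?f (real n)) \<le> ?K * real (n + 1) - ?K * real n"
  proof (rule differentiable_bound_general[where f' = "\<lambda>u. of_nat (n + 1) powr -s - of_real u powr -s"
        and \<phi>' = "\<lambda>_. ?K"])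
    show "continuous_on {real n..real (n + 1)} ?f"
      using n s1 by (auto intro!: continuous_intros)
    fix u assume u: "real n < u" "u < real (n + 1)"
    hence u1: "u \<ge> 1" using n by linarith
    have "((\<lambda>z. z * of_nat (n + 1) powr -s - z powr (1 - s) / (1 - s)) has_field_derivative
        of_nat (n + 1) powr -s - of_real u powr -s) (at (of_real u))"
      using u1 s1' by (auto intro!: derivative_eq_intros)
    thus "(?f has_vector_derivative of_nat (n + 1) powr -s - of_real u powr -s) (at u)"
      by (rule has_vector_derivative_real_field)
    have "norm (of_real (real (n + 1)) powr -s - of_real u powr -s :: complex)
        \<le> norm s / \<delta> * (u powr -\<delta> - real (n + 1) powr -\<delta>)"
      by (rule norm_powr_diff_le[OF \<delta> u1]) (use u in simp)
    also have "\<dots> \<le> ?K"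
      using \<delta> u n by (intro mult_left_mono diff_right_mono powr_mono2') auto
    finally show "norm (of_nat (n + 1) powr -s - of_real u powr -s :: complex) \<le> ?K"
      by (simp only: of_real_of_nat_eq)
  qed (use \<delta> in \<open>auto intro!: continuous_intros derivative_eq_intros\<close>)
  moreover have "?f (real (n + 1)) - ?f (real n) = zeta_term n s"
    by (simp add: zeta_term_def diff_divide_distrib algebra_simps)
  moreover have "K * real (n + 1) - K * real n = K" for K by (simp add: algebra_simps)
  ultimately show ?thesis by (simp only:)
qed

lemma telescope_powr_sums:
  assumes "\<delta> > 0"
  shows "(\<lambda>k. real (k + M) powr -\<delta> - real (k + M + 1) powr -\<delta>) sums (real M powr -\<delta>)"
proof -
  have "(\<lambda>k. real (k + M) powr -\<delta>) \<longlonglongrightarrow> 0" using assms by real_asymp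
  from telescope_sums'[OF this] show ?thesis by simp
qed

definition zeta_rem :: "nat \<Rightarrow> complex \<Rightarrow> complex" where
  "zeta_rem M s = (\<Sum>k. zeta_term (k + M) s)"

lemma summable_norm_zeta_term:
  assumes M: "M > 0" and \<delta>: "0 < \<delta>" "\<delta> \<le> Re s" and s1: "s \<noteq> 1"
  shows "summable (\<lambda>k. norm (zeta_term (k + M) s))"
proof (rule summable_comparison_test')
  show "summable (\<lambda>k. norm s / \<delta> * (real (k + M) powr -\<delta> - real (k + M + 1) powr -\<delta>))"
    by (intro summable_mult sums_summable[OF telescope_powr_sums] \<delta>)
  show "norm (norm (zeta_term (k + M) s)) \<le> norm s / \<delta> * (real (k + M) powr -\<delta> - real (k + M + 1) powr -\<delta>)" for k
    using norm_zeta_term_le[OF \<delta> s1, of "k + M"] M by simp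
qed

lemma zeta_rem_sums:
  assumes "M > 0" "0 < \<delta>" "\<delta> \<le> Re s" "s \<noteq> 1"
  shows "(\<lambda>k. zeta_term (k + M) s) sums zeta_rem M s"
  unfolding zeta_rem_def
  by (rule summable_sums[OF summable_norm_cancel[OF summable_norm_zeta_term[OF assms]]])

lemma norm_zeta_rem_le:
  assumes M: "M > 0" and \<delta>: "0 < \<delta>" "\<delta> \<le> Re s" and s1: "s \<noteq> 1"
  shows "norm (zeta_rem M s) \<le> norm s / \<delta> * real M powr -\<delta>"
proof -
  have S: "(\<lambda>k. norm s / \<delta> * (real (k + M) powr -\<delta> - real (k + M + 1) powr -\<delta>)) sums (norm s / \<delta> * real M powr -\<delta>)"
    by (intro sums_mult telescope_powr_sums \<delta>)
  have B: "norm (zeta_term (k + M) s) \<le> norm s / \<delta> * (real (k + M) powr -\<delta> - real (k + M + 1) powr -\<delta>)" for k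
    by (rule norm_zeta_term_le[OF \<delta> s1]) (use M in simp)
  have ns: "summable (\<lambda>k. norm (zeta_term (k + M) s))"
    by (rule summable_norm_zeta_term[OF assms])
  have "norm (zeta_rem M s) \<le> (\<Sum>k. norm (zeta_term (k + M) s))"
    unfolding zeta_rem_def by (rule summable_norm[OF ns])
  also have "\<dots> \<le> norm s / \<delta> * real M powr -\<delta>"
    unfolding sums_unique[OF S] by (intro suminf_le B ns sums_summable[OF S])
  finally show ?thesis .
qed

lemma zeta_rem_holomorphic:
  assumes M: "M > 0"
  shows "zeta_rem M holomorphic_on {s. Re s > 0} - {1}"
proof -
  let ?S = "{s. Re s > 0} - {1::complex}"
  have op: "open ?S" by (intro open_Diff) (auto simp: open_halfspace_Re_gt)
  have d: "zeta_term n holomorphic_on ?S" if "n > 0" for n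
    using that unfolding zeta_term_def by (intro holomorphic_intros) auto
  have ex: "\<exists>d h. 0 < d \<and> summable h \<and> range h \<subseteq> \<real>\<^sub>\<ge>\<^sub>0 \<and>
        (\<forall>\<^sub>F n in sequentially. \<forall>y\<in>ball x d \<inter> ?S. cmod (zeta_term (n + M) y) \<le> cmod (h n))"
    if x: "x \<in> ?S" for x
  proof -
    \<comment> \<open>With half of \<open>Re x\<close> the disc of radius \<open>\<delta>\<close>
      around x stays in \<open>Re y \<ge> \<delta>\<close>, so one telescoping majorant serves the
      whole disc.\<close>
    define \<delta> where "\<delta> = Re x / 2"
    define g where "g k = (norm x + \<delta>) / \<delta> * (real (k + M) powr -\<delta> - real (k + M + 1) powr -\<delta>)" for k
    have \<delta>: "\<delta> > 0" using x by (simp add: \<delta>_def)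
    have gs: "summable g" unfolding g_def
      by (intro summable_mult sums_summable[OF telescope_powr_sums] \<delta>)
    have diff0: "real (k + M) powr -\<delta> - real (k + M + 1) powr -\<delta> \<ge> 0" for k
      using powr_mono2'[of "-\<delta>" "real (k + M)" "real (k + M + 1)"] \<delta> M by simp
    have g0: "g k \<ge> 0" for k unfolding g_def using \<delta> diff0
      by (intro mult_nonneg_nonneg divide_nonneg_nonneg) auto
    have "norm (zeta_term (k + M) y) \<le> g k" if y: "y \<in> ball x \<delta> \<inter> ?S" for k y
    proof -
      have "\<bar>Re x - Re y\<bar> < \<delta>"
        using y abs_Re_le_cmod[of "x - y"] by (simp add: dist_norm)
      hence "\<delta> \<le> Re y" unfolding \<delta>_def by (auto simp: abs_if field_simps split: if_splits)
      hence "norm (zeta_term (k + M) y) \<le> norm y / \<delta> * (real (k + M) powr -\<delta> - real (k + M + 1) powr -\<delta>)"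
        using y M by (intro norm_zeta_term_le \<delta>) auto
      also have "norm y \<le> norm x + \<delta>"
        using y norm_triangle_ineq2[of y x] by (simp add: dist_norm norm_minus_commute)
      finally show ?thesis unfolding g_def using \<delta> diff0
        by (simp add: divide_right_mono mult_right_mono)
    qed
    moreover have "summable (\<lambda>k. complex_of_real (g k))" using gs by (simp add: summable_of_real_iff)
    moreover have "range (\<lambda>k. complex_of_real (g k)) \<subseteq> \<real>\<^sub>\<ge>\<^sub>0" using g0 by auto
    ultimately show ?thesis
      using \<delta> g0 by (intro exI[of _ \<delta>] exI[of _ "\<lambda>k. of_real (g k)"]) (auto simp: abs_of_nonneg)
  qed
  obtain g where g: "\<forall>x\<in>?S. ((\<lambda>n. zeta_term (n + M) x) sums g x) \<and> g field_differentiable (at x)"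
  proof (rule series_differentiable_comparison_complex[OF op _ ex])
    fix n x assume "x \<in> ?S"
    thus "zeta_term (n + M) field_differentiable at x"
      using d[of "n + M"] M op holomorphic_on_imp_differentiable_at by simp
  qed
  have "g holomorphic_on ?S"
    using g unfolding holomorphic_on_def by (auto intro: field_differentiable_at_within)
  moreover have "g x = zeta_rem M x" if "x \<in> ?S" for x
    using g that unfolding zeta_rem_def by (auto simp: sums_iff)
  ultimately show ?thesis by (rule holomorphic_transform)
qed

lemma sum_zeta_term:
  "(\<Sum>k<K. zeta_term (k + M) s) = (\<Sum>n=1..M+K. of_nat n powr -s) - (\<Sum>n=1..M. of_nat n powr -s)
     - (of_nat (M + K) powr (1 - s) - of_nat M powr (1 - s)) / (1 - s)"
  by (induction K) (auto simp: zeta_term_def diff_divide_distrib add_ac)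

text \<open>For \<open>Re s > 1\<close> let K grow in \<open>sum_zeta_term\<close>; both sides are
  holomorphic on the punctured half-plane \<open>Re s > 0\<close>, which is connected. The free
  parameter M is later matched to the height of s.\<close>

lemma zeta_eq_approx:
  assumes M: "M > 0" and s: "Re s > 0" "s \<noteq> 1"
  shows "riemann_zeta s = (\<Sum>n=1..M. of_nat n powr -s) + of_nat M powr (1 - s) / (s - 1) + zeta_rem M s"
proof (rule analytic_continuation_open[of "{s. Re s > 1}" "{s. Re s > 0} - {1::complex}" riemann_zeta
      "\<lambda>s. (\<Sum>n=1..M. of_nat n powr -s) + of_nat M powr (1 - s) / (s - 1) + zeta_rem M s"])
  show "open ({s. Re s > 0} - {1::complex})" by (intro open_Diff) (auto simp: open_halfspace_Re_gt)
  show "connected ({s. Re s > 0} - {1::complex})"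
    by (rule connected_open_delete)
       (auto simp: open_halfspace_Re_gt intro!: convex_connected convex_halfspace_Re_gt)
  have "(2::complex) \<in> {s. Re s > 1}" by simp
  thus "{s::complex. Re s > 1} \<noteq> {}" by blast
  show "riemann_zeta holomorphic_on {s. Re s > 0} - {1}"
    by (rule holomorphic_on_subset[OF riemann_zeta(1)]) auto
  show "(\<lambda>s. (\<Sum>n=1..M. of_nat n powr -s) + of_nat M powr (1 - s) / (s - 1) + zeta_rem M s)
      holomorphic_on {s. Re s > 0} - {1}"
    using M by (intro holomorphic_intros zeta_rem_holomorphic) auto
  fix z :: complex assume "z \<in> {s. Re s > 1}"
  hence z: "Re z > 1" by simp
  hence z1: "z \<noteq> 1" by auto
  have "(\<lambda>K. \<Sum>n<K. of_nat (Suc n) powr -z) \<longlonglongrightarrow> riemann_zeta z"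
    using riemann_zeta(2)[OF z] by (simp add: sums_def)
  hence "(\<lambda>K. \<Sum>n=1..K. of_nat n powr -z) \<longlonglongrightarrow> riemann_zeta z"
    by (simp add: sum.atLeast1_atMost_eq)
  hence L1: "(\<lambda>K. \<Sum>n=1..M+K. of_nat n powr -z) \<longlonglongrightarrow> riemann_zeta z"
    using LIMSEQ_ignore_initial_segment[of _ _ M] by (simp add: add.commute)
  have "(\<lambda>K. norm (of_nat (M + K) powr (1 - z) :: complex)) \<longlonglongrightarrow> 0"
    unfolding norm_of_nat_powr using z by simp real_asymp
  hence L2: "(\<lambda>K. of_nat (M + K) powr (1 - z) :: complex) \<longlonglongrightarrow> 0"
    by (rule tendsto_norm_zero_cancel)
  have "(\<lambda>K. \<Sum>k<K. zeta_term (k + M) z) \<longlonglongrightarrow> riemann_zeta z - (\<Sum>n=1..M. of_nat n powr -z)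
     - (0 - of_nat M powr (1 - z)) / (1 - z)"
    unfolding sum_zeta_term by (intro tendsto_intros L1 L2) (use z1 in auto)
  moreover have "(\<lambda>K. \<Sum>k<K. zeta_term (k + M) z) \<longlonglongrightarrow> zeta_rem M z"
    using zeta_rem_sums[OF M, of 1 z] z z1 by (simp add: sums_def)
  ultimately have "zeta_rem M z = riemann_zeta z - (\<Sum>n=1..M. of_nat n powr -z)
     - (0 - of_nat M powr (1 - z)) / (1 - z)" by (rule LIMSEQ_unique[rotated])
  moreover have "of_nat M powr (1 - z) / (1 - z) = - (of_nat M powr (1 - z) / (z - 1))"
    using z1 by (simp add: field_simps)
  ultimately show "riemann_zeta z = (\<Sum>n=1..M. of_nat n powr -z) + of_nat M powr (1 - z) / (z - 1) + zeta_rem M z"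
    by (simp add: algebra_simps)
qed (use s in \<open>auto simp: open_halfspace_Re_gt\<close>)

lemma sum_powr_le:
  assumes a: "0 < a" "a < 1"
  shows "(\<Sum>n=1..M. real n powr -a) \<le> real M powr (1 - a) / (1 - a)"
proof (induction M)
  case (Suc M)
  have "real (Suc M) powr -a \<le> real (Suc M) powr (1 - a) / (1 - a) - real M powr (1 - a) / (1 - a)"
  proof (cases "M = 0")
    case False
    have "\<exists>z. real M < z \<and> z < real (Suc M) \<and>
      real (Suc M) powr (1 - a) / (1 - a) - real M powr (1 - a) / (1 - a) = (real (Suc M) - real M) * z powr -a"
      by (rule MVT2) (use a False in \<open>auto intro!: derivative_eq_intros\<close>)
    then obtain z where z: "real M < z" "z < real (Suc M)"
      "real (Suc M) powr (1 - a) / (1 - a) - real M powr (1 - a) / (1 - a) = z powr -a" by auto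
    have "real (Suc M) powr -a \<le> z powr -a"
      using z a False by (intro powr_mono2') auto
    thus ?thesis using z(3) by simp
  qed (use a in simp)
  thus ?case using Suc.IH by simp
qed simp

lemma zeta_strip_bound:
  assumes a: "0 < a" "a < 1" and T: "T > 0" and b: "b > 0"
  shows "\<exists>C>0. \<forall>s. a \<le> Re s \<and> Re s \<le> b \<and> \<bar>Im s\<bar> \<ge> T \<longrightarrow> norm (riemann_zeta s) \<le> C * \<bar>Im s\<bar> powr (1 - a)"
proof (intro exI conjI allI impI)
  \<comment> \<open>One summand for each of the three parts of \<open>zeta_eq_approx\<close>: the
    sum, the pole term and the remainder.\<close>
  define D where "D = 1 / (1 - a) + 1 / T + (b + 1) / a"
  have D: "D > 0" unfolding D_def using a T b by (intro add_pos_pos divide_pos_pos) auto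
  show "D * (1 + 1 / T) powr (1 - a) > 0"
    using D T add_pos_pos[of 1 "1 / T"] by (intro mult_pos_pos) auto
  fix s assume "a \<le> Re s \<and> Re s \<le> b \<and> \<bar>Im s\<bar> \<ge> T"
  hence s: "a \<le> Re s" "Re s \<le> b" "\<bar>Im s\<bar> \<ge> T" by auto
  \<comment> \<open>Cutting at the height of s balances the parts: the sum is of order
    \<open>M^(1 - a)\<close>, and so is the remainder, bounded by a multiple of
    \<open>norm s * M^(-a)\<close>.\<close>
  define M where "M = nat \<lceil>\<bar>Im s\<bar>\<rceil>"
  have M: "M > 0" "\<bar>Im s\<bar> \<le> real M" "real M \<le> \<bar>Im s\<bar> + 1"
    unfolding M_def using s(3) T by (auto simp: of_nat_ceiling)
  have s1: "s \<noteq> 1" using s(3) T by auto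
  have mono: "real n powr (- Re s) \<le> real n powr -a" if "n > 0" for n
    using that s(1) by (intro powr_mono) auto
  have "norm (\<Sum>n=1..M. of_nat n powr -s :: complex) \<le> (\<Sum>n=1..M. real n powr -a)"
    by (rule sum_norm_le) (use mono in \<open>auto simp: norm_of_nat_powr\<close>)
  also have "\<dots> \<le> real M powr (1 - a) / (1 - a)" by (rule sum_powr_le[OF a])
  finally have 1: "norm (\<Sum>n=1..M. of_nat n powr -s :: complex) \<le> real M powr (1 - a) * (1 / (1 - a))" by simp
  have "T \<le> norm (s - 1)" using abs_Im_le_cmod[of "s - 1"] s(3) by simp
  hence "norm (of_nat M powr (1 - s) / (s - 1)) \<le> real M powr (1 - a) / T"
    unfolding norm_divide norm_of_nat_powr using M s(1) T
    by (intro frac_le powr_mono) auto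
  hence 2: "norm (of_nat M powr (1 - s) / (s - 1)) \<le> real M powr (1 - a) * (1 / T)" by simp
  have "norm s \<le> \<bar>Re s\<bar> + \<bar>Im s\<bar>" by (rule cmod_le)
  also have "\<dots> \<le> b * real M + real M"
  proof -
    have "\<bar>Re s\<bar> \<le> b" using s a by simp
    also have "\<dots> \<le> b * real M" using b M(1) by simp
    finally show ?thesis using M(2) by simp
  qed
  finally have ns: "norm s \<le> (b + 1) * real M" by (simp add: algebra_simps)
  have "norm (zeta_rem M s) \<le> norm s / a * real M powr -a"
    by (rule norm_zeta_rem_le[OF M(1) a(1) s(1) s1])
  also have "\<dots> \<le> (b + 1) * real M / a * real M powr -a"
    using ns a by (intro mult_right_mono divide_right_mono) auto
  also have "\<dots> = real M powr (1 - a) * ((b + 1) / a)"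
    using M(1) by (simp add: powr_diff powr_minus field_simps)
  finally have 3: "norm (zeta_rem M s) \<le> real M powr (1 - a) * ((b + 1) / a)" .
  have "norm (riemann_zeta s) \<le> norm (\<Sum>n=1..M. of_nat n powr -s :: complex)
      + norm (of_nat M powr (1 - s) / (s - 1)) + norm (zeta_rem M s)"
    unfolding zeta_eq_approx[OF M(1) order.strict_trans2[OF a(1) s(1)] s1]
    by (intro norm_triangle_le add_right_mono norm_triangle_ineq)
  also have "\<dots> \<le> real M powr (1 - a) * D"
    using 1 2 3 unfolding D_def by (simp add: algebra_simps)
  also have "\<dots> \<le> ((1 + 1 / T) * \<bar>Im s\<bar>) powr (1 - a) * D"
  proof (intro mult_right_mono powr_mono2)
    have "1 \<le> \<bar>Im s\<bar> / T" using s(3) T by simp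
    thus "real M \<le> (1 + 1 / T) * \<bar>Im s\<bar>" using M(3) by (simp add: algebra_simps)
  qed (use a D in auto)
  also have "\<dots> = D * (1 + 1 / T) powr (1 - a) * \<bar>Im s\<bar> powr (1 - a)"
    using T by (simp add: powr_mult)
  finally show "norm (riemann_zeta s) \<le> D * (1 + 1 / T) powr (1 - a) * \<bar>Im s\<bar> powr (1 - a)" .
qed

text \<open>The value at 1 is the residue of \<zeta>; the plain product would give 0 there because
  of the dummy value at the pole.\<close>

definition entire_zeta :: "complex \<Rightarrow> complex" where
  "entire_zeta s = (if s = 1 then 1 else (s - 1) * riemann_zeta s)"

lemma entire_zeta_holomorphic: "entire_zeta holomorphic_on UNIV"
proof (rule no_isolated_singularity[of UNIV _ "{1}"])
  have h: "(\<lambda>s. (s - 1) * riemann_zeta s) holomorphic_on UNIV - {1}"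
    by (intro holomorphic_intros holomorphic_on_subset[OF riemann_zeta(1)]) auto
  show h': "entire_zeta holomorphic_on UNIV - {1}"
    by (rule holomorphic_transform[OF h]) (simp add: entire_zeta_def)
  \<comment> \<open>This is \<open>zeta_eq_approx\<close> with \<open>M = 1\<close>, multiplied by
    \<open>s - 1\<close>; the remainder is bounded near 1, so its contribution tends to 0.\<close>
  have "((\<lambda>s. (s - 1) + 1 + (s - 1) * zeta_rem 1 s) \<longlongrightarrow> (1 - 1) + 1 + 0) (at 1)"
  proof (intro tendsto_add tendsto_diff tendsto_ident_at tendsto_const)
    show "((\<lambda>s. (s - 1) * zeta_rem 1 s) \<longlongrightarrow> 0) (at 1)"
    proof (rule Lim_null_comparison)
      show "\<forall>\<^sub>F s in at 1. norm ((s - 1) * zeta_rem 1 s) \<le> norm (s - 1) * (norm s / (1/2))"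
        unfolding eventually_at
      proof (intro exI[of _ "1/2"] conjI ballI impI)
        fix s :: complex assume s: "s \<noteq> 1 \<and> dist s 1 < 1 / 2"
        hence "\<bar>Re (s - 1)\<bar> < 1/2" using abs_Re_le_cmod[of "s - 1"] by (simp add: dist_norm)
        hence "1/2 \<le> Re s" unfolding minus_complex.sel one_complex.sel by linarith
        from norm_zeta_rem_le[OF _ _ this, of 1] s
        show "norm ((s - 1) * zeta_rem 1 s) \<le> norm (s - 1) * (norm s / (1/2))"
          unfolding norm_mult by (intro mult_left_mono) auto
      qed simp
      have "((\<lambda>s::complex. norm (s - 1) * (norm s / (1/2))) \<longlongrightarrow> norm (1 - 1 :: complex) * (norm (1::complex) / (1/2))) (at 1)"
        by (intro tendsto_intros) auto
      thus "((\<lambda>s::complex. norm (s - 1) * (norm s / (1/2))) \<longlongrightarrow> 0) (at 1)" by simp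
    qed
  qed
  moreover have "\<forall>\<^sub>F s in at 1. (s - 1) + 1 + (s - 1) * zeta_rem 1 s = entire_zeta s"
    unfolding eventually_at
  proof (intro exI[of _ 1] conjI ballI impI)
    fix s :: complex assume s: "s \<noteq> 1 \<and> dist s 1 < 1"
    hence "\<bar>Re (s - 1)\<bar> < 1" using abs_Re_le_cmod[of "s - 1"] by (simp add: dist_norm)
    hence "Re s > 0" unfolding minus_complex.sel one_complex.sel by linarith
    from zeta_eq_approx[OF _ this, of 1] s
    show "(s - 1) + 1 + (s - 1) * zeta_rem 1 s = entire_zeta s"
      by (simp add: entire_zeta_def field_simps)
  qed simp
  ultimately have "(entire_zeta \<longlongrightarrow> 1) (at 1)"
    by (simp add: tendsto_cong)
  hence "isCont entire_zeta 1" by (simp add: isCont_def entire_zeta_def)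
  moreover have "isCont entire_zeta s" if "s \<noteq> 1" for s
  proof -
    have "continuous_on (UNIV - {1}) entire_zeta" using h' by (rule holomorphic_on_imp_continuous_on)
    thus ?thesis using that by (subst (asm) continuous_on_eq_continuous_at) (auto intro: open_Diff)
  qed
  ultimately show "continuous_on UNIV entire_zeta"
    by (metis continuous_at_imp_continuous_on)
qed auto

text \<open>Controls the factor that enters \<open>zeta_341\<close> as a cube. The pole term
  contributes \<open>1 / (\<sigma> - 1)\<close>, and the other terms add up to 3, at most
  \<open>3 / (\<sigma> - 1)\<close>.\<close>

lemma norm_zeta_real_le:
  assumes "1 < \<sigma>" "\<sigma> \<le> 2"
  shows "norm (riemann_zeta (of_real \<sigma>)) \<le> 4 / (\<sigma> - 1)"
proof -
  have n: "norm (complex_of_real \<sigma> - 1) = \<sigma> - 1"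
    using assms norm_of_real[of "\<sigma> - 1", where 'a = complex] by simp
  have "norm (riemann_zeta (of_real \<sigma>)) \<le> norm (1 + 1 / (of_real \<sigma> - 1) :: complex) + norm (zeta_rem 1 (of_real \<sigma>))"
    using zeta_eq_approx[of 1 "of_real \<sigma>"] assms norm_triangle_ineq by simp
  also have "norm (1 + 1 / (of_real \<sigma> - 1) :: complex) \<le> 1 + 1 / (\<sigma> - 1)"
    by (rule norm_triangle_le) (simp add: norm_divide n)
  also have "norm (zeta_rem 1 (of_real \<sigma>)) \<le> 2"
    using norm_zeta_rem_le[of 1 1 "of_real \<sigma>"] assms by simp
  also have "1 + 1 / (\<sigma> - 1) + 2 \<le> 4 / (\<sigma> - 1)"
  proof -
    have "3 \<le> 3 / (\<sigma> - 1)" using assms by (simp add: le_divide_eq)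
    thus ?thesis by simp
  qed
  finally show ?thesis by simp
qed

lemma zeta_nonzero: "Re s > 1 \<Longrightarrow> riemann_zeta s \<noteq> 0"
  using zeta_341[of "Re s" "Im s"] by (auto simp: complex_eq)

text \<open>Cauchy's inequality on a disc of fixed radius: radius at most e keeps it in
  \<open>Re x \<ge> 1 - e\<close>, where \<zeta> grows like the power e, and radius at most
  \<open>T / 2\<close> keeps it away from the pole.\<close>

lemma zeta_higher_deriv_bound:
  assumes e: "0 < e" "e < 1" and T: "T > 0"
  shows "\<exists>C>0. \<forall>s. 1 \<le> Re s \<and> Re s \<le> 2 \<and> \<bar>Im s\<bar> \<ge> T \<longrightarrow>
           norm ((deriv ^^ k) riemann_zeta s) \<le> C * (1 + \<bar>Im s\<bar>) powr e"
proof -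
  obtain C where C: "C > 0" "\<And>s. 1 - e \<le> Re s \<Longrightarrow> Re s \<le> 4 \<Longrightarrow> \<bar>Im s\<bar> \<ge> T / 2 \<Longrightarrow>
      norm (riemann_zeta s) \<le> C * \<bar>Im s\<bar> powr e"
    using zeta_strip_bound[of "1 - e" "T / 2" 4] e T by auto
  define r where "r = min e (T / 2)"
  have r: "r > 0" "r \<le> e" "r \<le> T / 2" using e T by (auto simp: r_def)
  show ?thesis
  proof (intro exI conjI allI impI)
    show "fact k * (C * 2 powr e) / r ^ k > 0" using C(1) r by simp
    fix s assume "1 \<le> Re s \<and> Re s \<le> 2 \<and> \<bar>Im s\<bar> \<ge> T"
    hence s: "1 \<le> Re s" "Re s \<le> 2" "\<bar>Im s\<bar> \<ge> T" by auto
    have near: "\<bar>Re s - Re x\<bar> \<le> r" "\<bar>Im s - Im x\<bar> \<le> r" if "norm (s - x) \<le> r" for x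
      using that abs_Re_le_cmod[of "s - x"] abs_Im_le_cmod[of "s - x"] by auto
    have ne1: "x \<noteq> 1" if "norm (s - x) \<le> r" for x
      using near(2)[OF that] s(3) r T by auto
    have hol: "riemann_zeta holomorphic_on cball s r"
      by (rule holomorphic_on_subset[OF riemann_zeta(1)]) (use ne1 in \<open>auto simp: dist_norm\<close>)
    have "norm ((deriv ^^ k) riemann_zeta s) \<le> fact k * (C * 2 powr e * (1 + \<bar>Im s\<bar>) powr e) / r ^ k"
    proof (rule Cauchy_inequality)
      show "riemann_zeta holomorphic_on ball s r" by (rule holomorphic_on_subset[OF hol]) auto
      show "continuous_on (cball s r) riemann_zeta" using hol by (rule holomorphic_on_imp_continuous_on)
      fix x assume x: "norm (s - x) = r"
      hence nx: "\<bar>Re s - Re x\<bar> \<le> r" "\<bar>Im s - Im x\<bar> \<le> r" using near[of x] by auto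
      have "norm (riemann_zeta x) \<le> C * \<bar>Im x\<bar> powr e"
        by (rule C(2)) (use nx s r e in linarith)+
      also have "\<dots> \<le> C * (2 * (1 + \<bar>Im s\<bar>)) powr e"
        using nx s(3) r T C(1) e by (intro mult_left_mono powr_mono2) auto
      finally show "norm (riemann_zeta x) \<le> C * 2 powr e * (1 + \<bar>Im s\<bar>) powr e"
        by (simp only: powr_mult mult.assoc)
    qed (fact r(1))
    thus "norm ((deriv ^^ k) riemann_zeta s) \<le> fact k * (C * 2 powr e) / r ^ k * (1 + \<bar>Im s\<bar>) powr e"
      by (simp add: mult_ac)
  qed
qed

text \<open>The inequality \<open>zeta_341\<close> bounds \<open>\<zeta>\<close> from below at distance \<open>\<eta>\<close> from the line \<open>Re s = 1\<close>, and the bound on \<open>\<zeta>'\<close>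
  carries this over to the line if \<open>\<eta>\<close> is a small multiple of \<open>\<bar>Im s\<bar> powr (-5 * e)\<close>.\<close>

lemma zeta_lower_bound:
  assumes e: "0 < e" "e < 1" and T: "T > 0"
  shows "\<exists>c>0. \<forall>s. 1 < Re s \<and> Re s \<le> 2 \<and> \<bar>Im s\<bar> \<ge> T \<longrightarrow>
           norm (riemann_zeta s) \<ge> c / ((1 + \<bar>Im s\<bar>) powr e) ^ 4"
proof -
  obtain C where C: "C > 0" "\<And>s. 1 \<le> Re s \<Longrightarrow> Re s \<le> 2 \<Longrightarrow> \<bar>Im s\<bar> \<ge> T \<Longrightarrow>
      norm (riemann_zeta s) \<le> C * (1 + \<bar>Im s\<bar>) powr e"
    using zeta_higher_deriv_bound[OF assms, of 0] by auto
  obtain C' where C': "C' > 0" "\<And>s. 1 \<le> Re s \<Longrightarrow> Re s \<le> 2 \<Longrightarrow> \<bar>Im s\<bar> \<ge> T \<Longrightarrow>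
      norm (deriv riemann_zeta s) \<le> C' * (1 + \<bar>Im s\<bar>) powr e"
    using zeta_higher_deriv_bound[OF assms, of 1] by auto
  \<comment> \<open>Here \<open>128 = 4^3 * 2\<close>: the cube of the bound on the real axis, and
    the factor lost when the height is doubled.\<close>
  define c where "c = 1 / (128 * C)"
  have c: "c > 0" using C(1) by (simp add: c_def)
  define u where "u s = (1 + \<bar>Im s\<bar>) powr e" for s
  have u1: "u s \<ge> 1" for s unfolding u_def using e by (intro ge_one_powr_ge_zero) auto
  have base: "norm (riemann_zeta s) ^ 4 \<ge> c * (Re s - 1) ^ 3 / u s"
    if s: "1 < Re s" "Re s \<le> 2" "\<bar>Im s\<bar> \<ge> T" for s
  proof -
    define x where "x = Re s - 1"
    have x: "x > 0" using s by (simp add: x_def)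
    have "1 \<le> norm (riemann_zeta (of_real (Re s))) ^ 3 * norm (riemann_zeta s) ^ 4
        * norm (riemann_zeta (Complex (Re s) (2 * Im s)))"
      using zeta_341[OF s(1), of "Im s"] by (simp add: norm_mult norm_power)
    also have "\<dots> \<le> (4 / x) ^ 3 * norm (riemann_zeta s) ^ 4 * (C * (2 * u s))"
    proof (intro mult_mono mult_right_mono power_mono)
      show "norm (riemann_zeta (of_real (Re s))) \<le> 4 / x"
        unfolding x_def using norm_zeta_real_le s by simp
      have "norm (riemann_zeta (Complex (Re s) (2 * Im s))) \<le> C * (1 + \<bar>2 * Im s\<bar>) powr e"
        using C(2)[of "Complex (Re s) (2 * Im s)"] s T by simp
      also have "(1 + \<bar>2 * Im s\<bar>) powr e \<le> (2 * (1 + \<bar>Im s\<bar>)) powr e"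
        using e by (intro powr_mono2) auto
      also have "\<dots> \<le> 2 powr 1 * u s"
        unfolding u_def powr_mult using e by (intro mult_right_mono powr_mono) auto
      finally show "norm (riemann_zeta (Complex (Re s) (2 * Im s))) \<le> C * (2 * u s)"
        using C(1) by simp
    qed (use x C(1) in auto)
    finally have "1 * (c * x ^ 3 / u s) \<le> (4 / x) ^ 3 * norm (riemann_zeta s) ^ 4 * (C * (2 * u s)) * (c * x ^ 3 / u s)"
      using x c u1[of s] by (intro mult_right_mono) auto
    also have "\<dots> = norm (riemann_zeta s) ^ 4"
      unfolding c_def using x C(1) u1[of s] by (simp add: field_simps)
    finally show ?thesis by (simp add: x_def)
  qed
  \<comment> \<open>The first entry lets the variation of \<zeta> consume at most half of the bound
    in \<open>far\<close>; the others ensure \<open>\<eta> s \<le> 1\<close>, so that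
    \<open>1 + \<eta> s\<close> stays in the strip.\<close>
  define m where "m = min (1 / (2 * C')) (min 1 (1 / c))"
  have m: "m > 0" "m \<le> 1" "C' * m \<le> 1 / 2" "c * m \<le> 1"
  proof -
    show "m > 0" "m \<le> 1" using C' c by (auto simp: m_def)
    have "C' * m \<le> C' * (1 / (2 * C'))" unfolding m_def using C'(1) by (intro mult_left_mono) auto
    thus "C' * m \<le> 1 / 2" using C'(1) by simp
    have "c * m \<le> c * (1 / c)" unfolding m_def using c by (intro mult_left_mono) auto
    thus "c * m \<le> 1" using c by simp
  qed
  \<comment> \<open>At this distance two things fit: \<open>c * \<eta>^3 / u\<close> from
    \<open>base\<close> is the fourth power of \<open>c * m^3 / u^4\<close>, and the variation
    \<open>C' * u * \<eta>\<close> is \<open>C' * m\<close> times that same quantity.\<close>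
  define \<eta> where "\<eta> s = c * m ^ 4 / u s ^ 5" for s
  have \<eta>0: "\<eta> s > 0" for s unfolding \<eta>_def using c m u1[of s] by simp
  have \<eta>1: "\<eta> s \<le> 1" for s
  proof -
    have "c * m ^ 4 = (c * m) * m ^ 3" by (simp add: power4_eq_xxxx power3_eq_cube)
    also have "\<dots> \<le> 1 * 1 ^ 3" using m c by (intro mult_mono power_mono) auto
    also have "\<dots> \<le> u s ^ 5" using u1[of s] by (simp add: one_le_power)
    finally show ?thesis unfolding \<eta>_def using u1[of s] by (simp add: divide_le_eq)
  qed
  have far: "norm (riemann_zeta s) \<ge> c * m ^ 3 / u s ^ 4"
    if s: "1 + \<eta> s \<le> Re s" "Re s \<le> 2" "\<bar>Im s\<bar> \<ge> T" for s
  proof -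
    have "(c * m ^ 3 / u s ^ 4) ^ 4 = c * \<eta> s ^ 3 / u s"
      unfolding \<eta>_def using u1[of s] c m by (simp add: field_simps flip: power_mult power_add power_Suc)
    also have "\<dots> \<le> c * (Re s - 1) ^ 3 / u s"
      using s(1) \<eta>0[of s] c u1[of s] by (intro divide_right_mono mult_left_mono power_mono) auto
    also have "\<dots> \<le> norm (riemann_zeta s) ^ 4"
      by (rule base) (use s \<eta>0[of s] in auto)
    finally show ?thesis by (rule power_le_imp_le_base[of _ 3, simplified]) simp
  qed
  have "norm (riemann_zeta s) \<ge> c * m ^ 3 / 2 / u s ^ 4"
    if s: "1 < Re s" "Re s \<le> 2" "\<bar>Im s\<bar> \<ge> T" for s
  proof (cases "1 + \<eta> s \<le> Re s")
    case True
    have "c * m ^ 3 / 2 / u s ^ 4 \<le> c * m ^ 3 / u s ^ 4"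
      using c m u1[of s] by (intro divide_right_mono) auto
    thus ?thesis using far[OF True s(2,3)] by linarith
  next
    case False
    \<comment> \<open>The point at the same height where \<open>far\<close> applies; it is less than
      \<open>\<eta> s\<close> away from s.\<close>
    define w where "w = Complex (1 + \<eta> s) (Im s)"
    have w: "u w = u s" "\<eta> w = \<eta> s" "Re w = 1 + \<eta> s" "Im w = Im s"
      by (simp_all add: w_def u_def \<eta>_def)
    let ?S = "closed_segment s w"
    have "norm (riemann_zeta s - riemann_zeta w) \<le> C' * u s * norm (s - w)"
    proof (rule field_differentiable_bound[of ?S riemann_zeta "deriv riemann_zeta"])
      fix z assume z: "z \<in> ?S"
      then obtain v where v: "0 \<le> v" "v \<le> 1" "z = (1 - v) *\<^sub>R s + v *\<^sub>R w"
        by (auto simp: closed_segment_def)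
      have Imz: "Im z = Im s" unfolding v(3) using w(4) by (simp add: algebra_simps)
      have "Re z = Re s + v * (1 + \<eta> s - Re s)" unfolding v(3) using w(3) by (simp add: algebra_simps)
      moreover have "0 \<le> v * (1 + \<eta> s - Re s)" "v * (1 + \<eta> s - Re s) \<le> 1 * (1 + \<eta> s - Re s)"
        using v False by (auto intro!: mult_nonneg_nonneg mult_right_mono)
      ultimately have Rez: "1 \<le> Re z" "Re z \<le> 2" using s \<eta>1[of s] by auto
      have "z \<noteq> 1" using Imz s(3) T by auto
      hence "(riemann_zeta has_field_derivative deriv riemann_zeta z) (at z)"
        by (intro holomorphic_derivI[OF riemann_zeta(1)]) auto
      thus "(riemann_zeta has_field_derivative deriv riemann_zeta z) (at z within ?S)"
        by (rule has_field_derivative_at_within)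
      show "norm (deriv riemann_zeta z) \<le> C' * u s"
        using C'(2)[OF Rez] s(3) Imz by (simp add: u_def)
    qed auto
    also have "norm (s - w) \<le> \<eta> s"
    proof -
      have "s - w = of_real (Re s - 1 - \<eta> s)" by (simp add: complex_eq_iff w_def)
      hence "norm (s - w) = \<bar>Re s - 1 - \<eta> s\<bar>" by (simp only: norm_of_real)
      thus ?thesis using False s(1) by simp
    qed
    also have "C' * u s * \<eta> s = (C' * m) * (c * m ^ 3 / u s ^ 4)"
      unfolding \<eta>_def using u1[of s] by (simp add: field_simps power_numeral_reduce)
    also have "\<dots> \<le> 1 / 2 * (c * m ^ 3 / u s ^ 4)"
      by (rule mult_right_mono[OF m(3)]) (use c m u1[of s] in auto)
    finally have "norm (riemann_zeta s - riemann_zeta w) \<le> 1 / 2 * (c * m ^ 3 / u s ^ 4)"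
      using C'(1) u1[of s] by (simp add: mult_left_mono)
    moreover have "norm (riemann_zeta w) \<ge> c * m ^ 3 / u s ^ 4"
      using far[of w] w s \<eta>1[of s] by simp
    moreover have "norm (riemann_zeta w) \<le> norm (riemann_zeta s) + norm (riemann_zeta s - riemann_zeta w)"
      using norm_triangle_ineq3[of "riemann_zeta s" "riemann_zeta w"] by linarith
    moreover have "c * m ^ 3 / 2 / u s ^ 4 = 1 / 2 * (c * m ^ 3 / u s ^ 4)" by simp
    moreover have "y \<le> z" if "a \<le> 1 / 2 * x" "x \<le> w" "w \<le> z + a" "y = 1 / 2 * x" for a w x y z :: real
      using that by linarith
    ultimately show ?thesis by blast
  qed
  moreover have "c * m ^ 3 / 2 > 0" using c m by simp
  ultimately show ?thesis unfolding u_def by blast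
qed

lemma deriv_inverse_zeta:
  assumes s: "Re s > 1"
  defines "Z \<equiv> \<lambda>k. (deriv ^^ k) riemann_zeta s"
  shows "deriv (\<lambda>s. 1 / riemann_zeta s) s = - Z 1 / Z 0 ^ 2"
    and "(deriv ^^ 2) (\<lambda>s. 1 / riemann_zeta s) s = - Z 2 / Z 0 ^ 2 + 2 * Z 1 ^ 2 / Z 0 ^ 3"
proof -
  let ?U = "{s::complex. Re s > 1}"
  let ?B = "\<lambda>s. 1 / riemann_zeta s"
  have op: "open ?U" by (simp add: open_halfspace_Re_gt)
  have h: "riemann_zeta holomorphic_on ?U"
    by (rule holomorphic_on_subset[OF riemann_zeta(1)]) auto
  have h': "deriv riemann_zeta holomorphic_on ?U" by (rule holomorphic_deriv[OF h op])
  note [derivative_intros] = holomorphic_derivI[OF h op] holomorphic_derivI[OF h' op]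
  have B1: "deriv ?B z = - deriv riemann_zeta z / riemann_zeta z ^ 2" if "z \<in> ?U" for z
    using that zeta_nonzero[of z]
    by (intro DERIV_imp_deriv) (auto intro!: derivative_eq_intros simp: power2_eq_square)
  thus "deriv ?B s = - Z 1 / Z 0 ^ 2" using s by (simp add: Z_def)
  have "((\<lambda>z. - deriv riemann_zeta z / riemann_zeta z ^ 2) has_field_derivative
      - Z 2 / Z 0 ^ 2 + 2 * Z 1 ^ 2 / Z 0 ^ 3) (at s)"
    using s zeta_nonzero[of s]
    by (auto intro!: derivative_eq_intros simp: Z_def power_numeral_reduce numeral_2_eq_2 field_simps)
  hence "(deriv ?B has_field_derivative - Z 2 / Z 0 ^ 2 + 2 * Z 1 ^ 2 / Z 0 ^ 3) (at s)"
    by (rule has_field_derivative_transform_within_open[OF _ op]) (use s B1 in auto)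
  thus "(deriv ^^ 2) ?B s = - Z 2 / Z 0 ^ 2 + 2 * Z 1 ^ 2 / Z 0 ^ 3"
    by (simp add: numeral_2_eq_2 DERIV_imp_deriv)
qed

text \<open>With exponent \<open>e\<close> for \<open>\<zeta>\<close> and its derivatives, \<open>1/\<zeta>\<close> has exponent \<open>4 e\<close>, so the worst term
  \<open>\<zeta>'^2 / \<zeta>^3\<close> has exponent \<open>14 e\<close>; hence \<open>e = 1/28\<close>.\<close>

lemma inverse_zeta_higher_deriv_bound:
  assumes T: "T > 0" and k: "k \<le> 2"
  shows "\<exists>C>0. \<forall>s. 1 < Re s \<and> Re s \<le> 2 \<and> \<bar>Im s\<bar> \<ge> T \<longrightarrow>
           norm ((deriv ^^ k) (\<lambda>s. 1 / riemann_zeta s) s) \<le> C * (1 + \<bar>Im s\<bar>) powr (1/2)"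
proof -
  define u where "u s = (1 + \<bar>Im s\<bar>) powr (1/28)" for s
  have u1: "u s \<ge> 1" for s unfolding u_def by (intro ge_one_powr_ge_zero) auto
  have u14: "u s ^ 14 = (1 + \<bar>Im s\<bar>) powr (1/2)" for s
    unfolding u_def by (subst powr_power) auto
  obtain c where c: "c > 0" "\<And>s. 1 < Re s \<Longrightarrow> Re s \<le> 2 \<Longrightarrow> \<bar>Im s\<bar> \<ge> T \<Longrightarrow>
      norm (riemann_zeta s) \<ge> c / u s ^ 4"
    using zeta_lower_bound[of "1/28" T] T unfolding u_def by auto
  obtain C where C: "\<And>k. C k > 0" "\<And>k s. 1 \<le> Re s \<Longrightarrow> Re s \<le> 2 \<Longrightarrow> \<bar>Im s\<bar> \<ge> T \<Longrightarrow>
      norm ((deriv ^^ k) riemann_zeta s) \<le> C k * u s"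
    using zeta_higher_deriv_bound[of "1/28" T] T unfolding u_def by simp metis
  define D where "D = 1 / c + C 1 / c ^ 2 + (C 2 / c ^ 2 + 2 * C 1 ^ 2 / c ^ 3)"
  have "norm ((deriv ^^ k) (\<lambda>s. 1 / riemann_zeta s) s) \<le> D * u s ^ 14"
    if s: "1 < Re s" "Re s \<le> 2" "\<bar>Im s\<bar> \<ge> T" for s
  proof -
    define Z where "Z k = norm ((deriv ^^ k) riemann_zeta s)" for k
    define I where "I = 1 / Z 0"
    have pos: "c / u s ^ 4 > 0" using c(1) u1[of s] by simp
    have I: "0 \<le> I" "I \<le> u s ^ 4 / c"
      using frac_le[OF _ order_refl pos c(2)[OF s], of 1] by (auto simp: I_def Z_def)
    have Zb: "Z k \<le> C k * u s" "0 \<le> Z k" for k using C(2)[of s k] s by (auto simp: Z_def)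
    have mono: "a * u s ^ j \<le> a * u s ^ 14" if "j \<le> 14" "a \<ge> 0" for a j
      using that u1[of s] by (intro mult_left_mono power_increasing) auto
    have c0: "1 / c \<ge> 0" "C 1 / c ^ 2 \<ge> 0" "C 2 / c ^ 2 \<ge> 0" "2 * C 1 ^ 2 / c ^ 3 \<ge> 0"
      using c(1) C(1)[of 1] C(1)[of 2] by auto
    have nn: "1 / c * u s ^ 14 \<ge> 0" "C 1 / c ^ 2 * u s ^ 14 \<ge> 0" "C 2 / c ^ 2 * u s ^ 14 \<ge> 0"
        "2 * C 1 ^ 2 / c ^ 3 * u s ^ 14 \<ge> 0"
      by (rule mult_nonneg_nonneg[OF c0(1)] mult_nonneg_nonneg[OF c0(2)] mult_nonneg_nonneg[OF c0(3)]
            mult_nonneg_nonneg[OF c0(4)]; use u1[of s] in simp)+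
    have 0: "I \<le> 1 / c * u s ^ 14" using I(2) mono[of 4 "1 / c"] c0 by simp
    have q: "Z k * I ^ 2 \<le> C k / c ^ 2 * u s ^ 9" for k
    proof -
      have "Z k * I ^ 2 \<le> C k * u s * (u s ^ 4 / c) ^ 2"
        using I Zb[of k] C(1)[of k] u1[of s] by (intro mult_mono power_mono) auto
      moreover have "u s ^ 9 = u s * u s ^ 8" by (simp flip: power_Suc)
      ultimately show ?thesis by (simp add: power_divide mult.assoc flip: power_mult)
    qed
    have 1: "Z 1 * I ^ 2 \<le> C 1 / c ^ 2 * u s ^ 14" using q[of 1] mono[of 9 "C 1 / c ^ 2"] c0 by simp
    have 2: "Z 2 * I ^ 2 \<le> C 2 / c ^ 2 * u s ^ 14" using q[of 2] mono[of 9 "C 2 / c ^ 2"] c0 by simp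
    have "2 * Z 1 ^ 2 * I ^ 3 \<le> 2 * (C 1 * u s) ^ 2 * (u s ^ 4 / c) ^ 3"
      using I Zb[of 1] C(1)[of 1] u1[of s] by (intro mult_mono power_mono mult_left_mono) auto
    also have "\<dots> = 2 * C 1 ^ 2 / c ^ 3 * (u s ^ 2 * (u s ^ 4) ^ 3)"
      by (simp add: power_mult_distrib power_divide)
    also have "u s ^ 2 * (u s ^ 4) ^ 3 = u s ^ 14" by (simp flip: power_mult power_add)
    finally have 3: "2 * Z 1 ^ 2 * I ^ 3 \<le> 2 * C 1 ^ 2 / c ^ 3 * u s ^ 14" .
    consider "k = 0" | "k = 1" | "k = 2" using k by linarith
    thus ?thesis
    proof cases
      case 1
      hence "norm ((deriv ^^ k) (\<lambda>s. 1 / riemann_zeta s) s) = I"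
        by (simp add: I_def Z_def norm_divide)
      also have "\<dots> \<le> D * u s ^ 14"
        unfolding D_def distrib_right using 0 nn by linarith
      finally show ?thesis .
    next
      case k1: 2
      hence "norm ((deriv ^^ k) (\<lambda>s. 1 / riemann_zeta s) s) = Z 1 * I ^ 2"
        using deriv_inverse_zeta(1)[OF s(1)] by (simp add: I_def Z_def norm_divide norm_power power_divide)
      also have "\<dots> \<le> D * u s ^ 14"
        unfolding D_def distrib_right using 1 nn by linarith
      finally show ?thesis .
    next
      case k2: 3
      have "norm ((deriv ^^ k) (\<lambda>s. 1 / riemann_zeta s) s) \<le> Z 2 * I ^ 2 + 2 * Z 1 ^ 2 * I ^ 3"
        unfolding k2 deriv_inverse_zeta(2)[OF s(1)]
        by (rule norm_triangle_le) (simp add: I_def Z_def norm_divide norm_power norm_mult power_divide)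
      also have "\<dots> \<le> D * u s ^ 14"
        unfolding D_def distrib_right using 2 3 nn by linarith
      finally show ?thesis .
    qed
  qed
  moreover have "D > 0" unfolding D_def using c(1) C(1)[of 1] C(1)[of 2]
    by (intro add_pos_pos divide_pos_pos mult_pos_pos zero_less_power) auto
  ultimately show ?thesis unfolding u14 by blast
qed

section \<open>Vertical line integrals\<close>

text \<open>The common majorant of all vertical integrals: a numerator of growth
  \<open>t^(1/2)\<close> over a denominator of order \<open>t^2\<close>.\<close>

lemma integrable_decay: "integrable lborel (\<lambda>t::real. (1 + \<bar>t\<bar>) powr (- 3 / 2))"
proof -
  let ?h = "\<lambda>t::real. (1 + \<bar>t\<bar>) powr (- 3 / 2)"
  let ?g = "\<lambda>t. ?h t * indicator {0..} t"
  have "((\<lambda>t::real. - 2 * (1 + t) powr (- 1 / 2)) \<longlongrightarrow> 0) at_top" by real_asymp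
  hence "(\<integral>\<^sup>+t. ennreal (?h t) * indicator {0..} t \<partial>lborel) = ennreal (0 - - 2 * (1 + 0) powr (- 1 / 2))"
    by (intro nn_integral_FTC_atLeast[where F = "\<lambda>t. - 2 * (1 + t) powr (- 1 / 2)"])
       (auto intro!: derivative_eq_intros)
  hence "(\<integral>\<^sup>+t. ennreal (?g t) \<partial>lborel) < \<infinity>"
    by (simp add: nn_integral_set_ennreal)
  hence g: "integrable lborel ?g"
    by (intro integrableI_nonneg) auto
  hence "integrable lborel (\<lambda>t. ?g (0 + (-1) * t))"
    by (rule lborel_integrable_real_affine) simp
  hence "integrable lborel (\<lambda>t. ?g t + ?g (0 + (-1) * t))" using g by (rule Bochner_Integration.integrable_add[rotated])
  thus ?thesis
    by (rule Bochner_Integration.integrable_bound) (auto split: split_indicator)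
qed

lemma vertical_line_integrable:
  fixes f :: "complex \<Rightarrow> complex"
  assumes cont: "continuous_on {s. Re s = c} f"
    and decay: "\<And>t. \<bar>t\<bar> \<ge> T \<Longrightarrow> norm (f (Complex c t)) \<le> K * (1 + \<bar>t\<bar>) powr (- 3 / 2)"
  shows "integrable lborel (\<lambda>t. f (Complex c t))"
proof -
  let ?g = "\<lambda>t. f (Complex c t)"
  let ?h = "\<lambda>t::real. (1 + \<bar>t\<bar>) powr (- 3 / 2)"
  have cg: "continuous_on UNIV ?g"
    by (rule continuous_on_compose2[OF cont]) (auto simp: Complex_eq intro!: continuous_intros)
  have "compact (?g ` {-\<bar>T\<bar>..\<bar>T\<bar>})"
    by (intro compact_continuous_image continuous_on_subset[OF cg]) auto
  then obtain B where B: "\<And>t. t \<in> {-\<bar>T\<bar>..\<bar>T\<bar>} \<Longrightarrow> norm (?g t) \<le> B"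
    using compact_imp_bounded bounded_iff by (metis imageI)
  \<comment> \<open>The second entry divides the bound on the compact middle part by the least value
    of \<open>?h\<close> there.\<close>
  define L where "L = max \<bar>K\<bar> (B * (1 + \<bar>T\<bar>) powr (3 / 2))"
  have "norm (?g t) \<le> L * ?h t" for t
  proof (cases "\<bar>t\<bar> \<le> \<bar>T\<bar>")
    case True
    have B0: "0 \<le> B" by (rule order.trans[OF norm_ge_zero B[of t]]) (use True in auto)
    have "norm (?g t) \<le> B * (1 + \<bar>T\<bar>) powr (3 / 2 + - 3 / 2)"
      using B[of t] True by (simp add: abs_le_iff)
    also have "\<dots> = B * (1 + \<bar>T\<bar>) powr (3 / 2) * (1 + \<bar>T\<bar>) powr (- 3 / 2)"
      by (simp only: powr_add mult.assoc)
    also have "\<dots> \<le> L * ?h t"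
      unfolding L_def using True B0 by (intro mult_mono powr_mono2') auto
    finally show ?thesis .
  next
    case False
    hence "norm (?g t) \<le> K * ?h t" by (intro decay) auto
    also have "\<dots> \<le> L * ?h t" unfolding L_def by (intro mult_right_mono) auto
    finally show ?thesis .
  qed
  hence "norm (?g t) \<le> norm (L * ?h t)" for t using order.trans[OF _ abs_ge_self] by auto
  hence AE: "AE t in lborel. norm (?g t) \<le> norm (L * ?h t)" by (intro AE_I2)
  have "integrable lborel (\<lambda>t. L * ?h t)" using integrable_decay by (intro integrable_mult_right)
  moreover have "?g \<in> borel_measurable lborel" using borel_measurable_continuous_onI[OF cg] by simp
  ultimately show ?thesis using AE by (rule Bochner_Integration.integrable_bound)
qed

text \<open>Links the Lebesgue integral over the line to the integrals over the vertical sides of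
  finite rectangles.\<close>

lemma tendsto_symmetric_integral:
  fixes g :: "real \<Rightarrow> complex"
  assumes g: "integrable lborel g"
  shows "((\<lambda>R. integral {-R..R} g) \<longlongrightarrow> (LINT t|lborel. g t)) at_top"
proof -
  have "((\<lambda>R. LINT t|lborel. indicator {-R..R} t *\<^sub>R g t) \<longlongrightarrow> (LINT t|lborel. g t)) at_top"
  proof (rule integral_dominated_convergence_at_top[where w = "\<lambda>t. norm (g t)"])
    show "AE t in lborel. ((\<lambda>R. indicator {-R..R} t *\<^sub>R g t) \<longlongrightarrow> g t) at_top"
    proof (rule AE_I2, rule tendsto_eventually)
      fix t :: real
      show "\<forall>\<^sub>F R in at_top. indicator {-R..R} t *\<^sub>R g t = g t"
        using eventually_ge_at_top[of "\<bar>t\<bar>"] by eventually_elim (auto simp: indicator_def abs_le_iff)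
    qed
  qed (use g in \<open>auto split: split_indicator\<close>)
  moreover have "(LINT t|lborel. indicator {-R..R} t *\<^sub>R g t) = integral {-R..R} g" for R
  proof -
    have "set_integrable lborel {-R..R} g"
      unfolding set_integrable_def by (rule integrable_mult_indicator[OF _ g]) simp
    thus ?thesis
      using set_borel_integral_eq_integral(2)[of "{-R..R}" g] by (simp add: set_lebesgue_integral_def)
  qed
  ultimately show ?thesis by simp
qed

text \<open>The residue theorem on rectangles of growing height, whose horizontal sides contribute
  \<open>O(R^(-3/2))\<close>. Positive orientation runs up the line b and down the line a.\<close>

lemma contour_shift:
  assumes ab: "a' < a" "a < b" "b < b'" and z0: "a < Re z0" "Re z0 < b"
    and f: "f holomorphic_on {s. a' < Re s \<and> Re s < b'} - {z0}"
    and decay: "\<And>s. a \<le> Re s \<Longrightarrow> Re s \<le> b \<Longrightarrow> \<bar>Im s\<bar> \<ge> T \<Longrightarrow> norm (f s) \<le> K * (1 + \<bar>Im s\<bar>) powr (- 3 / 2)"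
  shows "vertical_line_integral b f - vertical_line_integral a f = 2 * of_real pi * \<i> * residue f z0"
proof -
  let ?S = "{s. a' < Re s \<and> Re s < b'}"
  have S: "open ?S" "convex ?S"
  proof -
    have eq: "?S = {s. Re s > a'} \<inter> {s. Re s < b'}" by auto
    show "open ?S" unfolding eq by (intro open_Int open_halfspace_Re_gt open_halfspace_Re_lt)
    show "convex ?S" unfolding eq by (intro convex_Int convex_halfspace_Re_gt convex_halfspace_Re_lt)
  qed
  have fc: "continuous_on (?S - {z0}) f" using f by (rule holomorphic_on_imp_continuous_on)
  have int: "integrable lborel (\<lambda>t. f (Complex c t))" if "c = a \<or> c = b" for c
  proof (rule vertical_line_integrable)
    show "continuous_on {s. Re s = c} f"
      by (rule continuous_on_subset[OF fc]) (use that ab z0 in auto)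
    show "norm (f (Complex c t)) \<le> K * (1 + \<bar>t\<bar>) powr (- 3 / 2)" if "\<bar>t\<bar> \<ge> T" for t
      using decay[of "Complex c t"] that \<open>c = a \<or> c = b\<close> ab by auto
  qed
  define J where "J R = contour_integral (linepath (Complex a (-R)) (Complex b (-R))) f
       + contour_integral (linepath (Complex b R) (Complex a R)) f" for R
  \<comment> \<open>From this height on the rectangle has \<open>z0\<close> in its interior and its
    horizontal sides lie where \<open>decay\<close> applies.\<close>
  define R0 where "R0 = max 1 (max T (\<bar>Im z0\<bar> + 1))"
  have rect: "J R + \<i> * integral {-R..R} (\<lambda>t. f (Complex b t)) - \<i> * integral {-R..R} (\<lambda>t. f (Complex a t))
      = 2 * of_real pi * \<i> * residue f z0" and Jb: "norm (J R) \<le> 2 * (K * (1 + R) powr (- 3 / 2) * (b - a))"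
    if R: "R \<ge> R0" for R
  proof -
    have R': "R \<ge> 1" "R \<ge> T" "R > \<bar>Im z0\<bar>" using R by (auto simp: R0_def)
    let ?p = "Complex a (-R)" and ?q = "Complex b (-R)" and ?r = "Complex b R" and ?s = "Complex a R"
    let ?\<gamma> = "rectpath ?p ?r"
    have \<gamma>: "?\<gamma> = linepath ?p ?q +++ linepath ?q ?r +++ linepath ?r ?s +++ linepath ?s ?p"
      by (simp add: rectpath_def Let_def)
    have img: "path_image ?\<gamma> \<subseteq> ?S - {z0}"
      using ab R' z0 by (subst path_image_rectpath) auto
    have subs: "path_image (linepath ?p ?q) \<subseteq> ?S - {z0}" "path_image (linepath ?r ?s) \<subseteq> ?S - {z0}"
      using img unfolding \<gamma> by (auto simp: path_image_join)
    have intble: "f contour_integrable_on ?\<gamma>"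
      by (rule contour_integrable_holomorphic_simple[OF f _ _ img]) (use S in \<open>auto intro: open_Diff\<close>)
    have "contour_integral ?\<gamma> f = of_real (2 * pi) * \<i> * (\<Sum>p\<in>{z0}. winding_number ?\<gamma> p * residue f p)"
    proof (rule Residue_theorem[OF S(1) _ _ f])
      show "\<forall>z. z \<notin> ?S \<longrightarrow> winding_number ?\<gamma> z = 0"
      proof (intro allI impI winding_number_rectpath_outside)
        fix z assume "z \<notin> ?S"
        thus "z \<notin> cbox ?p ?r" using ab by (auto simp: in_cbox_complex_iff)
      qed (use ab R' in auto)
    qed (use S img in \<open>auto intro: convex_connected\<close>)
    moreover have "winding_number ?\<gamma> z0 = 1"
      by (rule winding_number_rectpath) (use z0 R' in \<open>auto simp: in_box_complex_iff\<close>)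
    ultimately have main: "contour_integral ?\<gamma> f = 2 * of_real pi * \<i> * residue f z0" by simp
    have hi: "(f has_contour_integral contour_integral ?\<gamma> f) (linepath ?p ?q +++ linepath ?q ?r +++ linepath ?r ?s +++ linepath ?s ?p)"
      using has_contour_integral_integral[OF intble] unfolding \<gamma> .
    have "contour_integral (linepath ?q ?r) f = \<i> * integral {-R..R} (\<lambda>t. f (Complex b t))"
      by (rule contour_integral_linepath_same_Re) (use R' in auto)
    moreover have "contour_integral (linepath ?s ?p) f = - contour_integral (linepath ?p ?s) f"
      using contour_integral_reversepath[of "linepath ?p ?s" f] by simp
    moreover have "contour_integral (linepath ?p ?s) f = \<i> * integral {-R..R} (\<lambda>t. f (Complex a t))"
      by (rule contour_integral_linepath_same_Re) (use R' in auto)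
    ultimately show "J R + \<i> * integral {-R..R} (\<lambda>t. f (Complex b t)) - \<i> * integral {-R..R} (\<lambda>t. f (Complex a t))
      = 2 * of_real pi * \<i> * residue f z0"
      using has_chain_integral_chain_integral4[OF hi] main unfolding J_def by (simp add: algebra_simps)
    have Lb: "norm (contour_integral (linepath u v) f) \<le> K * (1 + R) powr (- 3 / 2) * (b - a)"
      if uv: "path_image (linepath u v) \<subseteq> ?S - {z0}" "norm (v - u) = b - a"
        "\<And>z. z \<in> closed_segment u v \<Longrightarrow> a \<le> Re z \<and> Re z \<le> b \<and> \<bar>Im z\<bar> = R" for u v
    proof -
      have fi: "f contour_integrable_on linepath u v"
        by (rule contour_integrable_holomorphic_simple[OF f _ _ uv(1)]) (use S in \<open>auto intro: open_Diff\<close>)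
      have bd: "norm (f z) \<le> K * (1 + R) powr (- 3 / 2)" if "z \<in> closed_segment u v" for z
        using decay[of z] uv(3)[OF that] R' by auto
      have "0 \<le> K * (1 + R) powr (- 3 / 2)" using bd[of u] norm_ge_zero order.trans by blast
      from contour_integral_bound_linepath[OF fi this bd] show ?thesis by (simp only: uv(2))
    qed
    have "norm (J R) \<le> K * (1 + R) powr (- 3 / 2) * (b - a) + K * (1 + R) powr (- 3 / 2) * (b - a)"
      unfolding J_def
    proof (rule norm_triangle_le, rule add_mono; rule Lb)
      have "?q - ?p = of_real (b - a)" "?s - ?r = of_real (a - b)" by (simp_all add: complex_eq_iff)
      thus "norm (?q - ?p) = b - a" "norm (?s - ?r) = b - a" using ab by (simp_all only: norm_of_real)
    qed (use subs ab R' in \<open>auto simp: closed_segment_same_Im closed_segment_eq_real_ivl split: if_splits\<close>)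
    thus "norm (J R) \<le> 2 * (K * (1 + R) powr (- 3 / 2) * (b - a))" by (simp only: mult_2)
  qed
  have "((\<lambda>R. 2 * (K * (1 + R) powr (- 3 / 2) * (b - a))) \<longlongrightarrow> 0) at_top" by real_asymp
  moreover have "\<forall>\<^sub>F R in at_top. norm (J R) \<le> 2 * (K * (1 + R) powr (- 3 / 2) * (b - a))"
    using eventually_ge_at_top[of R0] by eventually_elim (rule Jb)
  ultimately have "(J \<longlongrightarrow> 0) at_top" by (rule Lim_null_comparison[rotated])
  hence "((\<lambda>R. J R + \<i> * integral {-R..R} (\<lambda>t. f (Complex b t)) - \<i> * integral {-R..R} (\<lambda>t. f (Complex a t)))
     \<longlongrightarrow> 0 + \<i> * (LINT t|lborel. f (Complex b t)) - \<i> * (LINT t|lborel. f (Complex a t))) at_top"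
    using int by (intro tendsto_intros tendsto_symmetric_integral) auto
  moreover have "((\<lambda>R. J R + \<i> * integral {-R..R} (\<lambda>t. f (Complex b t)) - \<i> * integral {-R..R} (\<lambda>t. f (Complex a t)))
     \<longlongrightarrow> 2 * of_real pi * \<i> * residue f z0) at_top"
    by (rule tendsto_eventually) (use eventually_ge_at_top[of R0] in eventually_elim, rule rect)
  ultimately have "0 + \<i> * (LINT t|lborel. f (Complex b t)) - \<i> * (LINT t|lborel. f (Complex a t)) = 2 * of_real pi * \<i> * residue f z0"
    by (rule tendsto_unique[rotated]) simp
  thus ?thesis by (simp add: vertical_line_integral_def mult.commute)
qed

text \<open>Split \<open>A = A^(1/4) * A^(3/4)\<close>: the first factor is at least
  \<open>\<bar>c\<bar>^(1/2)\<close>, the second at least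
  \<open>((1 + \<bar>t\<bar>)^2 / 2)^(3/4)\<close>. The decay given up in t buys a factor that makes
  integrals over distant lines small.\<close>

lemma powr_decay_le:
  fixes t A c :: real
  assumes "1 + t\<^sup>2 \<le> A" "c\<^sup>2 \<le> A" and c0: "c \<noteq> 0"
  shows "1 / A \<le> 2 * \<bar>c\<bar> powr (- 1 / 2) * (1 + \<bar>t\<bar>) powr (- 3 / 2)"
proof -
  have A: "A > 0" using assms(1) zero_le_power2[of t] by linarith
  have "(1 + \<bar>t\<bar>)\<^sup>2 \<le> 2 * (1 + t\<^sup>2)"
    using zero_le_power2[of "1 - \<bar>t\<bar>"] by (simp add: power2_eq_square algebra_simps)
  hence h: "((1 + \<bar>t\<bar>)\<^sup>2 / 2) powr (3 / 4) \<le> A powr (3 / 4)"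
    using assms(1) by (intro powr_mono2) auto
  have c: "(c\<^sup>2) powr (1 / 4) \<le> A powr (1 / 4)"
    using assms(2) by (intro powr_mono2) auto
  have e1: "(c\<^sup>2) powr (1 / 4) = \<bar>c\<bar> powr (1 / 2)"
    using c0 powr_powr[of "\<bar>c\<bar>" 2 "1 / 4"] by simp
  have e2: "((1 + \<bar>t\<bar>)\<^sup>2 / 2) powr (3 / 4) = (1 + \<bar>t\<bar>) powr (3 / 2) / 2 powr (3 / 4)"
    using powr_powr[of "1 + \<bar>t\<bar>" 2 "3 / 4"] by (simp add: powr_divide)
  have "2 powr (3 / 4) \<le> (2::real) powr 1" by (intro powr_mono) auto
  hence "(1 + \<bar>t\<bar>) powr (3 / 2) / 2 \<le> ((1 + \<bar>t\<bar>)\<^sup>2 / 2) powr (3 / 4)"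
    unfolding e2 by (intro divide_left_mono) auto
  with h c have "\<bar>c\<bar> powr (1 / 2) * ((1 + \<bar>t\<bar>) powr (3 / 2) / 2) \<le> A powr (1 / 4) * A powr (3 / 4)"
    unfolding e1 by (intro mult_mono) auto
  also have "\<dots> = A" using A by (simp flip: powr_add)
  finally have "1 / A \<le> 1 / (\<bar>c\<bar> powr (1 / 2) * ((1 + \<bar>t\<bar>) powr (3 / 2) / 2))"
    using c0 A by (intro divide_left_mono mult_pos_pos) auto
  also have "\<dots> = 2 * \<bar>c\<bar> powr (- 1 / 2) * (1 + \<bar>t\<bar>) powr (- 3 / 2)"
    by (simp add: powr_minus field_simps)
  finally show ?thesis .
qed

lemma inverse_square_decay:
  fixes z :: complex
  assumes "\<bar>c\<bar> \<ge> 1" "\<bar>c\<bar> \<le> \<bar>Re z\<bar>"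
  shows "1 / norm z ^ 2 \<le> 2 * \<bar>c\<bar> powr (- 1 / 2) * (1 + \<bar>Im z\<bar>) powr (- 3 / 2)"
proof -
  have "\<bar>c\<bar>\<^sup>2 \<le> \<bar>Re z\<bar>\<^sup>2" "1\<^sup>2 \<le> \<bar>Re z\<bar>\<^sup>2" using assms by (intro power_mono; simp)+
  thus ?thesis
    using assms by (intro powr_decay_le) (auto simp: cmod_power2 intro: add_increasing2)
qed

lemma inverse_square_decay_Im:
  fixes z :: complex
  assumes "\<bar>Im z\<bar> \<ge> 1"
  shows "\<bar>Im z\<bar> powr (- 3 / 2) \<le> 4 * (1 + \<bar>Im z\<bar>) powr (- 3 / 2)"
    and "1 / norm z ^ 2 \<le> 4 * (1 + \<bar>Im z\<bar>) powr (- 3 / 2)"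
proof -
  let ?t = "\<bar>Im z\<bar>"
  have "?t powr (- 3 / 2) \<le> ((1 + ?t) / 2) powr (- 3 / 2)"
    using assms by (intro powr_mono2') auto
  also have "\<dots> = 2 powr (3 / 2) * (1 + ?t) powr (- 3 / 2)"
    by (simp add: powr_divide powr_minus field_simps)
  also have "\<dots> \<le> 2 powr 2 * (1 + ?t) powr (- 3 / 2)"
    by (intro mult_right_mono powr_mono) auto
  finally show *: "?t powr (- 3 / 2) \<le> 4 * (1 + ?t) powr (- 3 / 2)" by simp
  have "1 / norm z ^ 2 \<le> 1 / ?t ^ 2"
    using assms abs_Im_le_cmod[of z] by (intro divide_left_mono power_mono mult_pos_pos zero_less_power) auto
  also have "\<dots> = ?t powr - 2" using assms by (simp add: powr_minus divide_inverse)
  also have "\<dots> \<le> ?t powr (- 3 / 2)" using assms by (intro powr_mono) auto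
  finally show "1 / norm z ^ 2 \<le> 4 * (1 + ?t) powr (- 3 / 2)" using * by linarith
qed

text \<open>The line \<open>c m\<close> and the abscissa \<open>d m\<close> in the bound are
  separate because the integrand of \<open>F_coeff\<close> on \<open>Re s = m + 3\<close> is
  controlled by \<open>1 - s\<close>, whose real part has modulus \<open>m + 2\<close>.\<close>

lemma vertical_line_integral_tendsto_0:
  assumes "B \<ge> 0" and d: "filterlim (\<lambda>m. \<bar>d m\<bar>) at_top sequentially"
    and bound: "\<And>m t. norm (f (Complex (c m) t)) \<le> B / norm (Complex (d m) t) ^ 2"
  shows "(\<lambda>m. vertical_line_integral (c m) f) \<longlonglongrightarrow> 0"
proof -
  define I where "I = (LINT t|lborel. (1 + \<bar>t::real\<bar>) powr (- 3 / 2))"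
  have le: "norm (vertical_line_integral (c m) f) \<le> B * (2 * \<bar>d m\<bar> powr (- 1 / 2)) * I" if dm: "\<bar>d m\<bar> \<ge> 1" for m
  proof -
    let ?k = "B * (2 * \<bar>d m\<bar> powr (- 1 / 2))"
    have "norm (vertical_line_integral (c m) f) \<le> (LINT t|lborel. norm (f (Complex (c m) t) * \<i>))"
      unfolding vertical_line_integral_def by (rule integral_norm_bound)
    also have "\<dots> \<le> (LINT t|lborel. ?k * (1 + \<bar>t\<bar>) powr (- 3 / 2))"
    proof (rule integral_mono')
      show "integrable lborel (\<lambda>t. ?k * (1 + \<bar>t\<bar>) powr (- 3 / 2))"
        using integrable_decay by (intro integrable_mult_right)
      fix t :: real
      have "norm (f (Complex (c m) t) * \<i>) \<le> B * (1 / norm (Complex (d m) t) ^ 2)"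
        using bound[of m t] by (simp add: norm_mult)
      also have "\<dots> \<le> B * (2 * \<bar>d m\<bar> powr (- 1 / 2) * (1 + \<bar>t\<bar>) powr (- 3 / 2))"
        using inverse_square_decay[OF dm, of "Complex (d m) t"] assms(1) by (intro mult_left_mono) auto
      finally show "norm (f (Complex (c m) t) * \<i>) \<le> ?k * (1 + \<bar>t\<bar>) powr (- 3 / 2)"
        by (simp only: mult.assoc)
    qed (use assms(1) in auto)
    also have "\<dots> = ?k * I" unfolding I_def by simp
    finally show ?thesis .
  qed
  have "((\<lambda>x. B * (2 * x powr (- 1 / 2)) * I) \<longlongrightarrow> 0) at_top" by real_asymp
  hence "(\<lambda>m. B * (2 * \<bar>d m\<bar> powr (- 1 / 2)) * I) \<longlonglongrightarrow> 0" by (rule filterlim_compose[OF _ d])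
  moreover have "eventually (\<lambda>m. \<bar>d m\<bar> \<ge> 1) sequentially"
    using d by (simp add: filterlim_at_top)
  hence "eventually (\<lambda>m. norm (vertical_line_integral (c m) f) \<le> B * (2 * \<bar>d m\<bar> powr (- 1 / 2)) * I) sequentially"
    by eventually_elim (rule le)
  ultimately show ?thesis by (rule Lim_null_comparison[rotated])
qed

text \<open>For \<open>u > 0\<close> the line moves left, where the exponential is small, and
  crosses the double pole at 0 with residue u; otherwise it moves right and meets no pole. In both
  cases the integral over the moved line tends to 0.\<close>

lemma perron_kernel:
  "vertical_line_integral 1 (\<lambda>z. exp (of_real u * z) / z ^ 2) = 2 * of_real pi * \<i> * of_real (max u 0)"
proof -
  let ?f = "\<lambda>z. exp (of_real u * z) / z ^ 2 :: complex"
  have nf: "norm (?f z) = exp (u * Re z) / norm z ^ 2" for z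
    by (simp add: norm_divide norm_power)
  show ?thesis
  proof (cases "u > 0")
    case True
    have "vertical_line_integral 1 ?f - vertical_line_integral (- real (Suc m)) ?f
        = 2 * of_real pi * \<i> * residue ?f 0" for m
    proof (rule contour_shift[where a' = "- real (Suc m) - 1" and b' = 2 and T = 1 and K = "exp u * 4"])
      show "?f holomorphic_on {s. - real (Suc m) - 1 < Re s \<and> Re s < 2} - {0}"
        by (intro holomorphic_intros) auto
      fix s :: complex assume s: "Re s \<le> 1" "\<bar>Im s\<bar> \<ge> 1"
      have "norm (?f s) = exp (u * Re s) * (1 / norm s ^ 2)" by (simp add: nf)
      also have "\<dots> \<le> exp u * (4 * (1 + \<bar>Im s\<bar>) powr (- 3 / 2))"
        using s True inverse_square_decay_Im(2)[OF s(2)] by (intro mult_mono) auto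
      finally show "norm (?f s) \<le> exp u * 4 * (1 + \<bar>Im s\<bar>) powr (- 3 / 2)" by (simp only: mult.assoc)
    qed auto
    moreover have "residue ?f 0 = of_real u"
    proof -
      have "residue (\<lambda>z. exp (of_real u * z) / z ^ Suc 1) 0 = (deriv ^^ 1) (\<lambda>z. exp (of_real u * z)) 0 / fact 1"
        by (rule residue_holomorphic_over_power'[of UNIV]) (auto intro!: holomorphic_intros)
      moreover have "deriv (\<lambda>z. exp (of_real u * z)) 0 = (of_real u :: complex)"
        by (rule DERIV_imp_deriv) (auto intro!: derivative_eq_intros)
      ultimately show ?thesis by (simp add: numeral_2_eq_2)
    qed
    ultimately have eq: "vertical_line_integral (- real (Suc m)) ?f
        = vertical_line_integral 1 ?f - 2 * of_real pi * \<i> * of_real u" for m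
      by (simp add: algebra_simps)
    have "(\<lambda>m. vertical_line_integral (- real (Suc m)) ?f) \<longlonglongrightarrow> 0"
    proof (rule vertical_line_integral_tendsto_0[where B = 1 and d = "\<lambda>m. - real (Suc m)"])
      show "filterlim (\<lambda>m. \<bar>- real (Suc m)\<bar>) at_top sequentially" by real_asymp
      show "norm (?f (Complex (- real (Suc m)) t)) \<le> 1 / norm (Complex (- real (Suc m)) t) ^ 2" for m t
        unfolding nf using True by (intro divide_right_mono) (auto simp: mult_le_0_iff)
    qed simp
    hence "vertical_line_integral 1 ?f - 2 * of_real pi * \<i> * of_real u = 0"
      unfolding eq by (simp add: LIMSEQ_const_iff)
    thus ?thesis using True by simp
  next
    case False
    \<comment> \<open>\<open>contour_shift\<close> wants a marked point strictly between the lines.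
      The integrand is holomorphic at \<open>3 / 2\<close>, so the residue there is 0.\<close>
    have "vertical_line_integral (real m + 2) ?f - vertical_line_integral 1 ?f
        = 2 * of_real pi * \<i> * residue ?f (of_real (3 / 2))" for m
    proof (rule contour_shift[where a' = "1 / 2" and b' = "real m + 3" and T = 1 and K = "1 * 4"])
      show "?f holomorphic_on {s. 1 / 2 < Re s \<and> Re s < real m + 3} - {of_real (3 / 2)}"
        by (intro holomorphic_intros) auto
      fix s :: complex assume s: "1 \<le> Re s" "\<bar>Im s\<bar> \<ge> 1"
      have "norm (?f s) = exp (u * Re s) * (1 / norm s ^ 2)" by (simp add: nf)
      also have "\<dots> \<le> 1 * (4 * (1 + \<bar>Im s\<bar>) powr (- 3 / 2))"
        using s False inverse_square_decay_Im(2)[OF s(2)]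
        by (intro mult_mono) (auto simp: mult_le_0_iff)
      finally show "norm (?f s) \<le> 1 * 4 * (1 + \<bar>Im s\<bar>) powr (- 3 / 2)" by (simp only: mult.assoc)
    qed auto
    moreover have "residue ?f (of_real (3 / 2)) = 0"
      by (rule residue_holo[of "{s. Re s > 0}"])
         (auto simp: open_halfspace_Re_gt intro!: holomorphic_intros)
    ultimately have eq: "vertical_line_integral (real m + 2) ?f = vertical_line_integral 1 ?f" for m
      by simp
    have "(\<lambda>m. vertical_line_integral (real m + 2) ?f) \<longlonglongrightarrow> 0"
    proof (rule vertical_line_integral_tendsto_0[where B = 1 and d = "\<lambda>m. real m + 2"])
      show "filterlim (\<lambda>m. \<bar>real m + 2\<bar>) at_top sequentially" by real_asymp
      show "norm (?f (Complex (real m + 2) t)) \<le> 1 / norm (Complex (real m + 2) t) ^ 2" for m t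
        unfolding nf using False by (intro divide_right_mono) (auto simp: mult_le_0_iff)
    qed simp
    hence "vertical_line_integral 1 ?f = 0"
      unfolding eq by (simp add: LIMSEQ_const_iff)
    thus ?thesis using False by (simp add: max_def)
  qed
qed

section \<open>The coefficients \<open>F_n\<close> as residues\<close>

text \<open>The constant of \<open>zeta_strip_bound\<close> depends on the right edge of the strip;
  lines that move off to the right need a single one.\<close>

lemma norm_zeta_right_bound: "\<exists>Z\<ge>0. \<forall>s. Re s \<ge> 2 \<longrightarrow> norm (riemann_zeta s) \<le> Z"
proof (intro exI conjI allI impI)
  have sm: "summable (\<lambda>n. real (Suc n) powr - 2)"
    using summable_ignore_initial_segment[of "\<lambda>n. real n powr - 2" 1] summable_real_powr_iff[of "- 2"] by simp
  show "(\<Sum>n. real (Suc n) powr - 2) \<ge> 0" by (rule suminf_nonneg[OF sm]) simp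
  fix s assume s: "Re s \<ge> 2"
  have le: "norm (of_nat (Suc n) powr -s :: complex) \<le> real (Suc n) powr - 2" for n
    unfolding norm_of_nat_powr using s by (intro powr_mono) auto
  have sn: "summable (\<lambda>n. norm (of_nat (Suc n) powr -s :: complex))"
    by (rule summable_comparison_test'[OF sm, of 0]) (use le in simp)
  have "riemann_zeta s = (\<Sum>n. of_nat (Suc n) powr -s)"
    using riemann_zeta(2)[of s] s by (simp add: sums_iff)
  also have "norm \<dots> \<le> (\<Sum>n. norm (of_nat (Suc n) powr -s :: complex))"
    by (rule summable_norm[OF sn])
  also have "\<dots> \<le> (\<Sum>n. real (Suc n) powr - 2)" by (intro suminf_le le sn sm)
  finally show "norm (riemann_zeta s) \<le> (\<Sum>n. real (Suc n) powr - 2)" .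
qed

text \<open>The simple pole of \<zeta> and the factor \<open>(1 - s)^q\<close> make a pole of order
  \<open>q + 1\<close>, so the residue is the Taylor coefficient of order q of the regular factor.
  The power of -1 turns \<open>1 - s\<close> into \<open>s - 1\<close>, and the outer sign comes
  from the line \<open>1/2\<close> lying to the left of the pole.\<close>

lemma F_coeff_eq_deriv:
  assumes q: "q \<ge> 1" and n: "n > 0"
  shows "F_coeff q n = - (deriv ^^ q) (\<lambda>s. of_nat n powr (-s) * ((-1) ^ q * entire_zeta s / s ^ q)) 1 / fact q"
proof -
  let ?f = "\<lambda>s. of_nat n powr (-s) * (riemann_zeta s / (s ^ q * (1 - s) ^ q)) :: complex"
  let ?g = "\<lambda>s. of_nat n powr (-s) * ((-1) ^ q * entire_zeta s / s ^ q) :: complex"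
  have np: "norm (of_nat n powr (-s) :: complex) \<le> 1" if "Re s \<ge> 0" for s
    unfolding norm_of_nat_powr using that n powr_mono[of "- Re s" 0 "real n"] by simp
  \<comment> \<open>As \<open>q \<ge> 1\<close> and \<open>x \<ge> 1\<close>, one factor of each
    kind already accounts for \<open>x^2\<close>.\<close>
  have den: "x ^ 2 \<le> norm (s ^ q * (1 - s) ^ q)"
    if "1 \<le> x" "x \<le> norm s" "x \<le> norm (1 - s)" for s :: complex and x
  proof -
    have "x ^ 2 = x ^ 1 * x ^ 1" by (simp add: power2_eq_square)
    also have "\<dots> \<le> x ^ q * x ^ q" using that q by (intro mult_mono power_increasing) auto
    also have "\<dots> \<le> norm s ^ q * norm (1 - s) ^ q" using that by (intro mult_mono power_mono) auto
    finally show ?thesis by (simp add: norm_mult norm_power)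
  qed
  have "vertical_line_integral (real m + 3) ?f - vertical_line_integral (1 / 2) ?f
      = 2 * of_real pi * \<i> * residue ?f 1" for m
  proof -
    obtain C where C: "C > 0" "\<And>s. 1 / 2 \<le> Re s \<Longrightarrow> Re s \<le> real m + 3 \<Longrightarrow> \<bar>Im s\<bar> \<ge> 1 \<Longrightarrow>
        norm (riemann_zeta s) \<le> C * \<bar>Im s\<bar> powr (1 / 2)"
      using zeta_strip_bound[of "1 / 2" 1 "real m + 3"] by auto
    show ?thesis
    proof (rule contour_shift[where a' = "1 / 4" and b' = "real m + 4" and T = 1 and K = "C * 4"])
      show "?f holomorphic_on {s. 1 / 4 < Re s \<and> Re s < real m + 4} - {1}"
        using n by (intro holomorphic_intros holomorphic_on_subset[OF riemann_zeta(1)]) auto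
      fix s :: complex assume s: "1 / 2 \<le> Re s" "Re s \<le> real m + 3" "\<bar>Im s\<bar> \<ge> 1"
      have "norm (?f s) = norm (of_nat n powr (-s) :: complex) * (norm (riemann_zeta s) / norm (s ^ q * (1 - s) ^ q))"
        by (simp only: norm_mult norm_divide)
      also have "\<dots> \<le> 1 * (C * \<bar>Im s\<bar> powr (1 / 2) / \<bar>Im s\<bar> ^ 2)"
        using s np[of s] C den[of "\<bar>Im s\<bar>" s] abs_Im_le_cmod[of s] abs_Im_le_cmod[of "1 - s"]
        by (intro mult_mono frac_le) auto
      also have "\<dots> = C * \<bar>Im s\<bar> powr (- 3 / 2)"
      proof -
        have "\<bar>Im s\<bar> powr (1 / 2 - 2) = \<bar>Im s\<bar> powr (1 / 2) / \<bar>Im s\<bar> ^ 2"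
          unfolding powr_diff using s(3) by simp
        thus ?thesis by simp
      qed
      also have "\<dots> \<le> C * (4 * (1 + \<bar>Im s\<bar>) powr (- 3 / 2))"
        using C(1) inverse_square_decay_Im(1)[OF s(3)] by (intro mult_left_mono) auto
      finally show "norm (?f s) \<le> C * 4 * (1 + \<bar>Im s\<bar>) powr (- 3 / 2)" by (simp only: mult.assoc)
    qed auto
  qed
  hence eq: "vertical_line_integral (real m + 3) ?f = vertical_line_integral (1 / 2) ?f
      + 2 * of_real pi * \<i> * residue ?f 1" for m
    by (simp add: algebra_simps)
  have res: "residue ?f 1 = (deriv ^^ q) ?g 1 / fact q"
  proof -
    have "residue ?f 1 = residue (\<lambda>s. ?g s / (s - 1) ^ Suc q) 1"
    proof (rule residue_cong[OF _ refl])
      have E: "?f s = ?g s / (s - 1) ^ Suc q" if "s \<noteq> 1" for s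
      proof -
        have "(1 - s) ^ q = (-1) ^ q * (s - 1) ^ q"
          by (simp flip: power_mult_distrib)
        \<comment> \<open>Here \<open>z = riemann_zeta s\<close>, \<open>p = s^q\<close>,
          \<open>e = (-1)^q\<close>, \<open>w = (s - 1)^q\<close> and
          \<open>x = s - 1\<close>.\<close>
        moreover have "z / (p * (e * w)) = e * (x * z) / p / (x * w)" if "x \<noteq> 0" "e * e = 1" for z p e w x :: complex
        proof -
          have "inverse e = e" using that(2) by (rule inverse_unique)
          hence "z / (p * (e * w)) = e * z / (p * w)" by (simp add: divide_inverse mult_ac)
          thus ?thesis using that(1) by simp
        qed
        moreover have "(-1) ^ q * (-1) ^ q = (1::complex)" by (simp flip: power_mult_distrib)
        moreover have "s - 1 \<noteq> 0" using that by simp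
        moreover have "entire_zeta s = (s - 1) * riemann_zeta s" using that by (simp add: entire_zeta_def)
        ultimately show ?thesis by (simp only: power_Suc times_divide_eq_right[symmetric])
      qed
      show "\<forall>\<^sub>F s in at 1. ?f s = ?g s / (s - 1) ^ Suc q"
        using eventually_neq_at_within[of 1 1 UNIV] by eventually_elim (rule E)
    qed
    also have "\<dots> = (deriv ^^ q) ?g 1 / fact q"
    proof (rule residue_holomorphic_over_power[of "{s. Re s > 0}"])
      show "?g holomorphic_on {s. Re s > 0}"
        using n by (intro holomorphic_intros holomorphic_on_subset[OF entire_zeta_holomorphic]) auto
    qed (auto simp: open_halfspace_Re_gt)
    finally show ?thesis .
  qed
  obtain Z where Z: "Z \<ge> 0" "\<And>s. Re s \<ge> 2 \<Longrightarrow> norm (riemann_zeta s) \<le> Z"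
    using norm_zeta_right_bound by blast
  have "(\<lambda>m. vertical_line_integral (real m + 3) ?f) \<longlonglongrightarrow> 0"
  proof (rule vertical_line_integral_tendsto_0[where B = Z and d = "\<lambda>m. real m + 2"])
    show "filterlim (\<lambda>m. \<bar>real m + 2\<bar>) at_top sequentially" by real_asymp
    fix m t
    let ?s = "Complex (real m + 3) t" and ?w = "Complex (real m + 2) t"
    have w1: "1 \<le> norm ?w" using abs_Re_le_cmod[of ?w] by simp
    have ws: "norm ?w \<le> norm ?s" by (simp add: cmod_def power_mono)
    have "?w = - (1 - ?s)" by (simp add: complex_eq_iff)
    hence ws': "norm ?w = norm (1 - ?s)" by (simp only: norm_minus_cancel)
    have "norm (?f ?s) = norm (of_nat n powr (- ?s) :: complex) * (norm (riemann_zeta ?s) / norm (?s ^ q * (1 - ?s) ^ q))"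
      by (simp only: norm_mult norm_divide)
    also have "\<dots> \<le> 1 * (Z / norm ?w ^ 2)"
    proof (intro mult_mono frac_le)
      show "norm ?w ^ 2 \<le> norm (?s ^ q * (1 - ?s) ^ q)"
        by (rule den[OF w1 ws]) (simp only: ws' order_refl)
      show "0 < norm ?w ^ 2" using w1 by (intro zero_less_power) linarith
      show "norm (of_nat n powr (- ?s) :: complex) \<le> 1" by (rule np) simp
      show "norm (riemann_zeta ?s) \<le> Z" by (rule Z(2)) simp
    qed (use Z(1) in simp_all)
    finally show "norm (?f ?s) \<le> Z / norm ?w ^ 2" by simp
  qed (fact Z(1))
  hence "vertical_line_integral (1 / 2) ?f + 2 * of_real pi * \<i> * residue ?f 1 = 0"
    unfolding eq by (simp only: LIMSEQ_const_iff)
  hence "vertical_line_integral (1 / 2) ?f = - (2 * of_real pi * \<i> * residue ?f 1)"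
    by (simp only: add_eq_0_iff minus_minus)
  thus ?thesis unfolding F_coeff_def res by simp
qed

section \<open>The Dirichlet series with coefficients \<open>\<mu>(n) F_n\<close>\<close>

lemma has_field_derivative_nat_powr:
  assumes "n > 0"
  shows "((\<lambda>s. of_nat n powr (-s)) has_field_derivative
    - of_real (ln (real n)) * of_nat n powr (-s)) (at (s::complex) within A)"
proof -
  have "of_nat n powr (-s) = exp (- s * of_real (ln (real n)))" for s :: complex
    using assms by (simp add: powr_def)
  thus ?thesis by (auto intro!: derivative_eq_intros)
qed

lemma higher_deriv_nat_powr:
  assumes "n > 0"
  shows "(deriv ^^ k) (\<lambda>s. of_nat n powr (-s)) = (\<lambda>s. (- of_real (ln (real n))) ^ k * of_nat n powr (-s) :: complex)"
proof (induction k)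
  case (Suc k)
  have "deriv (\<lambda>s. (- of_real (ln (real n))) ^ k * of_nat n powr (-s) :: complex) s
      = (- of_real (ln (real n))) ^ Suc k * of_nat n powr (-s)" for s
    using DERIV_imp_deriv[OF DERIV_cmult[OF has_field_derivative_nat_powr[OF assms]]] by simp
  thus ?case by (simp add: Suc.IH fun_eq_iff)
qed simp

text \<open>Half of the margin \<open>\<sigma> - 1\<close> absorbs the logarithms, and the other
  half keeps the series convergent.\<close>

lemma summable_ln_powr:
  assumes "\<sigma> > 1"
  shows "summable (\<lambda>n. ln (real n) ^ k * real n powr - \<sigma>)"
proof (rule summable_comparison_test_bigo)
  define e where "e = (\<sigma> - 1) / 2"
  have e: "e > 0" using assms by (simp add: e_def)
  show "summable (\<lambda>n. norm (real n powr - (1 + e)))"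
    using summable_real_powr_iff[of "- (1 + e)"] e by simp
  have "(\<lambda>x::real. ln x ^ k * x powr - (1 + 2 * e)) \<in> O(\<lambda>x. x powr - (1 + e))"
    using e by real_asymp
  hence "(\<lambda>n. ln (real n) ^ k * real n powr - (1 + 2 * e)) \<in> O(\<lambda>n. real n powr - (1 + e))"
    by (rule landau_o.big.compose[OF _ filterlim_real_sequentially])
  moreover have "1 + 2 * e = \<sigma>" by (simp add: e_def field_simps)
  ultimately show "(\<lambda>n. ln (real n) ^ k * real n powr - \<sigma>) \<in> O(\<lambda>n. real n powr - (1 + e))" by simp
qed

abbreviation "inverse_zeta \<equiv> (\<lambda>s. 1 / riemann_zeta s)"

text \<open>Termwise differentiation of \<open>moebius_sums\<close>; on a disc of radius
  \<open>(Re x - 1) / 2\<close> the terms have a common majorant given by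
  \<open>summable_ln_powr\<close>.\<close>

lemma moebius_ln_sums:
  assumes "Re s > 1"
  shows "(\<lambda>n. of_int (moebius_mu n) * (- of_real (ln (real n))) ^ k * of_nat n powr -s)
           sums (deriv ^^ k) inverse_zeta s"
  using assms
proof (induction k arbitrary: s)
  case 0
  thus ?case using moebius_sums by simp
next
  case (Suc k)
  let ?f = "\<lambda>k n s. of_int (moebius_mu n) * (- of_real (ln (real n))) ^ k * of_nat n powr -s :: complex"
  let ?S = "{s::complex. Re s > 1}"
  have op: "open ?S" by (simp add: open_halfspace_Re_gt)
  have "\<exists>g g'. \<forall>x\<in>?S. (\<lambda>n. ?f k n x) sums g x \<and> (\<lambda>n. ?f (Suc k) n x) sums g' x
        \<and> (g has_field_derivative g' x) (at x)"
    proof (rule series_and_derivative_comparison_local[OF op])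
      fix n x
      show "(?f k n has_field_derivative ?f (Suc k) n x) (at x)"
      proof (cases "n = 0")
        case False
        hence "n > 0" by simp
        show ?thesis
          using DERIV_cmult[OF has_field_derivative_nat_powr[OF \<open>n > 0\<close>],
              where c = "of_int (moebius_mu n) * (- of_real (ln (real n))) ^ k"]
          by (simp add: mult_ac)
      qed (auto simp: moebius_mu_def)
    next
      fix x assume x: "x \<in> ?S"
      define d where "d = (Re x - 1) / 2"
      have d: "d > 0" using x by (simp add: d_def)
      have "norm (?f k n y) \<le> ln (real n) ^ k * real n powr - (1 + d)" if y: "y \<in> ball x d \<inter> ?S" for n y
      proof (cases "n = 0")
        case False
        have "\<bar>Re x - Re y\<bar> < d"
          using y abs_Re_le_cmod[of "x - y"] by (simp add: dist_norm)
        hence yd: "1 + d \<le> Re y" unfolding d_def by (auto simp: abs_if field_simps split: if_splits)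
        have "norm (?f k n y) \<le> 1 * ln (real n) ^ k * real n powr - (1 + d)"
          unfolding norm_mult norm_of_nat_powr
        proof (intro mult_mono norm_moebius_mu_le)
          show "norm ((- complex_of_real (ln (real n))) ^ k) \<le> ln (real n) ^ k"
            using False by (simp add: norm_power)
          show "real n powr Re (- y) \<le> real n powr - (1 + d)"
            using yd False by (intro powr_mono) auto
        qed (use False in auto)
        thus ?thesis by simp
      qed (simp add: moebius_mu_def)
      thus "\<exists>d h. 0 < d \<and> summable h \<and> (\<forall>\<^sub>F n in sequentially. \<forall>y\<in>ball x d \<inter> ?S. norm (?f k n y) \<le> h n)"
        using d summable_ln_powr[of "1 + d" k]
        by (intro exI[of _ d] exI[of _ "\<lambda>n. ln (real n) ^ k * real n powr - (1 + d)"]) auto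
    qed
  then obtain g g' where g: "\<forall>x\<in>?S. (\<lambda>n. ?f k n x) sums g x \<and> (\<lambda>n. ?f (Suc k) n x) sums g' x
        \<and> (g has_field_derivative g' x) (at x)" by (elim exE)
  have geq: "g x = (deriv ^^ k) inverse_zeta x" if "x \<in> ?S" for x
    using g that by (intro sums_unique2[OF _ Suc.IH]) auto
  have "(g has_field_derivative g' s) (at s)" using g Suc.prems by auto
  hence "((deriv ^^ k) inverse_zeta has_field_derivative g' s) (at s)"
    by (rule has_field_derivative_transform_within_open[OF _ op _ geq]) (use Suc.prems in auto)
  hence "(deriv ^^ Suc k) inverse_zeta s = g' s" by (simp add: DERIV_imp_deriv)
  thus ?case using g Suc.prems by auto
qed

text \<open>\<open>entire_zeta\<close> is 1 at the pole, hence nonzero nearby. At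
  \<open>s = 1\<close> itself the quotient agrees with \<open>inverse_zeta\<close> because
  \<open>1 / 0 = 0\<close>, so the singularity is already filled in correctly.\<close>

lemma inverse_zeta_near_1:
  "\<exists>R>0. R < 1 \<and> (\<forall>s\<in>ball 1 R. entire_zeta s \<noteq> 0 \<and> inverse_zeta s = (s - 1) / entire_zeta s)
     \<and> inverse_zeta holomorphic_on ball 1 R"
proof -
  have "isCont entire_zeta 1"
    using holomorphic_on_imp_continuous_on[OF entire_zeta_holomorphic]
    by (simp add: continuous_on_eq_continuous_at)
  from continuous_at_avoid[OF this, of 0] obtain e where e: "e > 0" "\<And>y. dist 1 y < e \<Longrightarrow> entire_zeta y \<noteq> 0"
    by (auto simp: entire_zeta_def)
  define R where "R = min e (1 / 2)"
  have R: "R > 0" "R < 1" using e by (auto simp: R_def)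
  have nz: "entire_zeta s \<noteq> 0" if "s \<in> ball 1 R" for s
    using that e by (auto simp: R_def)
  have eq: "inverse_zeta s = (s - 1) / entire_zeta s" if "s \<in> ball 1 R" for s
    using riemann_zeta(3) by (auto simp: entire_zeta_def)
  have "(\<lambda>s. (s - 1) / entire_zeta s) holomorphic_on ball 1 R"
    using nz by (intro holomorphic_intros holomorphic_on_subset[OF entire_zeta_holomorphic]) auto
  hence "inverse_zeta holomorphic_on ball 1 R"
    by (rule holomorphic_transform) (simp add: eq)
  thus ?thesis using R eq nz by (intro exI[of _ R]) auto
qed

text \<open>\<open>inverse_zeta_higher_deriv_bound\<close> leaves out small heights. There
  compactness takes over: offsets of at most \<open>R / 4\<close> in each coordinate stay in the
  disc of radius \<open>R / 2\<close> around 1.\<close>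

lemma inverse_zeta_deriv_bound_near_line:
  assumes k: "k \<le> 2"
  shows "\<exists>r C. r > 0 \<and> C > 0 \<and> (\<forall>s. 1 < Re s \<and> Re s < 1 + r \<longrightarrow>
           norm ((deriv ^^ k) inverse_zeta s) \<le> C * (1 + \<bar>Im s\<bar>) powr (1/2))"
proof -
  obtain R where R: "R > 0" "R < 1" "inverse_zeta holomorphic_on ball 1 R"
    using inverse_zeta_near_1 by metis
  have "continuous_on (cball 1 (R / 2)) ((deriv ^^ k) inverse_zeta)"
    using holomorphic_higher_deriv[OF R(3) open_ball, of k] R(1)
    by (intro continuous_on_subset[OF holomorphic_on_imp_continuous_on]) auto
  hence "compact ((deriv ^^ k) inverse_zeta ` cball 1 (R / 2))"
    by (rule compact_continuous_image) simp
  then obtain B where B: "B > 0" "\<And>s. s \<in> cball 1 (R / 2) \<Longrightarrow> norm ((deriv ^^ k) inverse_zeta s) \<le> B"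
    using compact_imp_bounded bounded_pos by (metis imageI)
  obtain C where C: "C > 0" "\<And>s. 1 < Re s \<Longrightarrow> Re s \<le> 2 \<Longrightarrow> \<bar>Im s\<bar> \<ge> R / 4 \<Longrightarrow>
      norm ((deriv ^^ k) inverse_zeta s) \<le> C * (1 + \<bar>Im s\<bar>) powr (1/2)"
    using inverse_zeta_higher_deriv_bound[of "R / 4" k] R(1) k by auto
  have "norm ((deriv ^^ k) inverse_zeta s) \<le> max B C * (1 + \<bar>Im s\<bar>) powr (1/2)"
    if s: "1 < Re s" "Re s < 1 + R / 4" for s
  proof (cases "\<bar>Im s\<bar> \<ge> R / 4")
    case True
    have "norm ((deriv ^^ k) inverse_zeta s) \<le> C * (1 + \<bar>Im s\<bar>) powr (1/2)"
      using C(2)[of s] s R True by auto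
    also have "\<dots> \<le> max B C * (1 + \<bar>Im s\<bar>) powr (1/2)" by (intro mult_right_mono) auto
    finally show ?thesis .
  next
    case False
    have "norm (1 - s) \<le> \<bar>Re (1 - s)\<bar> + \<bar>Im (1 - s)\<bar>" by (rule cmod_le)
    also have "\<dots> \<le> R / 2" using False s by simp
    finally have "norm ((deriv ^^ k) inverse_zeta s) \<le> B" by (intro B(2)) (simp add: dist_norm)
    also have "\<dots> \<le> max B C * 1" by simp
    also have "\<dots> \<le> max B C * (1 + \<bar>Im s\<bar>) powr (1/2)"
      using B(1) by (intro mult_left_mono ge_one_powr_ge_zero) auto
    finally show ?thesis .
  qed
  thus ?thesis using R(1) B(1) by (intro exI[of _ "R / 4"] exI[of _ "max B C"]) auto
qed

text \<open>The integrand of \<open>F_n\<close> is \<open>n powr -s\<close> times \<open>zeta_numerator q s / (s - 1) ^ (q + 1)\<close>.\<close>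

definition zeta_numerator :: "nat \<Rightarrow> complex \<Rightarrow> complex" where
  "zeta_numerator q = (\<lambda>s. (-1) ^ q * entire_zeta s / s ^ q)"

text \<open>For \<open>Re w > 0\<close> this is the sum of \<open>\<mu>(n) F_n n powr -w\<close>; at \<open>w = 0\<close> it takes the limiting value,
  because \<open>1 / riemann_zeta 1 = 0\<close> also with the dummy value of \<open>riemann_zeta\<close> at its pole.\<close>

definition moebius_F_series :: "nat \<Rightarrow> complex \<Rightarrow> complex" where
  "moebius_F_series q = (\<lambda>w. - (\<Sum>i=0..q. of_nat (q choose i) * (deriv ^^ i) inverse_zeta (1 + w)
      * (deriv ^^ (q - i)) (zeta_numerator q) 1) / fact q)"

lemma zeta_numerator_holomorphic: "zeta_numerator q holomorphic_on {s. Re s > 0}"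
  unfolding zeta_numerator_def
  by (intro holomorphic_on_divide holomorphic_on_mult holomorphic_on_power holomorphic_on_const
        holomorphic_on_ident holomorphic_on_subset[OF entire_zeta_holomorphic]) auto

lemma F_coeff_explicit:
  assumes q: "q \<ge> 1" and n: "n > 0"
  shows "F_coeff q n = - (\<Sum>i=0..q. of_nat (q choose i) * ((- of_real (ln (real n))) ^ i * of_nat n powr - 1)
      * (deriv ^^ (q - i)) (zeta_numerator q) 1) / fact q"
proof -
  have "(\<lambda>s. of_nat n powr (-s) * ((-1) ^ q * entire_zeta s / s ^ q)) = (\<lambda>s. of_nat n powr (-s) * zeta_numerator q s)"
    by (simp add: zeta_numerator_def)
  moreover have "(deriv ^^ q) (\<lambda>s. of_nat n powr (-s) * zeta_numerator q s) 1
     = (\<Sum>i=0..q. of_nat (q choose i) * (deriv ^^ i) (\<lambda>s. of_nat n powr (-s)) 1 * (deriv ^^ (q - i)) (zeta_numerator q) 1)"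
    by (rule higher_deriv_mult[OF _ zeta_numerator_holomorphic])
       (use n in \<open>auto simp: open_halfspace_Re_gt intro!: holomorphic_intros\<close>)
  ultimately show ?thesis
    unfolding F_coeff_eq_deriv[OF assms] by (simp add: higher_deriv_nat_powr[OF n])
qed

text \<open>The factor \<open>1 / n\<close> of \<open>F_coeff\<close> shifts the argument from w to
  \<open>1 + w\<close>. The absolute convergence justifies exchanging sum and integral in
  \<open>perron_sums\<close>.\<close>

lemma moebius_F_sums:
  assumes q: "q \<ge> 1" and w: "Re w > 0"
  shows "(\<lambda>n. of_int (moebius_mu n) * F_coeff q n * of_nat n powr -w) sums moebius_F_series q w"
    and "summable (\<lambda>n. norm (of_int (moebius_mu n) * F_coeff q n * of_nat n powr -w))"
proof -
  define h where "h i n = of_int (moebius_mu n) * (- of_real (ln (real n))) ^ i * of_nat n powr -(1 + w)" for i n :: nat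
  let ?a = "\<lambda>i. of_nat (q choose i) * (deriv ^^ (q - i)) (zeta_numerator q) 1 :: complex"
  have eq: "of_int (moebius_mu n) * F_coeff q n * of_nat n powr -w = - (\<Sum>i=0..q. ?a i * h i n) / fact q" for n
  proof (cases "n = 0")
    case False
    have "of_nat n powr (- 1 - w) = (of_nat n powr - 1 * of_nat n powr -w :: complex)"
      by (simp flip: powr_add)
    thus ?thesis
      unfolding h_def F_coeff_explicit[OF q False[unfolded neq0_conv]]
      by (simp add: sum_distrib_left sum_distrib_right mult_ac)
  qed (simp add: h_def moebius_mu_def)
  have "(\<lambda>n. - (\<Sum>i=0..q. ?a i * h i n) / fact q) sums (- (\<Sum>i=0..q. ?a i * (deriv ^^ i) inverse_zeta (1 + w)) / fact q)"
    unfolding h_def using w by (intro sums_divide sums_minus sums_sum sums_mult moebius_ln_sums) auto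
  thus "(\<lambda>n. of_int (moebius_mu n) * F_coeff q n * of_nat n powr -w) sums moebius_F_series q w"
    unfolding eq moebius_F_series_def by (simp add: mult_ac)
  have hs: "summable (\<lambda>n. norm (h i n))" for i
  proof (rule summable_comparison_test'[OF summable_ln_powr[of "1 + Re w" i], of 0])
    fix n :: nat
    have "norm (h i n) \<le> 1 * ln (real n) ^ i * real n powr - (1 + Re w)"
    proof (cases "n = 0")
      case False
      show ?thesis unfolding h_def norm_mult norm_of_nat_powr
        by (intro mult_mono norm_moebius_mu_le) (use False in \<open>auto simp: norm_power\<close>)
    qed (simp add: h_def)
    thus "norm (norm (h i n)) \<le> ln (real n) ^ i * real n powr - (1 + Re w)" by simp
  qed (use w in simp)
  have "summable (\<lambda>n. (\<Sum>i=0..q. norm (?a i) * norm (h i n)) / fact q)"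
    by (intro summable_divide summable_sum summable_mult hs)
  thus "summable (\<lambda>n. norm (of_int (moebius_mu n) * F_coeff q n * of_nat n powr -w))"
  proof (rule summable_comparison_test'[where N = 0])
    fix n :: nat
    have "norm (\<Sum>i=0..q. ?a i * h i n) \<le> (\<Sum>i=0..q. norm (?a i) * norm (h i n))"
      by (rule sum_norm_le) (simp add: norm_mult)
    thus "norm (norm (of_int (moebius_mu n) * F_coeff q n * of_nat n powr -w))
        \<le> (\<Sum>i=0..q. norm (?a i) * norm (h i n)) / fact q"
      unfolding eq by (simp add: norm_divide divide_right_mono)
  qed
qed

text \<open>The first part gives measurability of the integrands on \<open>Re z = 1\<close>. The
  second concerns a boundary point and comes from the disc of \<open>inverse_zeta_near_1\<close>; it
  gives the pointwise limit.\<close>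

lemma moebius_F_series_continuous:
  "continuous_on {w. Re w > 0} (moebius_F_series q)" "isCont (moebius_F_series q) 0"
proof -
  have "inverse_zeta holomorphic_on {s. Re s > 1}"
    using zeta_nonzero by (intro holomorphic_intros holomorphic_on_subset[OF riemann_zeta(1)]) auto
  hence c: "continuous_on {s. Re s > 1} ((deriv ^^ i) inverse_zeta)" for i
    by (intro holomorphic_on_imp_continuous_on holomorphic_higher_deriv) (simp_all add: open_halfspace_Re_gt)
  show "continuous_on {w. Re w > 0} (moebius_F_series q)"
    unfolding moebius_F_series_def
    by (intro continuous_intros continuous_on_compose2[OF c]) auto
  obtain R where R: "R > 0" "inverse_zeta holomorphic_on ball 1 R"
    using inverse_zeta_near_1 by metis
  have "isCont ((deriv ^^ i) inverse_zeta) 1" for i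
    using holomorphic_on_imp_continuous_on[OF holomorphic_higher_deriv[OF R(2) open_ball, of i]] R(1)
    by (simp add: continuous_on_eq_continuous_at)
  hence "isCont (\<lambda>w. (deriv ^^ i) inverse_zeta (1 + w)) 0" for i
    using isCont_o2[of 0 "\<lambda>w. 1 + w" "(deriv ^^ i) inverse_zeta"] by simp
  thus "isCont (moebius_F_series q) 0"
    unfolding moebius_F_series_def
    by (intro continuous_divide continuous_minus continuous_sum continuous_mult continuous_const) auto
qed

lemma moebius_F_series_bound:
  assumes "q \<le> 2"
  shows "\<exists>r C. r > 0 \<and> C > 0 \<and> (\<forall>w. 0 < Re w \<and> Re w < r \<longrightarrow>
           norm (moebius_F_series q w) \<le> C * (1 + \<bar>Im w\<bar>) powr (1/2))"
proof -
  let ?P = "\<lambda>i r C. r > 0 \<and> C > 0 \<and> (\<forall>s. 1 < Re s \<and> Re s < 1 + r \<longrightarrow>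
           norm ((deriv ^^ i) inverse_zeta s) \<le> C * (1 + \<bar>Im s\<bar>) powr (1/2))"
  have "\<forall>i\<in>{0..q}. \<exists>r C. ?P i r C" using inverse_zeta_deriv_bound_near_line assms by auto
  then obtain r C where rC: "\<And>i. i \<in> {0..q} \<Longrightarrow> ?P i (r i) (C i)" by metis
  define r0 where "r0 = Min (r ` {0..q})"
  have r0: "r0 > 0" "\<And>i. i \<in> {0..q} \<Longrightarrow> r0 \<le> r i"
    using rC by (auto simp: r0_def)
  let ?a = "\<lambda>i. of_nat (q choose i) * (deriv ^^ (q - i)) (zeta_numerator q) 1 :: complex"
  define D where "D = 1 + (\<Sum>i=0..q. norm (?a i) * C i) / fact q"
  have D: "D > 0" unfolding D_def using rC
    by (intro add_pos_nonneg divide_nonneg_nonneg sum_nonneg mult_nonneg_nonneg) (auto simp: less_imp_le)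
  have "norm (moebius_F_series q w) \<le> D * (1 + \<bar>Im w\<bar>) powr (1/2)" if w: "0 < Re w" "Re w < r0" for w
  proof -
    let ?u = "(1 + \<bar>Im w\<bar>) powr (1/2)"
    have "norm (moebius_F_series q w) = norm (\<Sum>i=0..q. ?a i * (deriv ^^ i) inverse_zeta (1 + w)) / fact q"
      unfolding moebius_F_series_def by (simp add: norm_divide mult_ac)
    also have "\<dots> \<le> (\<Sum>i=0..q. norm (?a i) * (C i * ?u)) / fact q"
    proof (intro divide_right_mono sum_norm_le)
      fix i assume i: "i \<in> {0..q}"
      have "norm ((deriv ^^ i) inverse_zeta (1 + w)) \<le> C i * ?u"
        using rC[OF i] r0(2)[OF i] w by (auto dest!: spec[of _ "1 + w"])
      thus "norm (?a i * (deriv ^^ i) inverse_zeta (1 + w)) \<le> norm (?a i) * (C i * ?u)"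
        unfolding norm_mult[of "?a i"] by (intro mult_left_mono) auto
    qed simp
    also have "\<dots> = (D - 1) * ?u"
      unfolding D_def by (simp add: sum_distrib_right mult.assoc)
    also have "\<dots> \<le> D * ?u" by (intro mult_right_mono) auto
    finally show ?thesis .
  qed
  thus ?thesis using r0(1) D by blast
qed

lemma moebius_F_series_0:
  assumes "q \<in> {1, 2}"
  shows "moebius_F_series q 0 = of_nat q"
proof -
  obtain R where R: "R > 0" "R < 1" "\<And>s. s \<in> ball 1 R \<Longrightarrow> inverse_zeta s = (s - 1) / entire_zeta s"
    "\<And>s. s \<in> ball 1 R \<Longrightarrow> entire_zeta s \<noteq> 0" "inverse_zeta holomorphic_on ball 1 R"
    using inverse_zeta_near_1 by metis
  let ?p = "\<lambda>s. (-1) ^ q * (s - 1) / s ^ q :: complex"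
  have pos: "Re s > 0" if "s \<in> ball 1 R" for s
    using that R(2) abs_Re_le_cmod[of "1 - s"] by (auto simp: dist_norm)
  have H: "zeta_numerator q holomorphic_on ball 1 R"
    by (rule holomorphic_on_subset[OF zeta_numerator_holomorphic]) (use pos in auto)
  have "moebius_F_series q 0 = - (deriv ^^ q) (\<lambda>s. inverse_zeta s * zeta_numerator q s) 1 / fact q"
    unfolding moebius_F_series_def
    by (subst higher_deriv_mult[OF R(5) H]) (use R(1) in auto)
  \<comment> \<open>Near 1 \<open>entire_zeta\<close> cancels between the two factors, so no
    derivative of \<zeta> survives in the rational function \<open>?p\<close>.\<close>
  also have "(deriv ^^ q) (\<lambda>s. inverse_zeta s * zeta_numerator q s) 1 = (deriv ^^ q) ?p 1"
  proof (rule higher_deriv_transform_within_open[where S = "ball 1 R"])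
    show "(\<lambda>s. inverse_zeta s * zeta_numerator q s) holomorphic_on ball 1 R"
      by (intro holomorphic_on_mult R(5) H)
    show "?p holomorphic_on ball 1 R" using pos by (intro holomorphic_intros) force
    show "inverse_zeta s * zeta_numerator q s = ?p s" if "s \<in> ball 1 R" for s
      unfolding R(3)[OF that] zeta_numerator_def using R(4)[OF that] by simp
  qed (use R(1) in auto)
  \<comment> \<open>For \<open>q = 1\<close> the derivative at 1 is -1; for \<open>q = 2\<close> the
    second derivative is -4, to be divided by 2.\<close>
  also have "- (deriv ^^ q) ?p 1 / fact q = of_nat q"
  proof -
    have d1: "deriv (\<lambda>s. - (s - 1) / s) 1 = (-1 :: complex)"
      by (rule DERIV_imp_deriv) (auto intro!: derivative_eq_intros)
    have d2: "deriv (\<lambda>s. (s - 1) / s ^ 2) s = (2 - s) / s ^ 3" if "s \<noteq> 0" for s :: complex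
      by (rule DERIV_imp_deriv) (use that in \<open>auto intro!: derivative_eq_intros simp: field_simps power_numeral_reduce\<close>)
    have "((\<lambda>s. (2 - s) / s ^ 3) has_field_derivative -4) (at (1::complex))"
      by (auto intro!: derivative_eq_intros)
    hence "(deriv (\<lambda>s. (s - 1) / s ^ 2) has_field_derivative -4) (at (1::complex))"
      by (rule has_field_derivative_transform_within_open[of _ _ _ "- {0}"]) (auto simp: d2)
    hence d22: "deriv (deriv (\<lambda>s. (s - 1) / s ^ 2)) 1 = (-4 :: complex)" by (rule DERIV_imp_deriv)
    show ?thesis using assms d1 d22 by (auto simp: numeral_2_eq_2)
  qed
  finally show ?thesis .
qed

section \<open>Perron's formula and the limit\<close>

lemma kernel_integrable: "integrable lborel (\<lambda>t. exp (of_real u * Complex 1 t) / Complex 1 t ^ 2)"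
proof (rule vertical_line_integrable[where T = 0 and K = "exp u * 2"])
  show "continuous_on {s. Re s = 1} (\<lambda>z. exp (of_real u * z) / z ^ 2)"
    by (intro continuous_intros) auto
  show "norm (exp (of_real u * Complex 1 t) / Complex 1 t ^ 2) \<le> exp u * 2 * (1 + \<bar>t\<bar>) powr (- 3 / 2)" for t
  proof -
    have "norm (exp (of_real u * Complex 1 t) / Complex 1 t ^ 2) = exp u * (1 / norm (Complex 1 t) ^ 2)"
      by (simp add: norm_divide norm_power)
    also have "\<dots> \<le> exp u * (2 * (1 + \<bar>t\<bar>) powr (- 3 / 2))"
      using inverse_square_decay[of 1 "Complex 1 t"] by (intro mult_left_mono) auto
    finally show ?thesis by (simp only: mult.assoc)
  qed
qed

text \<open>With \<open>u = 1 - ln n / X\<close> one has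
  \<open>exp (u z) = exp z * n^(-z / X)\<close>, so summing the kernels of
  \<open>perron_kernel\<close> under the integral produces \<open>moebius_F_series\<close> at
  \<open>z / X\<close>. On \<open>Re z = 1\<close> the terms have modulus
  \<open>b n * exp 1 / norm z ^ 2\<close> with b summable, which justifies the exchange.\<close>

lemma perron_sums:
  assumes q: "q \<ge> 1" and X: "X > 0"
  shows "(\<lambda>n. of_int (moebius_mu n) * F_coeff q n * of_real (max (1 - ln (real n) / X) 0)) sums
    (vertical_line_integral 1 (\<lambda>z. exp z * moebius_F_series q (z / of_real X) / z ^ 2) / (2 * of_real pi * \<i>))"
proof -
  define a where "a n = of_int (moebius_mu n) * F_coeff q n" for n
  define u where "u n = 1 - ln (real n) / X" for n :: nat
  define k where "k n t = exp (of_real (u n) * Complex 1 t) / Complex 1 t ^ 2" for n t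
  define b where "b n = norm (a n * of_nat n powr - of_real (1 / X))" for n
  have a0: "a 0 = 0" by (simp add: a_def moebius_mu_def)
  have k: "integrable lborel (k n)" for n
    unfolding k_def by (rule kernel_integrable)
  have k': "integrable lborel (\<lambda>t. norm (k n t))" for n
    using k by (rule integrable_norm)
  have b: "summable b"
    unfolding a_def b_def by (rule moebius_F_sums(2)[OF q]) (use X in simp)
  have nf: "norm (a n * k n t * \<i>) = b n * (exp 1 / norm (Complex 1 t) ^ 2)" for n t
  proof (cases "n = 0")
    case False
    have "exp (u n) = exp 1 * real n powr - (1 / X)"
      using False by (simp add: u_def powr_def flip: exp_add)
    moreover have "norm (of_nat n powr - of_real (1 / X) :: complex) = real n powr - (1 / X)"
      unfolding norm_of_nat_powr by simp
    ultimately show ?thesis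
      unfolding b_def k_def by (simp add: norm_mult norm_divide norm_power)
  qed (simp add: a0 b_def)
  have S: "(\<lambda>n. LINT t|lborel. a n * k n t * \<i>) sums (LINT t|lborel. (\<Sum>n. a n * k n t * \<i>))"
  proof (rule sums_integral)
    show "integrable lborel (\<lambda>t. a n * k n t * \<i>)" for n
      by (intro integrable_mult_left integrable_mult_right k)
    show "AE t in lborel. summable (\<lambda>n. norm (a n * k n t * \<i>))"
      unfolding nf by (intro AE_I2 summable_mult2 b)
    have "(LINT t|lborel. norm (a n * k n t * \<i>)) = b n * (LINT t|lborel. exp 1 / norm (Complex 1 t) ^ 2)" for n
      unfolding nf by (rule integral_mult_right_zero)
    thus "summable (\<lambda>n. LINT t|lborel. norm (a n * k n t * \<i>))"
      by (simp only: summable_mult2[OF b])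
  qed
  have L: "(LINT t|lborel. a n * k n t * \<i>) = 2 * of_real pi * \<i> * (a n * of_real (max (u n) 0))" for n
  proof -
    have "(LINT t|lborel. a n * k n t * \<i>) = a n * vertical_line_integral 1 (\<lambda>z. exp (of_real (u n) * z) / z ^ 2)"
      unfolding vertical_line_integral_def k_def mult.assoc by (rule integral_mult_right_zero)
    thus ?thesis unfolding perron_kernel by simp
  qed
  have R: "(\<Sum>n. a n * k n t * \<i>) = exp (Complex 1 t) * moebius_F_series q (Complex 1 t / of_real X) / Complex 1 t ^ 2 * \<i>" for t
  proof -
    let ?z = "Complex 1 t"
    have "Re (?z / of_real X) > 0" using X by (simp add: Re_divide_of_real)
    from moebius_F_sums(1)[OF q this]
    have "(\<lambda>n. a n * of_nat n powr - (?z / of_real X)) sums moebius_F_series q (?z / of_real X)"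
      unfolding a_def .
    hence "(\<lambda>n. exp ?z * (a n * of_nat n powr - (?z / of_real X)) / ?z ^ 2 * \<i>)
      sums (exp ?z * moebius_F_series q (?z / of_real X) / ?z ^ 2 * \<i>)"
      by (intro sums_mult sums_mult2 sums_divide)
    moreover have "exp ?z * (a n * of_nat n powr - (?z / of_real X)) / ?z ^ 2 * \<i> = a n * k n t * \<i>" for n
    proof (cases "n = 0")
      case False
      have "of_real (u n) * ?z = ?z + - (?z / of_real X) * of_real (ln (real n))"
        unfolding u_def by (simp add: algebra_simps)
      hence "exp (of_real (u n) * ?z) = exp ?z * of_nat n powr - (?z / of_real X)"
        using False by (simp add: powr_def exp_diff exp_minus divide_inverse)
      thus ?thesis unfolding k_def by simp
    qed (simp add: a0)
    ultimately show ?thesis by (simp add: sums_iff)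
  qed
  have "2 * of_real pi * \<i> * x / (2 * of_real pi * \<i>) = x" for x :: complex by simp
  with sums_divide[OF S[unfolded L R], of "2 * of_real pi * \<i>"] show ?thesis
    unfolding vertical_line_integral_def a_def[symmetric] u_def[symmetric] by (simp only:)
qed

text \<open>For \<open>X \<ge> 1\<close> the height of \<open>z / X\<close> is at most that of z, so
  the growth bound at \<open>z / X\<close> is dominated by one that is free of N.\<close>

lemma perron_integral_tendsto:
  assumes q: "q \<le> 2"
  shows "(\<lambda>N. vertical_line_integral 1 (\<lambda>z. exp z * moebius_F_series q (z / of_real (ln (real N))) / z ^ 2))
     \<longlonglongrightarrow> vertical_line_integral 1 (\<lambda>z. exp z * moebius_F_series q 0 / z ^ 2)"
proof -
  let ?G = "moebius_F_series q"
  obtain r C where r: "r > 0" and C: "C > 0"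
    and G: "\<And>w. 0 < Re w \<Longrightarrow> Re w < r \<Longrightarrow> norm (?G w) \<le> C * (1 + \<bar>Im w\<bar>) powr (1/2)"
    using moebius_F_series_bound[OF q] by blast
  have lnlim: "filterlim (\<lambda>N. ln (real N)) at_top sequentially" by real_asymp
  hence "eventually (\<lambda>N. ln (real N) > max 1 (1 / r)) sequentially"
    by (rule filterlim_at_top_dense[THEN iffD1, rule_format])
  then obtain N0 where N0: "\<And>N. N \<ge> N0 \<Longrightarrow> ln (real N) > max 1 (1 / r)"
    by (auto simp: eventually_at_top_linorder)
  \<comment> \<open>The index is shifted so that the majorant holds for every term:
    \<open>1 / X N\<close>, the real part of the argument, is below r, and
    \<open>X N > 1\<close>.\<close>
  define X where "X N = ln (real (N + N0))" for N
  have X: "X N > 1" "1 / X N < r" for N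
  proof -
    have "X N > max 1 (1 / r)" unfolding X_def by (rule N0) simp
    thus "X N > 1" "1 / X N < r" using r by (auto simp: field_simps)
  qed
  have Xlim: "filterlim X at_top sequentially"
    unfolding X_def by (rule filterlim_compose[OF lnlim]) (rule filterlim_add_const_nat_at_top)
  have "(\<lambda>N. LINT t|lborel. exp (Complex 1 t) * ?G (Complex 1 t / of_real (X N)) / Complex 1 t ^ 2 * \<i>)
     \<longlonglongrightarrow> (LINT t|lborel. exp (Complex 1 t) * ?G 0 / Complex 1 t ^ 2 * \<i>)"
  proof (rule integral_dominated_convergence[where w = "\<lambda>t. exp 1 * C * 2 * (1 + \<bar>t\<bar>) powr (- 3 / 2)"])
    have z: "continuous_on UNIV (Complex 1)" by (auto simp: Complex_eq intro!: continuous_intros)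
    have z0: "Complex 1 t \<noteq> 0" for t by (simp add: complex_eq_iff)
    have "continuous_on UNIV (\<lambda>t. exp (Complex 1 t) * ?G 0 / Complex 1 t ^ 2 * \<i>)"
      by (intro continuous_intros z) (use z0 in auto)
    thus "(\<lambda>t. exp (Complex 1 t) * ?G 0 / Complex 1 t ^ 2 * \<i>) \<in> borel_measurable lborel"
      using borel_measurable_continuous_onI by simp
    have zX: "continuous_on UNIV (\<lambda>t. Complex 1 t / of_real (X N))" for N
      using X(1)[of N] by (intro continuous_intros z) auto
    have "continuous_on UNIV (\<lambda>t. ?G (Complex 1 t / of_real (X N)))" for N
      by (rule continuous_on_compose2[OF moebius_F_series_continuous(1) zX])
         (use X(1)[of N] in \<open>auto simp: Re_divide_of_real\<close>)
    hence m: "continuous_on UNIV (\<lambda>t. exp (Complex 1 t) * ?G (Complex 1 t / of_real (X N)) / Complex 1 t ^ 2 * \<i>)" for N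
      by (intro continuous_on_mult continuous_on_divide continuous_on_power continuous_on_exp z continuous_on_const)
         (use z0 in auto)
    show "(\<lambda>t. exp (Complex 1 t) * ?G (Complex 1 t / of_real (X N)) / Complex 1 t ^ 2 * \<i>) \<in> borel_measurable lborel" for N
      using borel_measurable_continuous_onI[OF m] by simp
    show "integrable lborel (\<lambda>t. exp 1 * C * 2 * (1 + \<bar>t\<bar>) powr (- 3 / 2))"
      using integrable_decay by (intro integrable_mult_right)
    show "AE t in lborel. (\<lambda>N. exp (Complex 1 t) * ?G (Complex 1 t / of_real (X N)) / Complex 1 t ^ 2 * \<i>)
        \<longlonglongrightarrow> exp (Complex 1 t) * ?G 0 / Complex 1 t ^ 2 * \<i>"
    proof (rule AE_I2)
      fix t
      have "(\<lambda>N. 1 / X N) \<longlonglongrightarrow> 0" by (rule real_tendsto_divide_at_top[OF tendsto_const Xlim])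
      hence "(\<lambda>N. Complex 1 t * of_real (1 / X N)) \<longlonglongrightarrow> Complex 1 t * of_real 0"
        by (intro tendsto_intros)
      hence "(\<lambda>N. Complex 1 t / of_real (X N)) \<longlonglongrightarrow> 0" by (simp add: divide_inverse)
      from isCont_tendsto_compose[OF moebius_F_series_continuous(2) this]
      show "(\<lambda>N. exp (Complex 1 t) * ?G (Complex 1 t / of_real (X N)) / Complex 1 t ^ 2 * \<i>)
        \<longlonglongrightarrow> exp (Complex 1 t) * ?G 0 / Complex 1 t ^ 2 * \<i>"
        by (intro tendsto_intros) (use z0 in auto)
    qed
    show "AE t in lborel. norm (exp (Complex 1 t) * ?G (Complex 1 t / of_real (X N)) / Complex 1 t ^ 2 * \<i>)
        \<le> exp 1 * C * 2 * (1 + \<bar>t\<bar>) powr (- 3 / 2)" for N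
    proof (rule AE_I2)
      fix t :: real
      let ?z = "Complex 1 t" and ?u = "1 + \<bar>t\<bar>"
      have "norm (?G (?z / of_real (X N))) \<le> C * (1 + \<bar>Im (?z / of_real (X N))\<bar>) powr (1/2)"
        using X[of N] by (intro G) (auto simp: Re_divide_of_real)
      also have "\<dots> \<le> C * ?u powr (1/2)"
      proof (intro mult_left_mono powr_mono2)
        have "\<bar>t\<bar> / X N \<le> \<bar>t\<bar> / 1" using X(1)[of N] by (intro divide_left_mono) auto
        thus "1 + \<bar>Im (?z / of_real (X N))\<bar> \<le> ?u"
          using X(1)[of N] by (simp add: Im_divide_of_real)
      qed (use C in auto)
      finally have g: "norm (?G (?z / of_real (X N))) \<le> C * ?u powr (1/2)" .
      have "?u ^ 2 \<le> 2 * (1 + t\<^sup>2)"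
        using zero_le_power2[of "1 - \<bar>t\<bar>"] by (simp add: power2_eq_square algebra_simps)
      hence "1 / (1 + t\<^sup>2) \<le> 2 / ?u ^ 2"
        by (simp add: divide_le_eq le_divide_eq field_simps add_pos_nonneg)
      hence d: "1 / norm ?z ^ 2 \<le> 2 / ?u ^ 2" by (simp add: cmod_power2)
      have "norm (exp ?z * ?G (?z / of_real (X N)) / ?z ^ 2 * \<i>) = exp 1 * norm (?G (?z / of_real (X N))) * (1 / norm ?z ^ 2)"
        by (simp add: norm_mult norm_divide norm_power)
      also have "\<dots> \<le> exp 1 * (C * ?u powr (1/2)) * (2 / ?u ^ 2)"
        using g d C by (intro mult_mono) auto
      also have "\<dots> = exp 1 * C * 2 * (?u powr (1/2) / ?u powr 2)" by simp
      also have "?u powr (1/2) / ?u powr 2 = ?u powr (- 3 / 2)"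
        unfolding powr_diff[symmetric] by simp
      finally show "norm (exp ?z * ?G (?z / of_real (X N)) / ?z ^ 2 * \<i>) \<le> exp 1 * C * 2 * ?u powr (- 3 / 2)" .
    qed
  qed
  hence "(\<lambda>N. vertical_line_integral 1 (\<lambda>z. exp z * ?G (z / of_real (ln (real (N + N0)))) / z ^ 2))
     \<longlonglongrightarrow> vertical_line_integral 1 (\<lambda>z. exp z * ?G 0 / z ^ 2)"
    unfolding vertical_line_integral_def X_def .
  thus ?thesis
    by (rule LIMSEQ_offset[where k = N0 and f = "\<lambda>N. vertical_line_integral 1
          (\<lambda>z. exp z * ?G (z / of_real (ln (real N))) / z ^ 2)"])
qed

theorem proposition1p1:
  fixes q :: nat
  assumes "q \<in> {1, 2}"
  shows "(\<lambda>N::nat. \<Sum>n=1..N. of_real (lambda_coeff n N) * F_coeff q n) \<longlonglongrightarrow> of_nat q"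
proof -
  let ?V = "\<lambda>N. vertical_line_integral 1 (\<lambda>z. exp z * moebius_F_series q (z / of_real (ln (real N))) / z ^ 2)"
  have q: "q \<ge> 1" "q \<le> 2" using assms by auto
  have fin: "(\<Sum>n=1..N. of_real (lambda_coeff n N) * F_coeff q n) = ?V N / (2 * of_real pi * \<i>)"
    if N: "N \<ge> 2" for N
  proof -
    \<comment> \<open>The maximum with 0 extends the finite sum to all n: it vanishes beyond N, and
      at \<open>n = 0\<close> the Moebius factor does.\<close>
    let ?f = "\<lambda>n. of_int (moebius_mu n) * F_coeff q n * of_real (max (1 - ln (real n) / ln (real N)) 0)"
    have lnN: "ln (real N) > 0" using N by simp
    have "?f sums (\<Sum>n=1..N. ?f n)"
    proof (rule sums_finite)
      fix n assume "n \<notin> {1..N}"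
      then consider "n = 0" | "n > N" by fastforce
      thus "?f n = 0"
      proof cases
        case 2
        hence "ln (real N) \<le> ln (real n)" using N by simp
        hence "1 - ln (real n) / ln (real N) \<le> 0" using lnN by (simp add: field_simps)
        thus ?thesis by (simp add: max_def)
      qed (simp add: moebius_mu_def)
    qed simp
    hence "(\<Sum>n=1..N. ?f n) = ?V N / (2 * of_real pi * \<i>)"
      using perron_sums[OF q(1) lnN] by (rule sums_unique2)
    moreover have "?f n = of_real (lambda_coeff n N) * F_coeff q n" if "n \<in> {1..N}" for n
    proof -
      have "ln (real n) / ln (real N) \<le> 1" using that lnN by simp
      thus ?thesis by (simp add: lambda_coeff_def max_def mult_ac)
    qed
    ultimately show ?thesis by (metis (no_types, lifting) sum.cong)
  qed
  \<comment> \<open>In the limit only the Perron kernel at \<open>u = 1\<close> remains, and its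
    integral is \<open>2 * pi * \<i>\<close>.\<close>
  have "vertical_line_integral 1 (\<lambda>z. exp z * moebius_F_series q 0 / z ^ 2)
      = moebius_F_series q 0 * vertical_line_integral 1 (\<lambda>z. exp (of_real 1 * z) / z ^ 2)"
    unfolding vertical_line_integral_def
    by (subst integral_mult_right_zero[symmetric]) (simp add: mult_ac)
  also have "\<dots> = of_nat q * (2 * of_real pi * \<i>)"
    unfolding perron_kernel using moebius_F_series_0[OF assms] by simp
  finally have "?V \<longlonglongrightarrow> of_nat q * (2 * of_real pi * \<i>)"
    using perron_integral_tendsto[OF q(2)] by (simp only:)
  hence "(\<lambda>N. ?V N / (2 * of_real pi * \<i>)) \<longlonglongrightarrow> of_nat q * (2 * of_real pi * \<i>) / (2 * of_real pi * \<i>)"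
    by (intro tendsto_intros) auto
  hence "(\<lambda>N. ?V N / (2 * of_real pi * \<i>)) \<longlonglongrightarrow> of_nat q" by simp
  thus ?thesis
    by (rule Lim_transform_eventually)
       (use fin in \<open>auto intro!: eventually_sequentiallyI[of 2]\<close>)
qed

end
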